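(* Let $\mu$ be the connective constant of $\mathbb Z^2$. For every $k>0$ and every self-avoiding path $\gamma$ of length $k$ in $\bar{\mathbb H}$ started at $\ast$, the following hold. 1. For every $m\ge1$, $\varphi^{\lambda,m}(\gamma)$ converges as $\lambda$ decreases to $\lambda_m$; let $\varphi^{(m)}(\gamma):=\lim_{\lambda\searrow\lambda_m}\varphi^{\lambda,m}(\gamma)$. 2. $\varphi^{(m)}(\gamma)$ converges as $m\to\infty$; let $\varphi^{(\infty)}(\gamma):=\lim_{m\to\infty}\varphi^{(m)}(\gamma)$. 3. For every $\lambda>\mu^{-1}$, $\varphi^{\lambda,m}(\gamma)\to\varphi^{\lambda}(\gamma)$ as $m\to\infty$ (so that, together with 1 and 2, $\varphi^{\lambda,m}(\gamma)\to\varphi^{(m)}(\gamma)$ as $\lambda\searrow\lambda_m$ and $\varphi^{(m)}(\gamma)\to\varphi^{(\infty)}(\gamma)$ as $m\to\infty$).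
   Context: $\mathbb H=\{(x,y)\in\mathbb Z^2:y\ge0\}$ with nearest-neighbour edges, $\ast=(0,-1)$, and $\bar{\mathbb H}=\mathbb H\cup\{\ast\}$, where $\ast$ is adjacent to $(0,0)$. The connective constant is $\mu=\lim c_n^{1/n}$ with $c_n$ the number of self-avoiding walks of length $n$ in $\mathbb Z^2$ from the origin. The self-avoiding tree $\mathcal T_{\bar{\mathbb H}}$ has as vertices the finite self-avoiding walks in $\bar{\mathbb H}$ started at $\ast$, two being adjacent when one is a one-step extension of the other; its root is the walk of length $0$. A bridge of length $n\geq 1$ is a self-avoiding walk $\gamma$ of length $n$ such that the vertical coordinate $y$ satisfies $y(\gamma(0))<y(\gamma(i))\le y(\gamma(n))$ for $1\le i\le n$. A bridge is irreducible if there is no $i\in\{1,\dots,n-1\}$ such that both $\gamma|_{[0,i]}$ and $\gamma|_{[i,n]}$ are bridges. For $m\ge1$, an infinite self-avoiding path started at $\ast$ is $m$-good if it is an infinite concatenation of irreducible bridges of length at most $m$. The $m$-good tree $\mathcal T^{(m)}_{\bar{\mathbb H}}$ is the subtree of $\mathcal T_{\bar{\mathbb H}}$ spanned by those finite walks that are prefixes of some $m$-good infinite path. For $\lambda>0$ and an infinite, locally finite rooted tree $\mathcal T$ with root $o$, $RW_\lambda$ is the Markov chain started at $o$ which, at a vertex $x\ne o$ with $j$ children, jumps to the parent of $x$ with probability $1/(1+j\lambda)$ and to each child with probability $\lambda/(1+j\lambda)$; from $o$ it jumps to a uniformly chosen child. $\lambda_c(\mathcal T)$ is the critical value (recurrent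 for $\lambda<\lambda_c$, transient for $\lambda>\lambda_c$). When $RW_\lambda=(X_n)$ is transient, the limit walk is the random ray whose vertex at distance $i$ from the root is the vertex $\nu$ at that distance such that $X_n$ lies in the subtree of descendants of $\nu$ for all large $n$; a ray of the trees above is identified with an infinite self-avoiding path in $\bar{\mathbb H}$ from $\ast$. Put $\lambda_m:=\lambda_c(\mathcal T^{(m)}_{\bar{\mathbb H}})$; one has $\lambda_c(\mathcal T_{\bar{\mathbb H}})=\mu^{-1}$ and $\lambda_m\to\mu^{-1}$. For $\gamma$ of length $k$, $\varphi^\lambda(\gamma)$ (defined for $\lambda>\mu^{-1}$) and $\varphi^{\lambda,m}(\gamma)$ (defined for $\lambda>\lambda_m$) are the probabilities that $\gamma$ is the prefix of length $k$ of the limit walk with parameter $\lambda$ on $\mathcal T_{\bar{\mathbb H}}$ and on $\mathcal T^{(m)}_{\bar{\mathbb H}}$, respectively. In item 3, the sequence is considered for $m$ large enough that $\lambda_m<\lambda$. *)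

theory Defs
  imports "HOL-Probability.Probability" "HOL-Library.Sublist"
begin

section \<open>Self-avoiding walks\<close>

type_synonym point = "int \<times> int"

text \<open>A finite walk of length \<open>n\<close> is the list of its \<open>n + 1\<close> vertices.\<close>

definition walk_length :: "'a list \<Rightarrow> nat" where
  "walk_length w = length w - 1"

definition self_avoiding_walk :: "('a \<Rightarrow> 'a \<Rightarrow> bool) \<Rightarrow> 'a list \<Rightarrow> bool" where
  "self_avoiding_walk adj w \<longleftrightarrow> w \<noteq> [] \<and> successively adj w \<and> distinct w"

definition initial_walk :: "(nat \<Rightarrow> 'a) \<Rightarrow> nat \<Rightarrow> 'a list" where
  "initial_walk p n = map p [0..<Suc n]"

definition lattice_adj :: "point \<Rightarrow> point \<Rightarrow> bool" where
  "lattice_adj u v \<longleftrightarrow> \<bar>fst u - fst v\<bar> + \<bar>snd u - snd v\<bar> = 1"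

definition num_saws :: "nat \<Rightarrow> nat" where
  "num_saws n = card {w. self_avoiding_walk lattice_adj w \<and> walk_length w = n \<and> hd w = (0, 0)}"

definition connective_constant :: real where
  "connective_constant = lim (\<lambda>n. root n (real (num_saws n)))"

definition half_plane :: "point set" where
  "half_plane = {v. snd v \<ge> 0}"

definition ast :: point where
  "ast = (0, -1)"

definition ext_half_plane_adj :: "point \<Rightarrow> point \<Rightarrow> bool" where
  "ext_half_plane_adj u v \<longleftrightarrow>
     (u \<in> half_plane \<and> v \<in> half_plane \<and> lattice_adj u v) \<or>
     (u = ast \<and> v = (0, 0)) \<or> (u = (0, 0) \<and> v = ast)"


section \<open>Random walks on trees of walks\<close>

text \<open>
  A rooted tree of walks with root \<open>r\<close> is a set of lists containing \<open>r\<close>, all of whose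
  members extend \<open>r\<close>, and that is closed under removing the last vertex from a member
  other than \<open>r\<close>. Its edges are the one-step extensions, so the distance of a walk from
  a root of length 0 is the length of the walk.
\<close>

definition children :: "'a list set \<Rightarrow> 'a list \<Rightarrow> 'a list set" where
  "children T x = {y \<in> T. \<exists>v. y = x @ [v]}"

definition parent :: "'a list \<Rightarrow> 'a list" where
  "parent x = butlast x"

definition rw_step :: "'a list set \<Rightarrow> 'a list \<Rightarrow> real \<Rightarrow> 'a list \<Rightarrow> 'a list pmf" where
  "rw_step T r lam x =
     (if x = r then pmf_of_set (children T r)
      else embed_pmf (\<lambda>y.
        if y = parent x then 1 / (1 + real (card (children T x)) * lam)
        else if y \<in> children T x then lam / (1 + real (card (children T x)) * lam)
        else 0))"

text \<open>The mass function in \<^const>\<open>rw_step\<close> is a probability mass function.\<close>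

lemma pmf_rw_step:
  assumes "lam > 0" "finite (children T x)" "x \<noteq> r" "x \<noteq> []"
  shows "pmf (rw_step T r lam x) y =
    (if y = parent x then 1 / (1 + real (card (children T x)) * lam)
     else if y \<in> children T x then lam / (1 + real (card (children T x)) * lam)
     else 0)"
proof -
  let ?C = "children T x" and ?d = "1 + real (card (children T x)) * lam"
  let ?f = "\<lambda>y. if y = parent x then 1 / ?d else if y \<in> ?C then lam / ?d else 0"
  have d: "?d > 0"
    using assms(1) by (simp add: add_pos_nonneg)
  have nn: "?f y \<ge> 0" for y
    using assms(1) d by simp
  have pC: "parent x \<notin> ?C"
    using assms(4) by (auto simp: children_def parent_def dest!: arg_cong[where f = length])
  have "(\<integral>\<^sup>+ y. ennreal (?f y) \<partial>count_space UNIV)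
      = (\<integral>\<^sup>+ y. ennreal (?f y) \<partial>count_space (insert (parent x) ?C))"
    by (rule nn_integral_count_space_eq) auto
  also have "\<dots> = (\<Sum>y\<in>insert (parent x) ?C. ennreal (?f y))"
    using assms(2) by (intro nn_integral_count_space_finite) auto
  also have "\<dots> = ennreal (\<Sum>y\<in>insert (parent x) ?C. ?f y)"
    using nn by (intro sum_ennreal) auto
  also have "(\<Sum>y\<in>insert (parent x) ?C. ?f y) = 1 / ?d + (\<Sum>y\<in>?C. lam / ?d)"
  proof -
    have "(\<Sum>y\<in>?C. ?f y) = (\<Sum>y\<in>?C. lam / ?d)"
      using pC by (intro sum.cong) auto
    then show ?thesis
      using assms(2) pC by simp
  qed
  also have "\<dots> = 1"
    using d by (simp add: field_simps)
  finally have "(\<integral>\<^sup>+ y. ennreal (?f y) \<partial>count_space UNIV) = 1"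
    by simp
  with nn have "pmf (embed_pmf ?f) y = ?f y"
    by (intro pmf_embed_pmf) auto
  then show ?thesis
    using assms(3) by (simp add: rw_step_def)
qed

text \<open>
  Law on trajectories of the time-homogeneous Markov chain with transition kernel \<open>K\<close>
  started at \<open>x\<close>, given by the Ionescu-Tulcea construction.
\<close>

definition markov_kernels :: "('a \<Rightarrow> 'a pmf) \<Rightarrow> 'a \<Rightarrow> nat \<Rightarrow> (nat \<Rightarrow> 'a) \<Rightarrow> 'a measure" where
  "markov_kernels K x n \<omega> = measure_pmf (if n = 0 then return_pmf x else K (\<omega> (n - 1)))"

lemma measurable_markov_kernels:
  "markov_kernels K x i
     \<in> measurable (\<Pi>\<^sub>M j\<in>{0..<i}. count_space UNIV) (subprob_algebra (count_space UNIV))"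
proof (cases i)
  case 0
  then show ?thesis
    by (simp add: markov_kernels_def [abs_def] measure_pmf_in_subprob_algebra)
next
  case (Suc n)
  have "(\<lambda>y. measure_pmf (K y))
      \<in> measurable (count_space UNIV) (subprob_algebra (count_space UNIV))"
    by (simp add: measure_pmf_in_subprob_algebra)
  moreover have "(\<lambda>\<omega>. \<omega> n) \<in> measurable (\<Pi>\<^sub>M j\<in>{0..<i}. count_space UNIV) (count_space UNIV)"
    using Suc by (intro measurable_component_singleton) auto
  ultimately show ?thesis
    using Suc by (simp add: markov_kernels_def [abs_def] measurable_compose)
qed

interpretation markov: Ionescu_Tulcea "markov_kernels K x" "\<lambda>_. count_space UNIV"
  for K :: "'a \<Rightarrow> 'a pmf" and x :: 'a
  by (rule Ionescu_Tulcea.intro)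
     (simp_all add: measurable_markov_kernels markov_kernels_def prob_space_measure_pmf)

definition markov_law :: "('a \<Rightarrow> 'a pmf) \<Rightarrow> 'a \<Rightarrow> (nat \<Rightarrow> 'a) measure" where
  "markov_law K x = markov.PF.lim K x"

lemma sets_markov_law: "sets (markov_law K x) = sets (\<Pi>\<^sub>M i\<in>UNIV. count_space UNIV)"
  by (simp add: markov_law_def)

lemma emeasure_markov_law_cylinder:
  "emeasure (markov_law K x) {\<omega>. \<forall>i\<le>n. \<omega> i = y i} =
     ennreal (of_bool (y 0 = x) * (\<Prod>i<n. pmf (K (y i)) (y (Suc i))))"
proof -
  let ?M = "\<lambda>_::nat. count_space (UNIV :: 'a set)"
  let ?u = "\<lambda>_::nat. undefined :: 'a"
  let ?q = "\<lambda>i. pmf (if i = 0 then return_pmf x else K (y (i - 1))) (y i)"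
  let ?A = "\<lambda>m. PiE {0..<m} (\<lambda>i. {y i})"
  have sets_A [measurable]: "?A m \<in> sets (PiM {0..<m} ?M)" for m
    by (intro sets_PiM_I_finite) auto
  have u: "?u \<in> space (PiM {0..<0} ?M)"
    by (simp add: space_PiM)
  have finite_dim: "emeasure (markov.C K x 0 m ?u) (?A m) = ennreal (\<Prod>i<m. ?q i)" for m
  proof (induction m)
    case 0
    show ?case
      using sets_A[of 0] by (simp add: PiE_empty_domain)
  next
    case (Suc m)
    have step: "emeasure (markov.eP K x m \<omega>) (?A (Suc m)) = ennreal (?q m) * indicator (?A m) \<omega>"
      if \<omega>: "\<omega> \<in> space (PiM {0..<m} ?M)" for \<omega>
    proof -
      have "emeasure (markov.eP K x m \<omega>) (?A (Suc m))
          = emeasure (markov_kernels K x m \<omega>) ((\<lambda>z. fun_upd \<omega> m z) -` ?A (Suc m))"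
        using markov.emeasure_eP[OF \<omega> sets_A[of "Suc m"]] by simp
      also have "(\<lambda>z. fun_upd \<omega> m z) -` ?A (Suc m) = (if \<omega> \<in> ?A m then {y m} else {})"
      proof (intro set_eqI)
        fix z
        have undef: "\<omega> i = undefined" if "i \<ge> m" for i
          using \<omega> that by (auto simp: space_PiM PiE_iff extensional_def)
        have "fun_upd \<omega> m z \<in> ?A (Suc m) \<longleftrightarrow> z = y m \<and> (\<forall>i<m. \<omega> i = y i)"
          using undef by (auto simp: PiE_iff extensional_def less_Suc_eq)
        moreover have "\<omega> \<in> ?A m \<longleftrightarrow> (\<forall>i<m. \<omega> i = y i)"
          using undef by (auto simp: PiE_iff extensional_def)
        ultimately show "z \<in> fun_upd \<omega> m -` ?A (Suc m) \<longleftrightarrow> z \<in> (if \<omega> \<in> ?A m then {y m} else {})"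
          by simp
      qed
      also have "emeasure (markov_kernels K x m \<omega>) \<dots> = ennreal (?q m) * indicator (?A m) \<omega>"
        by (cases m) (auto simp: markov_kernels_def emeasure_pmf_single PiE_iff split: split_indicator)
      finally show ?thesis .
    qed
    have sets_C: "sets (markov.C K x 0 m ?u) = sets (PiM {0..<m} ?M)"
      using markov.sets_C[OF u, of K x m] by simp
    have space_C: "space (markov.C K x 0 m ?u) = space (PiM {0..<m} ?M)"
      using markov.space_C[OF u, of K x m] by simp
    have "emeasure (markov.C K x 0 (Suc m) ?u) (?A (Suc m))
        = (\<integral>\<^sup>+\<omega>. emeasure (markov.eP K x m \<omega>) (?A (Suc m)) \<partial>markov.C K x 0 m ?u)"
      unfolding markov.C.simps add_0
    proof (rule emeasure_bind)
      show "space (markov.C K x 0 m ?u) \<noteq> {}"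
        unfolding space_C by (simp add: space_PiM_empty_iff)
      show "markov.eP K x m
          \<in> measurable (markov.C K x 0 m ?u) (subprob_algebra (PiM {0..<Suc m} ?M))"
        using markov.measurable_eP[of K x m] measurable_cong_sets[OF sets_C refl] by blast
    qed (rule sets_A)
    also have "\<dots> = (\<integral>\<^sup>+\<omega>. ennreal (?q m) * indicator (?A m) \<omega> \<partial>markov.C K x 0 m ?u)"
      using step space_C by (intro nn_integral_cong) auto
    also have "\<dots> = ennreal (?q m) * emeasure (markov.C K x 0 m ?u) (?A m)"
      using sets_A[of m] sets_C by (intro nn_integral_cmult_indicator) auto
    also have "\<dots> = ennreal (\<Prod>i<Suc m. ?q i)"
      by (simp add: Suc ennreal_mult'' prod_nonneg mult.commute)
    finally show ?case .
  qed
  have "{\<omega>. \<forall>i\<le>n. \<omega> i = y i} = prod_emb UNIV ?M {0..<Suc n} (?A (Suc n))"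
    by (auto simp: prod_emb_def PiE_iff less_Suc_eq_le restrict_def space_PiM)
  then have "emeasure (markov_law K x) {\<omega>. \<forall>i\<le>n. \<omega> i = y i}
      = emeasure (markov.CI K x {0..<Suc n}) (?A (Suc n))"
    unfolding markov_law_def using markov.lim[OF _ sets_A[of "Suc n"]] by simp
  also have "\<dots> = emeasure (markov.C K x 0 (Suc n) ?u) (prod_emb {0..<Suc n} ?M {0..<Suc n} (?A (Suc n)))"
    by (rule markov.emeasure_CI[OF _ sets_A]) simp
  also have "prod_emb {0..<Suc n} ?M {0..<Suc n} (?A (Suc n)) = ?A (Suc n)"
    by (rule prod_emb_id) (auto simp: PiE_iff)
  also have "emeasure (markov.C K x 0 (Suc n) ?u) (?A (Suc n)) = ennreal (\<Prod>i<Suc n. ?q i)"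
    by (rule finite_dim)
  also have "(\<Prod>i<Suc n. ?q i) = of_bool (y 0 = x) * (\<Prod>i<n. pmf (K (y i)) (y (Suc i)))"
    by (simp add: prod.lessThan_Suc_shift del: prod.lessThan_Suc)
  finally show ?thesis .
qed

definition RW :: "'a list set \<Rightarrow> 'a list \<Rightarrow> real \<Rightarrow> (nat \<Rightarrow> 'a list) measure" where
  "RW T r lam = markov_law (rw_step T r lam) r"

definition RW_recurrent :: "'a list set \<Rightarrow> 'a list \<Rightarrow> real \<Rightarrow> bool" where
  "RW_recurrent T r lam \<longleftrightarrow> (AE X in RW T r lam. \<exists>n>0. X n = r)"

definition RW_transient :: "'a list set \<Rightarrow> 'a list \<Rightarrow> real \<Rightarrow> bool" where
  "RW_transient T r lam \<longleftrightarrow> \<not> RW_recurrent T r lam"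

definition critical_value :: "'a list set \<Rightarrow> 'a list \<Rightarrow> real" where
  "critical_value T r = (THE c. c \<ge> 0 \<and>
     (\<forall>lam>0. (lam < c \<longrightarrow> RW_recurrent T r lam) \<and> (lam > c \<longrightarrow> RW_transient T r lam)))"

text \<open>
  The limit walk of the trajectory \<open>X\<close>, with the ray identified with the infinite path \<open>p\<close>
  whose initial walks are its vertices; the descendants of \<open>\<nu>\<close> (including \<open>\<nu>\<close>) are the
  members of \<open>T\<close> that have \<open>\<nu>\<close> as a prefix.
\<close>

definition is_limit_walk :: "'a list set \<Rightarrow> (nat \<Rightarrow> 'a list) \<Rightarrow> (nat \<Rightarrow> 'a) \<Rightarrow> bool" where
  "is_limit_walk T X p \<longleftrightarrow>
     (\<forall>i. initial_walk p i \<in> T \<and>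
        (\<forall>\<^sub>F n in sequentially. X n \<in> {x \<in> T. prefix (initial_walk p i) x}))"

definition limit_walk_prob :: "'a list set \<Rightarrow> 'a list \<Rightarrow> real \<Rightarrow> 'a list \<Rightarrow> real" where
  "limit_walk_prob T r lam \<gamma> = measure (RW T r lam)
     {X \<in> space (RW T r lam). \<exists>p. is_limit_walk T X p \<and> initial_walk p (walk_length \<gamma>) = \<gamma>}"


section \<open>The self-avoiding tree and the good trees\<close>

definition saw_tree :: "point list set" where
  "saw_tree = {w. self_avoiding_walk ext_half_plane_adj w \<and> hd w = ast}"

definition is_bridge :: "point list \<Rightarrow> bool" where
  "is_bridge w \<longleftrightarrow> self_avoiding_walk lattice_adj w \<and> walk_length w \<ge> 1 \<and>
     (\<forall>i\<in>{1..walk_length w}.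
        snd (w ! 0) < snd (w ! i) \<and> snd (w ! i) \<le> snd (w ! walk_length w))"

definition irreducible_bridge :: "point list \<Rightarrow> bool" where
  "irreducible_bridge w \<longleftrightarrow> is_bridge w \<and>
     \<not> (\<exists>i\<in>{1..<walk_length w}. is_bridge (take (Suc i) w) \<and> is_bridge (drop i w))"

text \<open>The times at which consecutive bridges of the concatenation meet are \<open>t 0 < t 1 < \<dots>\<close>.\<close>

definition good_path :: "nat \<Rightarrow> (nat \<Rightarrow> point) \<Rightarrow> bool" where
  "good_path m p \<longleftrightarrow> (\<forall>n. initial_walk p n \<in> saw_tree) \<and>
     (\<exists>t :: nat \<Rightarrow> nat. strict_mono t \<and> t 0 = 0 \<and>
        (\<forall>i. irreducible_bridge (map p [t i..<Suc (t (Suc i))]) \<and> t (Suc i) - t i \<le> m))"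

definition good_tree :: "nat \<Rightarrow> point list set" where
  "good_tree m = {w \<in> saw_tree. \<exists>p n. good_path m p \<and> w = initial_walk p n}"

definition lambda_crit :: "nat \<Rightarrow> real" where
  "lambda_crit m = critical_value (good_tree m) [ast]"

definition phi :: "real \<Rightarrow> point list \<Rightarrow> real" where
  "phi lam \<gamma> = limit_walk_prob saw_tree [ast] lam \<gamma>"

definition phi_good :: "real \<Rightarrow> nat \<Rightarrow> point list \<Rightarrow> real" where
  "phi_good lam m \<gamma> = limit_walk_prob (good_tree m) [ast] lam \<gamma>"

text \<open>
  The limits below are values of \<^const>\<open>Lim\<close> and \<^const>\<open>lim\<close>, which are total functions and
  carry no information unless convergence is asserted separately.
\<close>

definition phi_crit :: "nat \<Rightarrow> point list \<Rightarrow> real" where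
  "phi_crit m \<gamma> = Lim (at_right (lambda_crit m)) (\<lambda>lam. phi_good lam m \<gamma>)"

definition phi_inf :: "point list \<Rightarrow> real" where
  "phi_inf \<gamma> = lim (\<lambda>m. phi_crit m \<gamma>)"

end

theory Submission
  imports Defs
begin

text \<open>
  Escape probabilities of the walk on a tree form the maximal solution of
  \<open>x v = S / (1 + S)\<close>, where \<open>S\<close> is \<open>lam\<close> times the sum of \<open>x\<close> over the children of \<open>v\<close>; the limit
  walk passes from a vertex to its children in proportion to their escape probabilities.

  On a good tree let \<open>z\<close> be the parameter for which the weights \<open>z ^ length b\<close> of the
  irreducible bridges \<open>b\<close> of length at most \<open>m\<close> add up to 1.  The infinite concatenation of independent
  bridges with these weights has a bounded positive density \<open>h\<close> satisfying \<open>h v = z * \<close> (sum of \<open>h\<close> over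
  the children).  Comparison with \<open>h\<close> shows that \<open>z\<close> is the critical value.  As \<open>lam\<close> decreases
  to \<open>z\<close> the equation becomes linear, and since every vertex has nearby descendants whose
  subtrees are all isomorphic (a code word followed by \<open>m\<close> upward steps), the ratio of the escape
  probability to \<open>h\<close> becomes constant.  Hence the critical limit is the law of the concatenation.
  As \<open>m\<close> grows it converges because the weights of all irreducible bridges still add up to 1 in the
  limit, which is Kesten's identity and follows from the Hammersley-Welsh inequality.

  For \<open>lam > 1 / \<mu>\<close>, a walk whose last site is a strict record (highest, leftmost or
  rightmost) can continue by bridges without horizontal displacement in a free vertical strip, so
  the limit of the escape probabilities on the good trees is bounded below on records.  The ratio of
  this limit to the escape probability on the whole tree is then bounded below, and the
  nonlinearity of the equation forces it to be 1.
\<close>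


text \<open>The zero function also solves the equation for escape probabilities, so
  \<open>esc\<close> is defined analytically, as the supremum of all subsolutions. A lower bound
  then needs only a test function, and monotonicity in the tree and in the parameter is immediate;
  the link with the walk is \<open>hitp_child\<close>. The competing zero solution causes both main
  difficulties. Near criticality all escape probabilities on a good tree tend to 0, so only ratios
  to \<open>h\<close> can have a useful limit. Such a ratio is almost an average over the children
  under the \<open>h\<close>-transform, up to factors tending to 1, and from every vertex the
  transform meets a copy of one fixed subtree within \<open>2 * m\<close> steps with probability
  bounded below; this squeezes supremum and infimum together. For fixed supercritical
  \<open>lam\<close> the limit over \<open>m\<close> solves the equation of the whole tree, but
  might be smaller than the maximal solution. No positive lower bound holds at all vertices, since a
  walk may trap itself; hence the detour through records.\<close>

abbreviation traj :: "(nat \<Rightarrow> 'a) measure" where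
  "traj \<equiv> \<Pi>\<^sub>M i\<in>UNIV. count_space UNIV"

section \<open>Trajectory laws of Markov chains on a countable state space\<close>

definition cylinder :: "nat \<Rightarrow> (nat \<Rightarrow> 'a) \<Rightarrow> (nat \<Rightarrow> 'a) set" where
  "cylinder n y = {\<omega>. \<forall>i\<le>n. \<omega> i = y i}"

lemma space_traj [simp]: "space traj = UNIV"
  by (auto simp: space_PiM)

lemma space_markov_law [simp]: "space (markov_law K x) = UNIV"
  using sets_eq_imp_space_eq[OF sets_markov_law[of K x]] by simp

lemma measurable_traj [measurable]: "(\<lambda>\<omega>. \<omega> i) \<in> measurable traj (count_space UNIV)"
  by (rule measurable_component_singleton) simp

lemma measurable_markov_law_eq [simp]: "measurable (markov_law K x) N = measurable traj N"
  by (rule measurable_cong_sets[OF sets_markov_law refl])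

text \<open>The total mass is read off from the projection to the empty index set, which is a member
  of the projective family and hence a probability measure.\<close>

lemma prob_space_markov_law: "prob_space (markov_law K x)"
proof -
  have "prob_space (distr (markov_law K x) (PiM {} (\<lambda>_. count_space UNIV)) (\<lambda>\<omega>. restrict \<omega> {}))"
    unfolding markov_law_def by (subst markov.distr_lim) (auto intro!: markov.PF.prob_space_P)
  then show ?thesis
    by (rule prob_space_distrD [rotated])
       (simp add: measurable_cong_sets[OF sets_markov_law refl])
qed

interpretation ml: prob_space "markov_law K x"
  by (rule prob_space_markov_law)

declare sets_markov_law [measurable_cong, simp]

lemma cylinder_sets [measurable]: "cylinder n y \<in> sets traj"
proof -
  have "{\<omega> \<in> space traj. \<forall>i\<le>n. \<omega> i = y i} \<in> sets traj"
    by measurable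
  then show ?thesis by (simp add: cylinder_def)
qed

lemma emeasure_cylinder:
  "emeasure (markov_law K x) (cylinder n y) =
     ennreal (of_bool (y 0 = x) * (\<Prod>i<n. pmf (K (y i)) (y (Suc i))))"
  unfolding cylinder_def by (rule emeasure_markov_law_cylinder)

text \<open>The empty set is adjoined because cylinders over incompatible words are disjoint; with
  it the family is a pi-system.\<close>

definition cylinders :: "(nat \<Rightarrow> 'a) set set" where
  "cylinders = insert {} {cylinder n y | n y. True}"

lemma cylinder_in_cylinders: "cylinder n y \<in> cylinders"
  unfolding cylinders_def by blast

lemma Int_stable_cylinders: "Int_stable cylinders"
proof -
  have *: "cylinder n y \<inter> cylinder m z \<in> cylinders" if "n \<le> m" for n m :: nat and y z :: "nat \<Rightarrow> 'a"
  proof (cases "\<forall>i\<le>n. y i = z i")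
    case True
    then have "cylinder n y \<inter> cylinder m z = cylinder m z"
      using that by (auto simp: cylinder_def)
    then show ?thesis by (auto simp: cylinders_def)
  next
    case False
    then obtain i where "i \<le> n" "y i \<noteq> z i" by auto
    then have "cylinder n y \<inter> cylinder m z = {}"
      using that by (force simp: cylinder_def)
    then show ?thesis by (auto simp: cylinders_def)
  qed
  have **: "cylinder n y \<inter> cylinder m z \<in> cylinders" for n m :: nat and y z :: "nat \<Rightarrow> 'a"
    using *[of n m y z] *[of m n z y] by (cases "n \<le> m") (auto simp: Int_commute)
  show ?thesis
    unfolding Int_stable_def
  proof (intro ballI)
    fix a b :: "(nat \<Rightarrow> 'a) set" assume "a \<in> cylinders" "b \<in> cylinders"
    then consider "a = {} \<or> b = {}" | n y m z where "a = cylinder n y" "b = cylinder m z"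
      unfolding cylinders_def by auto
    then show "a \<inter> b \<in> cylinders"
    proof cases
      case 1 then show ?thesis by (auto simp: cylinders_def)
    next
      case 2 then show ?thesis using ** by simp
    qed
  qed
qed

lemma sets_traj_cylinders:
  "sets (traj :: (nat \<Rightarrow> 'a::countable) measure) = sigma_sets UNIV cylinders"
proof (rule antisym)
  let ?S = "sigma UNIV (cylinders :: (nat \<Rightarrow> 'a) set set)"
  have "(\<lambda>\<omega>::nat \<Rightarrow> 'a. \<omega> i) \<in> measurable ?S (count_space UNIV)" for i
    unfolding measurable_count_space_eq2_countable
  proof (intro conjI ballI)
    fix a :: 'a
    let ?L = "{l :: 'a list. length l = i}"
    let ?c = "\<lambda>l. cylinder i (\<lambda>j. if j < i then l ! j else a)"
    \<comment> \<open>Countability of the state space enters here: a one-coordinate event is the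
      union of the cylinders over the countably many words of length \<open>i\<close>.\<close>
    have "(\<lambda>\<omega>. \<omega> i) -` {a} \<inter> space ?S = (\<Union>l\<in>?L. ?c l)"
    proof (intro equalityI subsetI)
      fix \<omega> assume "\<omega> \<in> (\<lambda>\<omega>. \<omega> i) -` {a} \<inter> space ?S"
      then have "\<omega> \<in> ?c (map \<omega> [0..<i])"
        by (auto simp: cylinder_def)
      then show "\<omega> \<in> (\<Union>l\<in>?L. ?c l)"
        by (intro UN_I[of "map \<omega> [0..<i]"]) simp_all
    qed (auto simp: cylinder_def)
    moreover have "?c l \<in> sets ?S" for l
      using sigma_sets.Basic[OF cylinder_in_cylinders] by simp
    then have "(\<Union>l\<in>?L. ?c l) \<in> sets ?S"
      by (rule sets.countable_UN'' [OF countableI_type])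
    ultimately show "(\<lambda>\<omega>. \<omega> i) -` {a} \<inter> space ?S \<in> sets ?S"
      by (simp only:)
  qed auto
  then have "(\<lambda>\<omega> i. \<omega> i) \<in> measurable ?S (traj :: (nat \<Rightarrow> 'a) measure)"
    by (intro measurable_PiM_single') auto
  then have "A \<in> sigma_sets UNIV cylinders" if "A \<in> sets (traj :: (nat \<Rightarrow> 'a) measure)" for A
    using measurable_sets[OF _ that, of "\<lambda>\<omega>. \<omega>" ?S] by simp
  then show "sets (traj :: (nat \<Rightarrow> 'a) measure) \<subseteq> sigma_sets UNIV cylinders"
    by blast
next
  have "cylinders \<subseteq> sets (traj :: (nat \<Rightarrow> 'a) measure)"
    by (auto simp: cylinders_def)
  then show "sigma_sets UNIV cylinders \<subseteq> sets (traj :: (nat \<Rightarrow> 'a) measure)"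
    using sets.sigma_sets_subset[of cylinders traj] by simp
qed

lemma measurable_case_nat_traj [measurable]: "case_nat x \<in> measurable traj traj"
proof -
  have "(\<lambda>\<omega> i. case_nat x \<omega> i) \<in> measurable traj traj"
  proof (rule measurable_PiM_single')
    fix i :: nat
    show "(\<lambda>\<omega>. case_nat x \<omega> i) \<in> measurable traj (count_space UNIV)"
      by (cases i) auto
  qed auto
  then show ?thesis by simp
qed

text \<open>First-step decomposition of the trajectory law. Both sides are determined by their
  values on the pi-system of cylinders, where each is an explicit product.\<close>

lemma markov_law_bind:
  fixes K :: "'a::countable \<Rightarrow> 'a pmf"
  shows "markov_law K x = measure_pmf (K x) \<bind> (\<lambda>y. distr (markov_law K y) traj (case_nat x))"
    (is "_ = ?R")
proof -
  have k: "(\<lambda>y. distr (markov_law K y) traj (case_nat x)) \<in> measurable (measure_pmf p) (subprob_algebra traj)" for p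
    by (auto simp: space_subprob_algebra intro!: prob_space_imp_subprob_space ml.prob_space_distr)
  have sR: "sets ?R = sets traj"
    by (rule sets_bind) (use k in \<open>auto\<close>)
  have em: "emeasure ?R A = (\<integral>\<^sup>+ y. emeasure (markov_law K y) (case_nat x -` A) \<partial>measure_pmf (K x))"
    if "A \<in> sets traj" for A
  proof -
    have "emeasure ?R A = (\<integral>\<^sup>+ y. emeasure (distr (markov_law K y) traj (case_nat x)) A \<partial>measure_pmf (K x))"
      by (rule emeasure_bind[OF _ k that]) simp
    also have "\<dots> = (\<integral>\<^sup>+ y. emeasure (markov_law K y) (case_nat x -` A) \<partial>measure_pmf (K x))"
      using that by (intro nn_integral_cong) (simp add: emeasure_distr)
    finally show ?thesis .
  qed
  show ?thesis
  proof (rule measure_eqI_generator_eq_countable[OF Int_stable_cylinders, where \<Omega> = UNIV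
        and A = "range (\<lambda>a. cylinder 0 (\<lambda>_. a))"])
    show "sets (markov_law K x) = sigma_sets UNIV cylinders" "sets ?R = sigma_sets UNIV cylinders"
      using sR by (simp_all add: sets_traj_cylinders)
    fix A :: "(nat \<Rightarrow> 'a) set" assume "A \<in> cylinders"
    then consider "A = {}" | n y where "A = cylinder n y"
      by (auto simp: cylinders_def)
    then show "emeasure (markov_law K x) A = emeasure ?R A"
    proof cases
      case 2
      have "emeasure ?R A = (\<integral>\<^sup>+ z. emeasure (markov_law K z) (case_nat x -` cylinder n y) \<partial>measure_pmf (K x))"
        using 2 em by simp
      also have "\<dots> = emeasure (markov_law K x) (cylinder n y)"
      proof (cases n)
        case 0
        then have "case_nat x -` cylinder n y = (if y 0 = x then UNIV else {})"
          by (auto simp: cylinder_def)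
        then show ?thesis
          using 0 measure_pmf.emeasure_space_1[of "K x"]
            by (auto simp: emeasure_cylinder ml.emeasure_space_1 [simplified])
      next
        case (Suc k)
        have all: "(\<forall>i\<le>Suc k. P i) \<longleftrightarrow> P 0 \<and> (\<forall>i\<le>k. P (Suc i))" for P
          by (metis Suc_le_mono bot_nat_0.extremum not0_implies_Suc)
        have "case_nat x -` cylinder n y = (if y 0 = x then cylinder k (\<lambda>i. y (Suc i)) else {})"
          by (auto simp: cylinder_def Suc all)
        then have "(\<integral>\<^sup>+ z. emeasure (markov_law K z) (case_nat x -` cylinder n y) \<partial>measure_pmf (K x))
          = (\<integral>\<^sup>+ z. ennreal (of_bool (y 0 = x) * (\<Prod>i<k. pmf (K (y (Suc i))) (y (Suc (Suc i)))))
              * indicator {y (Suc 0)} z \<partial>measure_pmf (K x))"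
          by (intro nn_integral_cong) (auto simp: emeasure_cylinder indicator_def)
        also have "\<dots> = ennreal (of_bool (y 0 = x) * (\<Prod>i<k. pmf (K (y (Suc i))) (y (Suc (Suc i)))))
            * ennreal (pmf (K x) (y (Suc 0)))"
          by (subst nn_integral_cmult_indicator) (auto simp: emeasure_pmf_single)
        also have "\<dots> = emeasure (markov_law K x) (cylinder n y)"
          unfolding emeasure_cylinder Suc prod.lessThan_Suc_shift
          by (auto simp: ennreal_mult'' prod_nonneg mult.commute)
        finally show ?thesis .
      qed
      finally show ?thesis using 2 by simp
    qed simp
  qed (auto simp: cylinders_def cylinder_def)
qed

lemma emeasure_markov_law_step:
  fixes K :: "'a::countable \<Rightarrow> 'a pmf"
  assumes "A \<in> sets traj"
  shows "emeasure (markov_law K x) A = (\<integral>\<^sup>+ y. emeasure (markov_law K y) (case_nat x -` A) \<partial>measure_pmf (K x))"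
proof -
  have k: "(\<lambda>y. distr (markov_law K y) traj (case_nat x)) \<in> measurable (measure_pmf p) (subprob_algebra traj)" for p
    by (auto simp: space_subprob_algebra intro!: prob_space_imp_subprob_space ml.prob_space_distr)
  have "emeasure (markov_law K x) A = (\<integral>\<^sup>+ y. emeasure (distr (markov_law K y) traj (case_nat x)) A \<partial>measure_pmf (K x))"
    by (subst markov_law_bind) (rule emeasure_bind[OF _ k assms], simp)
  also have "\<dots> = (\<integral>\<^sup>+ y. emeasure (markov_law K y) (case_nat x -` A) \<partial>measure_pmf (K x))"
    using assms by (intro nn_integral_cong) (simp add: emeasure_distr)
  finally show ?thesis .
qed

lemma measure_markov_law_step:
  fixes K :: "'a::countable \<Rightarrow> 'a pmf"
  assumes "A \<in> sets traj"
  shows "measure (markov_law K x) A = (\<integral> y. measure (markov_law K y) (case_nat x -` A) \<partial>measure_pmf (K x))"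
proof -
  have "ennreal (measure (markov_law K x) A) = (\<integral>\<^sup>+ y. ennreal (measure (markov_law K y) (case_nat x -` A)) \<partial>measure_pmf (K x))"
    using emeasure_markov_law_step[OF assms, of K x] by (simp add: ml.emeasure_eq_measure)
  also have "\<dots> = ennreal (\<integral> y. measure (markov_law K y) (case_nat x -` A) \<partial>measure_pmf (K x))"
    by (rule nn_integral_eq_integral) (auto intro!: measure_pmf.integrable_const_bound[where B = 1])
  finally show ?thesis by (simp add: integral_nonneg_AE)
qed

primrec Kpow :: "('a \<Rightarrow> 'a pmf) \<Rightarrow> nat \<Rightarrow> 'a \<Rightarrow> 'a pmf" where
  "Kpow K 0 x = return_pmf x"
| "Kpow K (Suc n) x = bind_pmf (K x) (Kpow K n)"

lemma Kpow_add: "Kpow K (m + n) x = bind_pmf (Kpow K m x) (Kpow K n)"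
  by (induction m arbitrary: x) (simp_all add: bind_return_pmf bind_assoc_pmf cong: bind_pmf_cong)

lemma Kpow_add_ge: "pmf (Kpow K m x) y * pmf (Kpow K n y) z \<le> pmf (Kpow K (m + n) x) z"
proof -
  have "pmf (Kpow K m x) y * pmf (Kpow K n y) z
      = (\<integral>w. pmf (Kpow K n y) z * indicator {y} w \<partial>measure_pmf (Kpow K m x))"
    by (simp add: measure_pmf_single)
  also have "\<dots> \<le> (\<integral>w. pmf (Kpow K n w) z \<partial>measure_pmf (Kpow K m x))"
    by (intro integral_mono)
       (auto intro!: measure_pmf.integrable_const_bound[where B = 1] simp: pmf_le_1 indicator_def)
  finally show ?thesis by (simp add: Kpow_add pmf_bind)
qed

lemma emeasure_markov_law_start:
  fixes K :: "'a::countable \<Rightarrow> 'a pmf"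
  shows "emeasure (markov_law K x) {\<omega>. \<omega> 0 = y} = of_bool (x = y)"
  using emeasure_cylinder[of K x 0 "\<lambda>_. y"] by (auto simp: cylinder_def)

lemma AE_markov_law_start:
  fixes K :: "'a::countable \<Rightarrow> 'a pmf"
  shows "AE \<omega> in markov_law K x. \<omega> 0 = x"
proof -
  have "measure (markov_law K x) {\<omega>. \<omega> 0 = x} = 1"
    using emeasure_markov_law_start[of K x x] by (simp add: ml.emeasure_eq_measure)
  then show ?thesis using ml.AE_prob_1 by force
qed

lemma measurable_shift_traj [measurable]: "(\<lambda>\<omega> i. \<omega> (i + n)) \<in> measurable traj traj"
  by (rule measurable_PiM_single') auto

lemma shift_set_measurable:
  assumes "A \<in> sets traj"
  shows "{\<omega>. \<omega> n = y \<and> (\<lambda>i. \<omega> (i + n)) \<in> A} \<in> sets traj"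
proof -
  have "{\<omega> \<in> space traj. \<omega> n = y \<and> (\<lambda>i. \<omega> (i + n)) \<in> A} \<in> sets traj"
    using assms by measurable
  then show ?thesis by simp
qed

text \<open>The simple Markov property at a fixed time, by induction on that time: the first step is
  split off with \<open>emeasure_markov_law_step\<close> and the rest is the induction
  hypothesis.\<close>

lemma markov_property:
  fixes K :: "'a::countable \<Rightarrow> 'a pmf"
  assumes A: "A \<in> sets traj"
  shows "emeasure (markov_law K x) {\<omega>. \<omega> n = y \<and> (\<lambda>i. \<omega> (i + n)) \<in> A}
    = ennreal (pmf (Kpow K n x) y) * emeasure (markov_law K y) A"
proof (induction n arbitrary: x)
  case 0
  have "emeasure (markov_law K x) {\<omega>. \<omega> 0 = y \<and> \<omega> \<in> A} = of_bool (x = y) * emeasure (markov_law K y) A"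
  proof (cases "x = y")
    case True
    have "emeasure (markov_law K x) {\<omega>. \<omega> 0 = y \<and> \<omega> \<in> A} = emeasure (markov_law K x) A"
      using AE_markov_law_start[of x K] True shift_set_measurable[OF A, of 0 y] A
      by (intro emeasure_eq_AE) auto
    then show ?thesis using True by simp
  next
    case False
    have "AE \<omega> in markov_law K x. \<not> (\<omega> 0 = y \<and> \<omega> \<in> A)"
      by (rule eventually_mono[OF AE_markov_law_start[of x K]]) (use False in auto)
    then have "emeasure (markov_law K x) {\<omega>. \<omega> 0 = y \<and> \<omega> \<in> A} = 0"
      by (drule_tac emeasure_eq_0_AE) simp
    then show ?thesis using False by simp
  qed
  then show ?case by (auto simp: indicator_def pmf_return)
next
  case (Suc n)
  have "emeasure (markov_law K x) {\<omega>. \<omega> (Suc n) = y \<and> (\<lambda>i. \<omega> (i + Suc n)) \<in> A}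
     = (\<integral>\<^sup>+ z. emeasure (markov_law K z) {\<omega>. \<omega> n = y \<and> (\<lambda>i. \<omega> (i + n)) \<in> A} \<partial>measure_pmf (K x))"
    by (subst emeasure_markov_law_step[OF shift_set_measurable[OF A]])
       (simp add: vimage_def)
  also have "\<dots> = (\<integral>\<^sup>+ z. ennreal (pmf (Kpow K n z) y) \<partial>measure_pmf (K x)) * emeasure (markov_law K y) A"
    by (subst Suc.IH) (simp add: nn_integral_multc)
  also have "(\<integral>\<^sup>+ z. ennreal (pmf (Kpow K n z) y) \<partial>measure_pmf (K x)) = ennreal (pmf (Kpow K (Suc n) x) y)"
    by (simp add: ennreal_pmf_bind)
  finally show ?case .
qed

lemma AE_markov_law_edges:
  fixes K :: "'a::countable \<Rightarrow> 'a pmf"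
  shows "AE \<omega> in markov_law K x. \<forall>n. \<omega> (Suc n) \<in> set_pmf (K (\<omega> n))"
proof -
  have "AE \<omega> in markov_law K x. \<not> (\<omega> n = y \<and> \<omega> (Suc n) = z)" if z: "z \<notin> set_pmf (K y)" for n y z
  proof -
    have m: "{\<omega>::nat \<Rightarrow> 'a. \<omega> 1 = z} \<in> sets traj"
    proof -
      have "{\<omega> \<in> space traj. \<omega> 1 = z} \<in> sets traj" by measurable
      then show ?thesis by simp
    qed
    have "emeasure (markov_law K y) {\<omega>. \<omega> 1 = z}
        = (\<integral>\<^sup>+ w. emeasure (markov_law K w) {\<omega>. \<omega> 0 = z} \<partial>measure_pmf (K y))"
      by (subst emeasure_markov_law_step[OF m]) (simp add: vimage_def)
    also have "\<dots> = (\<integral>\<^sup>+ w. indicator {z} w \<partial>measure_pmf (K y))"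
      by (intro nn_integral_cong) (simp add: emeasure_markov_law_start indicator_def)
    also have "\<dots> = 0" using z by (simp add: emeasure_pmf_single pmf_eq_0_set_pmf)
    finally have "emeasure (markov_law K x) {\<omega>. \<omega> n = y \<and> (\<lambda>i. \<omega> (i + n)) \<in> {\<omega>. \<omega> 1 = z}} = 0"
      by (subst markov_property[OF m]) simp
    then have "{\<omega>. \<omega> n = y \<and> (\<lambda>i. \<omega> (i + n)) \<in> {\<omega>. \<omega> 1 = z}} \<in> null_sets (markov_law K x)"
      using shift_set_measurable[OF m, of n y] by (auto simp: null_sets_def)
    then show ?thesis
      by (drule_tac AE_not_in) auto
  qed
  then have "AE \<omega> in markov_law K x. \<forall>n y z. z \<notin> set_pmf (K y) \<longrightarrow> \<not> (\<omega> n = y \<and> \<omega> (Suc n) = z)"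
    by (intro AE_all_countable [THEN iffD2] allI) (auto intro: AE_impI)
  then show ?thesis by eventually_elim auto
qed


section \<open>Hitting probabilities\<close>

definition hitp :: "('a \<Rightarrow> 'a pmf) \<Rightarrow> 'a \<Rightarrow> 'a \<Rightarrow> real" where
  "hitp K a x = measure (markov_law K x) {\<omega>. \<exists>i. \<omega> i = a}"

lemma sets_hit [measurable]: "{\<omega>. \<exists>i. \<omega> i = a} \<in> sets traj" "{\<omega>. \<exists>i\<le>n. \<omega> i = a} \<in> sets traj"
proof -
  have "{\<omega>\<in>space traj. \<exists>i. \<omega> i = a} \<in> sets traj" "{\<omega>\<in>space traj. \<exists>i\<le>n. \<omega> i = a} \<in> sets traj"
    by measurable
  then show "{\<omega>. \<exists>i. \<omega> i = a} \<in> sets traj" "{\<omega>. \<exists>i\<le>n. \<omega> i = a} \<in> sets traj" by simp_all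
qed

lemma hitp_nonneg [simp]: "0 \<le> hitp K a x" and hitp_le_1 [simp]: "hitp K a x \<le> 1"
  by (simp_all add: hitp_def)

lemma hitp_self:
  fixes K :: "'a::countable \<Rightarrow> 'a pmf"
  shows "hitp K a a = 1"
  unfolding hitp_def
  using AE_markov_law_start[of a K]
  by (subst ml.prob_eq_1) (auto elim!: eventually_mono)

lemma hitp_step:
  fixes K :: "'a::countable \<Rightarrow> 'a pmf"
  assumes "x \<noteq> a"
  shows "hitp K a x = (\<integral>y. hitp K a y \<partial>measure_pmf (K x))"
proof -
  have "case_nat x -` {\<omega>. \<exists>i. \<omega> i = a} = {\<omega>. \<exists>i. \<omega> i = a}"
    using assms by (auto simp: gr0_conv_Suc split: nat.splits)
  then show ?thesis
    unfolding hitp_def by (subst measure_markov_law_step) simp_all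
qed

text \<open>Minimality of the hitting probability among superharmonic functions with value 1 at
  \<open>a\<close>, first for hitting before a finite horizon, then in the limit. The set
  \<open>C\<close> confines the walk until it hits \<open>a\<close>, so superharmonicity is checked
  only there.\<close>

lemma hitp_le_superharmonic:
  fixes K :: "'a::countable \<Rightarrow> 'a pmf"
  assumes G: "\<And>x. 0 \<le> G x" "\<And>x. G x \<le> 1" "G a = 1"
    and C: "\<And>x y. x \<in> C \<Longrightarrow> x \<noteq> a \<Longrightarrow> y \<in> set_pmf (K x) \<Longrightarrow> y \<in> C"
    and super: "\<And>x. x \<in> C \<Longrightarrow> x \<noteq> a \<Longrightarrow> (\<integral>y. G y \<partial>measure_pmf (K x)) \<le> G x"
    and x: "x \<in> C"
  shows "hitp K a x \<le> G x"
proof -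
  have int: "integrable (measure_pmf p) f" if "\<And>x. 0 \<le> f x \<and> f x \<le> 1" for f :: "'a \<Rightarrow> real" and p
    using that by (intro measure_pmf.integrable_const_bound[where B = 1]) auto
  have le: "measure (markov_law K x) {\<omega>. \<exists>i\<le>n. \<omega> i = a} \<le> G x" if "x \<in> C" for n x
    using that
  proof (induction n arbitrary: x)
    case 0
    show ?case
    proof (cases "x = a")
      case False
      then show ?thesis
        using emeasure_markov_law_start[of K x a] G(1)[of x] by (simp add: ml.emeasure_eq_measure)
    qed (use G in simp)
  next
    case (Suc n)
    show ?case
    proof (cases "x = a")
      case False
      have "case_nat x -` {\<omega>. \<exists>i\<le>Suc n. \<omega> i = a} = {\<omega>. \<exists>i\<le>n. \<omega> i = a}" (is "?A = ?B")
      proof (intro equalityI subsetI)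
        fix \<omega> assume "\<omega> \<in> ?A"
        then obtain i where "i \<le> Suc n" "case_nat x \<omega> i = a" by auto
        then show "\<omega> \<in> ?B" using False by (cases i) auto
      next
        fix \<omega> assume "\<omega> \<in> ?B"
        then obtain i where "i \<le> n" "\<omega> i = a" by auto
        then show "\<omega> \<in> ?A" by (auto intro!: exI[of _ "Suc i"])
      qed
      then have "measure (markov_law K x) {\<omega>. \<exists>i\<le>Suc n. \<omega> i = a}
        = (\<integral>y. measure (markov_law K y) {\<omega>. \<exists>i\<le>n. \<omega> i = a} \<partial>measure_pmf (K x))"
        by (subst measure_markov_law_step) simp_all
      also have "\<dots> \<le> (\<integral>y. G y \<partial>measure_pmf (K x))"
        using Suc.IH C[OF Suc.prems False] G
        by (intro integral_mono_AE int) (auto simp: AE_measure_pmf_iff)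
      also have "\<dots> \<le> G x" using super Suc.prems False by blast
      finally show ?thesis .
    qed (use G in simp)
  qed
  have "(\<lambda>n. measure (markov_law K x) {\<omega>. \<exists>i\<le>n. \<omega> i = a}) \<longlonglongrightarrow>
      measure (markov_law K x) (\<Union>n. {\<omega>. \<exists>i\<le>n. \<omega> i = a})"
    by (intro ml.finite_Lim_measure_incseq) (auto simp: incseq_def intro: order_trans)
  moreover have "(\<Union>n::nat. {\<omega>. \<exists>i\<le>n. \<omega> i = a}) = {\<omega>. \<exists>i. \<omega> i = a}" by auto
  ultimately show ?thesis
    unfolding hitp_def using le[OF x] by (auto intro: LIMSEQ_le_const2)
qed


section \<open>Escape probabilities as maximal subsolutions\<close>

text \<open>The effective conductance of a unit edge (to the parent) in series with a conductance
  \<open>s\<close> (to infinity through the children).\<close>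

definition netf :: "real \<Rightarrow> real" where
  "netf s = s / (1 + s)"

lemma netf_mono: "0 \<le> s \<Longrightarrow> s \<le> t \<Longrightarrow> netf s \<le> netf t"
  by (simp add: netf_def divide_simps) (simp add: algebra_simps)

lemma netf_bounds: "0 \<le> s \<Longrightarrow> 0 \<le> netf s" "0 \<le> s \<Longrightarrow> netf s \<le> 1" "0 \<le> s \<Longrightarrow> netf s \<le> s"
  by (simp_all add: netf_def divide_simps) (simp add: algebra_simps)

lemma one_minus_netf: "0 \<le> s \<Longrightarrow> (1 - netf s) * (1 + s) = 1"
  by (simp add: netf_def field_simps)

lemma netf_0 [simp]: "netf 0 = 0"
  by (simp add: netf_def)

lemma netf_eq_0_iff: "0 \<le> s \<Longrightarrow> netf s = 0 \<longleftrightarrow> s = 0"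
  by (simp add: netf_def)

text \<open>Forcing the value 0 off the tree makes subsolutions of a subtree comparable with those
  of a larger tree.\<close>

definition subsol :: "'a list set \<Rightarrow> real \<Rightarrow> ('a list \<Rightarrow> real) \<Rightarrow> bool" where
  "subsol T lam y \<longleftrightarrow> (\<forall>v. 0 \<le> y v \<and> y v \<le> 1 \<and> (v \<notin> T \<longrightarrow> y v = 0) \<and>
     y v \<le> netf (lam * sum y (children T v)))"

text \<open>The maximal solution; for a child of a tree vertex it is the probability that the walk
  started there never visits its parent, see \<open>hitp_child\<close>.\<close>

definition esc :: "'a list set \<Rightarrow> real \<Rightarrow> 'a list \<Rightarrow> real" where
  "esc T lam v = (SUP y\<in>{y. subsol T lam y}. y v)"

lemma subsol_0: "subsol T lam (\<lambda>_. 0)"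
  by (simp add: subsol_def)

lemma bdd_subsol: "bdd_above ((\<lambda>y. y v) ` {y. subsol T lam y})"
  by (auto simp: subsol_def intro!: bdd_aboveI[where M = 1])

lemma subsol_le_esc: "subsol T lam y \<Longrightarrow> y v \<le> esc T lam v"
  unfolding esc_def by (intro cSUP_upper bdd_subsol) auto

lemma esc_leI: "(\<And>y. subsol T lam y \<Longrightarrow> y v \<le> c) \<Longrightarrow> esc T lam v \<le> c"
  unfolding esc_def by (intro cSUP_least) (use subsol_0 in auto)

lemma esc_nonneg [simp]: "0 \<le> esc T lam v"
  using subsol_le_esc[OF subsol_0] .

lemma esc_le_1 [simp]: "esc T lam v \<le> 1"
  by (rule esc_leI) (simp add: subsol_def)

lemma esc_outside: "v \<notin> T \<Longrightarrow> esc T lam v = 0"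
  by (rule antisym[OF esc_leI esc_nonneg]) (auto simp: subsol_def)

lemma sum_esc_nonneg [simp]: "0 \<le> sum (esc T lam) A"
  by (simp add: sum_nonneg)

lemma esc_subsol:
  assumes "lam \<ge> 0"
  shows "subsol T lam (esc T lam)"
proof -
  have "esc T lam v \<le> netf (lam * sum (esc T lam) (children T v))" for v
  proof (rule esc_leI)
    fix y assume y: "subsol T lam y"
    have "y v \<le> netf (lam * sum y (children T v))" using y by (simp add: subsol_def)
    also have "\<dots> \<le> netf (lam * sum (esc T lam) (children T v))"
      using y subsol_le_esc[OF y] assms
      by (intro netf_mono mult_left_mono sum_mono mult_nonneg_nonneg sum_nonneg) (auto simp: subsol_def)
    finally show "y v \<le> \<dots>" .
  qed
  then show ?thesis by (auto simp: subsol_def esc_outside)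
qed

lemma esc_eq:
  assumes "lam \<ge> 0" "v \<in> T"
  shows "esc T lam v = netf (lam * sum (esc T lam) (children T v))"
proof (rule antisym)
  show "esc T lam v \<le> netf (lam * sum (esc T lam) (children T v))"
    using esc_subsol[OF assms(1), of T] by (simp add: subsol_def)
  \<comment> \<open>Iterating the right-hand side once on the maximal subsolution gives a
    subsolution that is at least as large, so maximality forces equality.\<close>
  define z where "z = (\<lambda>v. if v \<in> T then netf (lam * sum (esc T lam) (children T v)) else 0)"
  have nn: "0 \<le> lam * sum (esc T lam) A" for A using assms(1) by simp
  have z_ge: "esc T lam u \<le> z u" for u
    using esc_subsol[OF assms(1), of T] by (auto simp: subsol_def z_def)
  have z: "0 \<le> z u" "z u \<le> 1" for u using netf_bounds[OF nn] by (auto simp: z_def)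
  have "netf (lam * sum (esc T lam) (children T u)) \<le> netf (lam * sum z (children T u))" for u
    by (intro netf_mono nn mult_left_mono sum_mono z_ge assms)
  then have "z u \<le> netf (lam * sum z (children T u))" for u
    using netf_bounds(1)[of "lam * sum z (children T u)"] z assms(1)
    by (auto simp: z_def intro: sum_nonneg mult_nonneg_nonneg)
  then have "subsol T lam z" using z by (auto simp: subsol_def z_def)
  then show "netf (lam * sum (esc T lam) (children T v)) \<le> esc T lam v"
    using subsol_le_esc[of T lam z v] assms(2) by (simp add: z_def)
qed

lemma esc_mono:
  assumes "0 \<le> lam" "lam \<le> lam'" "T \<subseteq> T'" "\<And>v. finite (children T' v)"
  shows "esc T lam v \<le> esc T' lam' v"
proof (rule esc_leI)
  fix y assume y: "subsol T lam y"
  have "subsol T' lam' y"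
    unfolding subsol_def
  proof (intro allI conjI impI)
    fix v
    have "y v \<le> netf (lam * sum y (children T v))" using y by (simp add: subsol_def)
    also have "\<dots> \<le> netf (lam' * sum y (children T' v))"
      using y assms
      by (intro netf_mono mult_mono sum_mono2 mult_nonneg_nonneg sum_nonneg)
         (auto simp: subsol_def children_def)
    finally show "y v \<le> netf (lam' * sum y (children T' v))" .
  qed (use y assms in \<open>auto simp: subsol_def\<close>)
  then show "y v \<le> esc T' lam' v" by (rule subsol_le_esc)
qed


section \<open>Random walk on a tree of walks\<close>

locale walk_tree =
  fixes T :: "'a::countable list set" and a0 :: 'a
  assumes root_in: "[a0] \<in> T"
    and hd_T: "w \<in> T \<Longrightarrow> w \<noteq> [] \<and> hd w = a0"
    and butlast_T: "w \<in> T \<Longrightarrow> w \<noteq> [a0] \<Longrightarrow> butlast w \<in> T"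
    and finite_children: "finite (children T x)"
    and children_root: "children T [a0] \<noteq> {}"
begin

lemma childrenD: "u \<in> children T x \<Longrightarrow> u \<in> T \<and> u \<noteq> [] \<and> butlast u = x"
  by (auto simp: children_def)

lemma Nil_notin_T: "[] \<notin> T" using hd_T by blast

lemma parent_notin_children: "x \<in> T \<Longrightarrow> parent x \<notin> children T x"
proof
  assume "x \<in> T" "parent x \<in> children T x"
  then obtain v where "butlast x = x @ [v]" by (auto simp: children_def parent_def)
  then have "length (butlast x) = length (x @ [v])" by simp
  then show False by simp
qed

lemma child_ne_root: "x \<in> T \<Longrightarrow> u \<in> children T x \<Longrightarrow> u \<noteq> [a0]"
  using Nil_notin_T by (auto dest!: childrenD)

abbreviation "descs a \<equiv> {x \<in> T. prefix a x}"

lemma descs_closed: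
  assumes "x \<in> descs a" "x \<noteq> a" "a \<in> T"
  shows "x \<noteq> [a0]" "parent x \<in> descs a" "children T x \<subseteq> descs a"
proof -
  show ne: "x \<noteq> [a0]"
    using assms Nil_notin_T by (auto simp: prefix_Cons)
  obtain zs where zs: "x = a @ zs" "zs \<noteq> []" using assms by (auto simp: prefix_def)
  then have "parent x = a @ butlast zs" by (simp add: parent_def butlast_append)
  then show "parent x \<in> descs a"
    using butlast_T[OF _ ne] assms by (auto simp: parent_def)
  show "children T x \<subseteq> descs a"
    using assms by (auto simp: children_def)
qed

context
  fixes lam :: real
  assumes lam: "lam > 0"
begin

abbreviation "K \<equiv> rw_step T [a0] lam"

lemma denom_pos: "0 < 1 + real (card (children T x)) * lam"
  using lam by (simp add: add_pos_nonneg)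

lemma pmf_K:
  assumes "x \<in> T" "x \<noteq> [a0]"
  shows "pmf (K x) y =
    (if y = parent x then 1 / (1 + real (card (children T x)) * lam)
     else if y \<in> children T x then lam / (1 + real (card (children T x)) * lam)
     else 0)"
  using assms Nil_notin_T by (intro pmf_rw_step lam finite_children) auto

lemma set_pmf_K:
  assumes "x \<in> T" "x \<noteq> [a0]"
  shows "set_pmf (K x) = insert (parent x) (children T x)"
  using lam denom_pos[of x] by (auto simp: set_pmf_iff pmf_K[OF assms] split: if_splits)

lemma K_root: "K [a0] = pmf_of_set (children T [a0])"
  by (simp add: rw_step_def)

lemma integral_K:
  assumes "x \<in> T" "x \<noteq> [a0]"
  shows "(\<integral>y. f y \<partial>measure_pmf (K x))
    = (f (parent x) + lam * sum f (children T x)) / (1 + real (card (children T x)) * lam)"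
proof -
  let ?d = "1 + real (card (children T x)) * lam"
  have p: "parent x \<notin> children T x" using parent_notin_children assms by blast
  have "(\<integral>y. f y \<partial>measure_pmf (K x)) = (\<Sum>y\<in>insert (parent x) (children T x). f y * pmf (K x) y)"
    by (rule integral_measure_pmf_real) (use finite_children set_pmf_K[OF assms] in auto)
  also have "\<dots> = f (parent x) / ?d + (\<Sum>y\<in>children T x. f y * (lam / ?d))"
    using p finite_children by (simp add: pmf_K[OF assms]) (intro sum.cong, auto)
  also have "\<dots> = (f (parent x) + lam * sum f (children T x)) / ?d"
    by (simp add: add_divide_distrib sum_divide_distrib sum_distrib_left mult.commute)
  finally show ?thesis .
qed

lemma hitp_K:
  assumes "x \<in> T" "x \<noteq> [a0]" "x \<noteq> a"
  shows "hitp K a x * (1 + real (card (children T x)) * lam)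
    = hitp K a (parent x) + lam * sum (hitp K a) (children T x)"
  using denom_pos[of x] hitp_step[OF assms(3), of K] unfolding integral_K[OF assms(1,2)]
  by (simp add: divide_simps)

lemma one_minus_esc:
  assumes "x \<in> T"
  shows "(1 - esc T lam x) * (1 + lam * sum (esc T lam) (children T x)) = 1"
proof -
  have "esc T lam x = netf (lam * sum (esc T lam) (children T x))"
    by (rule esc_eq[OF less_imp_le[OF lam] assms])
  moreover have "0 \<le> lam * sum (esc T lam) (children T x)"
    using lam by (intro mult_nonneg_nonneg sum_esc_nonneg) simp
  ultimately show ?thesis by (metis one_minus_netf)
qed

text \<open>To come back to \<open>a\<close> the walk must descend through every ancestor in
  between, so the product of the return probabilities along the branch is the natural candidate. It
  is harmonic below \<open>a\<close>, and \<open>hitp_le_superharmonic\<close> applies.\<close>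

lemma hitp_child_le:
  assumes a: "a \<in> T" and u: "u \<in> children T a"
  shows "hitp K a u \<le> 1 - esc T lam u"
proof -
  define F where "F x = (\<Prod>i\<in>{length a..<length x}. 1 - esc T lam (take (Suc i) x))" for x
  have F_snoc: "F x = F (butlast x) * (1 - esc T lam x)" if "length x > length a" for x
  proof -
    have "length x = Suc (length x - 1)" "length x - 1 \<ge> length a" using that by simp_all
    then obtain n where n: "length x = Suc n" "n \<ge> length a"
      by (rule that)
    have "F x = (\<Prod>i\<in>{length a..<n}. 1 - esc T lam (take (Suc i) x)) * (1 - esc T lam x)"
      using n by (simp add: F_def)
    also have "(\<Prod>i\<in>{length a..<n}. 1 - esc T lam (take (Suc i) x)) = F (butlast x)"
      unfolding F_def using n by (intro prod.cong) (auto simp: take_butlast)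
    finally show ?thesis .
  qed
  have "hitp K a u \<le> F u"
  proof (rule hitp_le_superharmonic[where C = "descs a"])
    show "0 \<le> F x" "F x \<le> 1" for x by (auto simp: F_def intro!: prod_nonneg prod_le_1)
    show "F a = 1" by (simp add: F_def)
    show "u \<in> descs a" using u by (auto simp: children_def)
    show "y \<in> descs a" if "x \<in> descs a" "x \<noteq> a" "y \<in> set_pmf (K x)" for x y
      using descs_closed[OF that(1,2) a] that(1,3) by (subst (asm) set_pmf_K) auto
    show "(\<integral>y. F y \<partial>measure_pmf (K x)) \<le> F x" if x: "x \<in> descs a" "x \<noteq> a" for x
    proof -
      note c = descs_closed[OF x a]
      have len: "length x > length a"
        using x by (auto simp: prefix_def)
      let ?S = "lam * sum (esc T lam) (children T x)"
      have Sp: "?S \<ge> 0" using lam by simp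
      have "F x * (1 + ?S) = F (parent x) * ((1 - esc T lam x) * (1 + ?S))"
        using F_snoc[OF len] by (simp add: parent_def)
      \<comment> \<open>By \<open>one_minus_esc\<close>, removing the last factor amounts to
        multiplying by \<open>1 + ?S\<close>.\<close>
      then have Fp: "F (parent x) = F x * (1 + ?S)"
        using one_minus_esc[of x] x by (metis mem_Collect_eq mult.right_neutral)
      have "sum F (children T x) = (\<Sum>w\<in>children T x. F x * (1 - esc T lam w))"
      proof (rule sum.cong[OF refl])
        fix w assume "w \<in> children T x"
        then have "butlast w = x" "length w > length x" by (auto simp: children_def)
        then show "F w = F x * (1 - esc T lam w)" using F_snoc[of w] len by simp
      qed
      also have "\<dots> = F x * (real (card (children T x)) - sum (esc T lam) (children T x))"
        by (simp add: sum_distrib_left[symmetric] sum_subtractf)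
      finally have sF: "sum F (children T x)
        = F x * (real (card (children T x)) - sum (esc T lam) (children T x))" .
      have "F (parent x) + lam * sum F (children T x) = F x * (1 + real (card (children T x)) * lam)"
        unfolding Fp sF by (simp add: algebra_simps)
      then show ?thesis
        using x c denom_pos[of x] by (simp add: integral_K)
    qed
  qed
  also have "F u = 1 - esc T lam u"
    using u F_snoc[of u] by (auto simp: children_def F_def)
  finally show ?thesis .
qed

text \<open>A walk from \<open>v\<close> passes the parent of \<open>v\<close> before
  \<open>a\<close>. Instead of a stopping-time argument, the hitting probability is capped on the
  subtree of \<open>v\<close> and compared with itself.\<close>

lemma hitp_le_parent:
  assumes a: "a \<in> T" and v: "v \<in> descs a" "v \<noteq> a"
  shows "hitp K a v \<le> hitp K a (parent v)"
proof -
  let ?g = "hitp K a" and ?c = "hitp K a (parent v)"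
  \<comment> \<open>The cap at the parent's value preserves superharmonicity: the only exit from the
    subtree of \<open>v\<close> is the parent, where the bound \<open>?c\<close> holds with
    equality.\<close>
  define G where "G x = (if x \<in> descs v then min (?g x) ?c else ?g x)" for x
  have av: "a \<notin> descs v" using v prefix_order.antisym by auto
  have Gg: "G x \<le> ?g x" for x by (simp add: G_def)
  have int: "integrable (measure_pmf p) f" if "\<And>x. 0 \<le> f x \<and> f x \<le> 1" for f :: "'a list \<Rightarrow> real" and p
    using that by (intro measure_pmf.integrable_const_bound[where B = 1]) auto
  have G01: "0 \<le> G x \<and> G x \<le> 1" for x by (auto simp: G_def min_le_iff_disj)
  have "?g v \<le> G v"
  proof (rule hitp_le_superharmonic[where C = "descs a"])
    show "0 \<le> G x" "G x \<le> 1" for x using G01 by auto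
    show "G a = 1" using av by (auto simp: G_def hitp_self)
    show "v \<in> descs a" by fact
    show "y \<in> descs a" if "x \<in> descs a" "x \<noteq> a" "y \<in> set_pmf (K x)" for x y
      using descs_closed[OF that(1,2) a] that(1,3) by (subst (asm) set_pmf_K) auto
    show "(\<integral>y. G y \<partial>measure_pmf (K x)) \<le> G x" if x: "x \<in> descs a" "x \<noteq> a" for x
    proof -
      have le: "(\<integral>y. G y \<partial>measure_pmf (K x)) \<le> ?g x"
        unfolding hitp_step[OF x(2)] using Gg G01 by (intro integral_mono int) auto
      show ?thesis
      proof (cases "x \<in> descs v")
        case True
        have vT: "v \<in> T" using v by simp
        have nbrs: "y \<in> descs v \<or> y = parent v" if "y \<in> set_pmf (K x)" for y
        proof (cases "x = v")
          case True
          have "v \<noteq> [a0]" using descs_closed[OF v a] by simp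
          then show ?thesis using that True vT set_pmf_K[of x] by (auto simp: children_def)
        next
          case False
          have xc: "x \<in> descs v" using \<open>x \<in> descs v\<close> .
          show ?thesis
            using descs_closed[OF xc False vT] that x set_pmf_K[of x] by auto
        qed
        have "(\<integral>y. G y \<partial>measure_pmf (K x)) \<le> (\<integral>y. ?c \<partial>measure_pmf (K x))"
        proof (intro integral_mono_AE int)
          show "AE y in measure_pmf (K x). G y \<le> ?c"
            unfolding AE_measure_pmf_iff
          proof
            fix y assume "y \<in> set_pmf (K x)"
            then consider "y \<in> descs v" | "y = parent v" using nbrs by blast
            then show "G y \<le> ?c" using Gg by cases (auto simp: G_def)
          qed
        qed (use G01 in auto)
        then show ?thesis using le True by (simp add: G_def)
      next
        case False
        then have "G x = ?g x" unfolding G_def by (rule if_not_P)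
        then show ?thesis using le by simp
      qed
    qed
  qed
  then show ?thesis using v by (simp add: G_def)
qed

lemma hitp_pos:
  assumes a: "a \<in> T" and "v \<in> descs a"
  shows "hitp K a v > 0"
  using assms(2)
proof (induction "length v" arbitrary: v rule: less_induct)
  case less
  show ?case
  proof (cases "v = a")
    case False
    note c = descs_closed[OF less.prems False a]
    have "length (parent v) < length v"
      using less.prems Nil_notin_T by (cases v) (auto simp: parent_def)
    then have "hitp K a (parent v) > 0" using less c by blast
    moreover have "0 \<le> lam * sum (hitp K a) (children T v)"
      using lam by (simp add: sum_nonneg)
    ultimately have "hitp K a v * (1 + real (card (children T v)) * lam) > 0"
      using hitp_K[of v a] c False less.prems by simp
    then show ?thesis using denom_pos[of v] by (simp add: zero_less_mult_iff)
  qed (simp add: hitp_self)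
qed

text \<open>The remaining inequality comes from maximality of \<open>esc\<close>: the true
  probabilities of never visiting the parent form a subsolution.\<close>

lemma hitp_child:
  assumes a: "a \<in> T" and u: "u \<in> children T a"
  shows "hitp K a u = 1 - esc T lam u"
proof (rule antisym[OF hitp_child_le[OF assms]])
  let ?g = "hitp K a"
  \<comment> \<open>As the walk from \<open>v\<close> reaches \<open>a\<close> only through the
    parent, the quotient is the probability of reaching the parent, and \<open>y\<close> is the
    probability of never doing so.\<close>
  define y where "y v = (if v \<in> descs a \<and> v \<noteq> a then 1 - ?g v / ?g (parent v) else 0)" for v
  have "subsol T lam y"
    unfolding subsol_def
  proof (intro allI)
    fix v
    show "0 \<le> y v \<and> y v \<le> 1 \<and> (v \<notin> T \<longrightarrow> y v = 0) \<and> y v \<le> netf (lam * sum y (children T v))"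
    proof (cases "v \<in> descs a \<and> v \<noteq> a")
      case True
      note c = descs_closed[OF conjunct1[OF True] conjunct2[OF True] a]
      have gp: "?g (parent v) > 0" "?g v > 0" using hitp_pos[OF a] c True by auto
      have le: "?g v \<le> ?g (parent v)" using hitp_le_parent[OF a] True by blast
      have y01: "0 \<le> y v" "y v \<le> 1" using gp le True by (auto simp: y_def)
      let ?j = "real (card (children T v))"
      have "sum y (children T v) = (\<Sum>w\<in>children T v. 1 - ?g w / ?g v)"
      proof (rule sum.cong[OF refl])
        fix w assume w: "w \<in> children T v"
        then have "w \<in> descs a" "w \<noteq> a" "parent w = v"
          using c True prefix_length_le[of a v] by (auto simp: children_def parent_def)
        then show "y w = 1 - ?g w / ?g v" by (simp add: y_def)
      qed
      also have "\<dots> = ?j - sum ?g (children T v) / ?g v"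
        by (simp add: sum_subtractf sum_divide_distrib)
      finally have S: "sum y (children T v) = ?j - sum ?g (children T v) / ?g v" .
      have eq: "?g v * (1 + ?j * lam) = ?g (parent v) + lam * sum ?g (children T v)"
        using hitp_K[of v a] True c by blast
      have "1 + lam * sum y (children T v) = ?g (parent v) / ?g v"
        unfolding S using eq gp by (simp add: field_simps)
      then have "netf (lam * sum y (children T v)) = (?g (parent v) / ?g v - 1) / (?g (parent v) / ?g v)"
        unfolding netf_def by (metis add_diff_cancel_left')
      also have "\<dots> = y v" using gp True by (simp add: y_def field_simps)
      finally show ?thesis using y01 True by auto
    next
      case False
      have "0 \<le> y w" for w
      proof (cases "w \<in> descs a \<and> w \<noteq> a")
        case True
        then have "hitp K a (parent w) > 0"
          using hitp_pos[OF a] descs_closed(2)[OF _ _ a] by blast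
        then show ?thesis using hitp_le_parent[OF a, of w] True by (simp add: y_def)
      qed (auto simp: y_def)
      then have "0 \<le> netf (lam * sum y (children T v))"
        using lam by (intro netf_bounds mult_nonneg_nonneg sum_nonneg) auto
      then show ?thesis using False by (auto simp: y_def)
    qed
  qed
  then have "y u \<le> esc T lam u" by (rule subsol_le_esc)
  moreover have "u \<in> descs a" "u \<noteq> a" "parent u = a" using u by (auto simp: children_def parent_def)
  ultimately show "1 - esc T lam u \<le> ?g u" by (auto simp: y_def hitp_self)
qed

end

end


section \<open>The limit walk and its law\<close>

context walk_tree
begin

lemma UNIV_traj [simp]: "UNIV \<in> sets traj"
  using sets.top[of traj] by simp

lemma tree_path_root_in: "\<omega> n \<in> T \<Longrightarrow> \<omega> n \<in> descs [a0]"
  using hd_T[of "\<omega> n"] by (cases "\<omega> n") auto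

lemma prefix_same_length: "prefix v w \<Longrightarrow> length v = length w \<Longrightarrow> v = w"
  by (auto simp: prefix_def)

lemma prefix_in_T: "x \<in> T \<Longrightarrow> prefix v x \<Longrightarrow> v \<noteq> [] \<Longrightarrow> v \<in> T"
proof (induction x rule: rev_induct)
  case (snoc z x)
  show ?case
  proof (cases "v = x @ [z]")
    case False
    then have p: "prefix v x" using snoc.prems by (auto simp: prefix_snoc)
    then have "x @ [z] \<noteq> [a0]" using snoc.prems by auto
    then have "x \<in> T" using butlast_T[OF snoc.prems(1)] by simp
    then show ?thesis using snoc.IH p snoc.prems by blast
  qed (use snoc.prems in simp)
qed simp

definition tail_in :: "'a list \<Rightarrow> (nat \<Rightarrow> 'a list) set" where
  "tail_in v = {\<omega>. \<forall>\<^sub>F n in sequentially. \<omega> n \<in> descs v}"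

lemma tail_in_sets [measurable]: "tail_in v \<in> sets traj"
proof -
  have at: "(\<lambda>\<omega>. \<omega> n) -` descs v \<in> sets traj" for n
    using measurable_sets[OF measurable_traj, of "descs v" n] by simp
  have "tail_in v = (\<Union>N. \<Inter>n. (\<lambda>\<omega>. \<omega> (N + n)) -` descs v)"
  proof -
    have "(\<forall>n\<ge>N. \<omega> n \<in> descs v) \<longleftrightarrow> (\<forall>n. \<omega> (N + n) \<in> descs v)" for N :: nat and \<omega>
      by (metis le_iff_add)
    then show ?thesis by (simp add: tail_in_def eventually_sequentially set_eq_iff)
  qed
  then show ?thesis
    by (simp only:) (intro sets.countable_UN'' sets.countable_INT'' countableI_type at; simp)
qed

lemma tail_in_unique:
  assumes "\<omega> \<in> tail_in v" "\<omega> \<in> tail_in w" "length v \<le> length w"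
  shows "prefix v w"
proof -
  from assms(1,2) have "\<forall>\<^sub>F n in sequentially. \<omega> n \<in> descs v \<and> \<omega> n \<in> descs w"
    by (auto simp: tail_in_def eventually_conj_iff)
  then obtain n where "prefix v (\<omega> n)" "prefix w (\<omega> n)"
    by (metis (mono_tags, lifting) eventually_happens' mem_Collect_eq sequentially_bot)
  then show ?thesis using assms(3) prefix_length_prefix by blast
qed

lemma length_initial_walk [simp]: "length (initial_walk p i) = Suc i"
  by (simp add: initial_walk_def)

text \<open>Turns the existential over infinite paths into countable operations on measurable
  events. The vertices eventually containing the walk below them are nested by
  \<open>tail_in_unique\<close>, hence are the initial walks of one path.\<close>

lemma limit_walk_event:
  assumes g: "\<gamma> \<in> T"
  shows "{\<omega>. \<exists>p. is_limit_walk T \<omega> p \<and> initial_walk p (walk_length \<gamma>) = \<gamma>}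
    = tail_in \<gamma> \<inter> (\<Inter>i. \<Union>v\<in>{v\<in>T. length v = Suc i}. tail_in v)" (is "?L = ?R")
proof (intro equalityI subsetI)
  fix \<omega> assume "\<omega> \<in> ?L"
  then obtain p where p: "is_limit_walk T \<omega> p" "initial_walk p (walk_length \<gamma>) = \<gamma>" by auto
  have t: "initial_walk p i \<in> {v\<in>T. length v = Suc i}" "\<omega> \<in> tail_in (initial_walk p i)" for i
    using p(1) by (auto simp: is_limit_walk_def tail_in_def)
  have "\<omega> \<in> (\<Inter>i. \<Union>v\<in>{v\<in>T. length v = Suc i}. tail_in v)"
    by (rule INT_I, rule UN_I, rule t, rule t)
  then show "\<omega> \<in> ?R" using t(2)[of "walk_length \<gamma>"] p(2) by simp
next
  fix \<omega> assume R: "\<omega> \<in> ?R"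
  then have "\<forall>i. \<exists>v. v \<in> T \<and> length v = Suc i \<and> \<omega> \<in> tail_in v" by auto
  then obtain v where v: "\<And>i. v i \<in> T" "\<And>i. length (v i) = Suc i" "\<And>i. \<omega> \<in> tail_in (v i)"
    by metis
  define p where "p i = v i ! i" for i
  have pre: "prefix (v j) (v i)" if "j \<le> i" for i j
    using tail_in_unique[OF v(3) v(3)] v(2) that by simp
  have iw: "initial_walk p i = v i" for i
  proof (rule nth_equalityI)
    fix j assume "j < length (initial_walk p i)"
    then have j: "j \<le> i" by simp
    then have "initial_walk p i ! j = v j ! j"
      by (simp add: initial_walk_def p_def nth_append nth_map[of j "[0..<Suc i]"] del: upt_Suc)
    also have "\<dots> = v i ! j"
      using pre[OF j] v(2)[of j] by (auto simp: prefix_def nth_append)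
    finally show "initial_walk p i ! j = v i ! j" .
  qed (simp add: v)
  have "is_limit_walk T \<omega> p"
    using v(1,3) by (auto simp: is_limit_walk_def iw tail_in_def)
  moreover have "initial_walk p (walk_length \<gamma>) = \<gamma>"
  proof -
    have l: "length (v (walk_length \<gamma>)) = length \<gamma>"
      using hd_T[OF g] v(2) by (cases \<gamma>) (auto simp: walk_length_def)
    have "prefix (v (walk_length \<gamma>)) \<gamma>"
      using tail_in_unique[OF v(3), of \<gamma>] R l by simp
    then have "v (walk_length \<gamma>) = \<gamma>" using l by (rule prefix_same_length)
    then show ?thesis by (simp add: iw)
  qed
  ultimately show "\<omega> \<in> ?L" by blast
qed

lemma limit_walk_prob_outside:
  assumes "\<gamma> \<notin> T"
  shows "limit_walk_prob T r lam \<gamma> = 0"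
proof -
  have "{X \<in> space (RW T r lam). \<exists>p. is_limit_walk T X p \<and> initial_walk p (walk_length \<gamma>) = \<gamma>} = {}"
    using assms by (auto simp: is_limit_walk_def) metis
  then show ?thesis by (simp only: limit_walk_prob_def measure_empty)
qed

definition tree_path :: "(nat \<Rightarrow> 'a list) \<Rightarrow> bool" where
  "tree_path \<omega> \<longleftrightarrow> \<omega> 0 = [a0] \<and> (\<forall>n. \<omega> n \<in> T \<and>
     (\<omega> (Suc n) \<in> children T (\<omega> n) \<or> \<omega> n \<noteq> [a0] \<and> \<omega> (Suc n) = parent (\<omega> n)))"

text \<open>The only edge out of the subtree of \<open>w\<close> leads from \<open>w\<close> to its
  parent \<open>v\<close>.\<close>

lemma tree_path_stays:
  assumes \<omega>: "tree_path \<omega>" and w: "w \<in> children T v" and v: "v \<in> T" and N: "\<omega> N \<in> descs w"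
    and nv: "\<And>n. n > N \<Longrightarrow> \<omega> n \<noteq> v" and "n \<ge> N"
  shows "\<omega> n \<in> descs w"
  using \<open>n \<ge> N\<close>
proof (induction n rule: dec_induct)
  case (step n)
  have "\<omega> (Suc n) \<in> children T (\<omega> n) \<or> \<omega> (Suc n) = parent (\<omega> n)"
    using \<omega> by (auto simp: tree_path_def)
  then show ?case
  proof
    assume "\<omega> (Suc n) \<in> children T (\<omega> n)"
    then show ?thesis using step.IH by (auto simp: children_def)
  next
    assume p: "\<omega> (Suc n) = parent (\<omega> n)"
    have "\<omega> n \<noteq> w"
      using p nv[of "Suc n"] step.hyps childrenD[OF w] by (auto simp: parent_def)
    then show ?thesis using descs_closed(2)[OF step.IH] childrenD[OF w] p by simp
  qed
qed (rule N)

lemma tree_path_tail_children: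
  assumes \<omega>: "tree_path \<omega>" and fin: "\<And>y. y \<in> T \<Longrightarrow> \<forall>\<^sub>F n in sequentially. \<omega> n \<noteq> y"
    and v: "v \<in> T" and t: "\<omega> \<in> tail_in v"
  shows "\<exists>w\<in>children T v. \<omega> \<in> tail_in w"
proof -
  have "\<forall>\<^sub>F n in sequentially. \<omega> n \<in> descs v \<and> \<omega> n \<noteq> v"
    using t fin[OF v] by (auto simp: tail_in_def eventually_conj_iff)
  then obtain N where N: "\<And>n. n \<ge> N \<Longrightarrow> \<omega> n \<in> descs v \<and> \<omega> n \<noteq> v"
    by (auto simp: eventually_sequentially)
  from N[of N] obtain z zs where z: "\<omega> N = v @ z # zs"
    by (auto simp: prefix_def neq_Nil_conv)
  let ?w = "v @ [z]"
  have "prefix ?w (\<omega> N)" "\<omega> N \<in> T" using z N[of N] by auto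
  then have wT: "?w \<in> T" using prefix_in_T by blast
  then have w: "?w \<in> children T v" by (auto simp: children_def)
  have "\<omega> n \<in> descs ?w" if "n \<ge> N" for n
    by (rule tree_path_stays[OF \<omega> w v _ _ that]) (use N \<open>prefix ?w (\<omega> N)\<close> in auto)
  then show ?thesis using w by (auto simp: tail_in_def eventually_sequentially)
qed

text \<open>Prepares the last-exit decomposition: ending below \<open>w\<close> means that the last
  visit to \<open>v\<close> is followed at once by the step to \<open>w\<close>.\<close>

lemma tree_path_last_exit:
  assumes \<omega>: "tree_path \<omega>" and v: "v \<in> T" and w: "w \<in> children T v"
  shows "\<omega> \<in> tail_in w \<longleftrightarrow> (\<exists>n. \<omega> n = v \<and> \<omega> (Suc n) = w \<and> (\<forall>j>n. \<omega> j \<noteq> v))"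
proof
  assume "\<omega> \<in> tail_in w"
  then have ex: "\<exists>N. \<forall>n\<ge>N. \<omega> n \<in> descs w" by (auto simp: tail_in_def eventually_sequentially)
  \<comment> \<open>The first time from which the walk remains below \<open>w\<close>; the step into
    this time must be the one from \<open>v\<close> to \<open>w\<close>.\<close>
  define N where "N = (LEAST N. \<forall>n\<ge>N. \<omega> n \<in> descs w)"
  have N: "\<And>n. n \<ge> N \<Longrightarrow> \<omega> n \<in> descs w"
    using LeastI_ex[OF ex] unfolding N_def by blast
  have "[a0] \<notin> descs w"
    using child_ne_root[OF v w] childrenD[OF w] Nil_notin_T by (auto simp: prefix_Cons)
  then have "N \<noteq> 0" using N[of 0] \<omega> by (auto simp: tree_path_def)
  then obtain n where n: "N = Suc n" by (cases N) auto
  have "\<not> (\<forall>i\<ge>n. \<omega> i \<in> descs w)"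
    using not_less_Least[of n "\<lambda>N. \<forall>n\<ge>N. \<omega> n \<in> descs w"] n unfolding N_def by simp
  then have nin: "\<omega> n \<notin> descs w" using N unfolding n by (metis not_less_eq_eq le_antisym)
  have S: "\<omega> (Suc n) \<in> descs w" using N n by simp
  have "\<omega> (Suc n) = w"
  proof (rule ccontr)
    assume ne: "\<omega> (Suc n) \<noteq> w"
    have step: "\<omega> (Suc n) \<in> children T (\<omega> n) \<or> \<omega> (Suc n) = parent (\<omega> n)" and T: "\<omega> n \<in> T" "\<omega> n \<noteq> []"
      using \<omega> hd_T by (auto simp: tree_path_def)
    from step show False
    proof
      assume "\<omega> (Suc n) \<in> children T (\<omega> n)"
      then have "parent (\<omega> (Suc n)) = \<omega> n" by (auto simp: children_def parent_def)
      then show False using descs_closed(2)[OF S ne] childrenD[OF w] nin by simp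
    next
      assume "\<omega> (Suc n) = parent (\<omega> n)"
      then have "prefix (\<omega> (Suc n)) (\<omega> n)" by (simp add: parent_def prefixeq_butlast)
      then show False using S nin T by auto
    qed
  qed
  moreover have "\<omega> n = v"
  proof -
    have "\<omega> (Suc n) \<in> children T (\<omega> n) \<or> \<omega> (Suc n) = parent (\<omega> n)" and T: "\<omega> n \<in> T"
      using \<omega> by (auto simp: tree_path_def)
    then show ?thesis
    proof (elim disjE)
      assume "\<omega> (Suc n) \<in> children T (\<omega> n)"
      then show ?thesis using w calculation by (auto simp: children_def)
    next
      assume "\<omega> (Suc n) = parent (\<omega> n)"
      then have "prefix w (\<omega> n)" using calculation by (simp add: parent_def prefixeq_butlast)
      then show ?thesis using nin T by auto
    qed
  qed
  moreover have "\<omega> j \<noteq> v" if "j > n" for j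
  proof -
    have "\<omega> j \<in> descs w" using N n that by simp
    then show ?thesis using w by (auto simp: children_def prefix_def)
  qed
  ultimately show "\<exists>n. \<omega> n = v \<and> \<omega> (Suc n) = w \<and> (\<forall>j>n. \<omega> j \<noteq> v)" by blast
next
  assume "\<exists>n. \<omega> n = v \<and> \<omega> (Suc n) = w \<and> (\<forall>j>n. \<omega> j \<noteq> v)"
  then obtain n where n: "\<omega> n = v" "\<omega> (Suc n) = w" "\<forall>j>n. \<omega> j \<noteq> v" by blast
  have "\<omega> i \<in> descs w" if "i \<ge> Suc n" for i
    by (rule tree_path_stays[OF \<omega> w v _ _ that]) (use n childrenD[OF w] in auto)
  then show "\<omega> \<in> tail_in w" by (auto simp: tail_in_def eventually_sequentially)
qed

context
  fixes lam :: real
  assumes lam: "lam > 0"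
begin

abbreviation "KK \<equiv> rw_step T [a0] lam"
abbreviation "P \<equiv> markov_law KK [a0]"

lemma set_pmf_K_root: "set_pmf (KK [a0]) = children T [a0]"
  using children_root finite_children by (simp add: K_root[OF lam])

lemma AE_tree_path: "AE \<omega> in P. tree_path \<omega>"
  using AE_markov_law_edges[of KK "[a0]"] AE_markov_law_start[of "[a0]" KK]
proof eventually_elim
  case (elim \<omega>)
  have T: "\<omega> n \<in> T" for n
  proof (induction n)
    case (Suc n)
    show ?case
    proof (cases "\<omega> n = [a0]")
      case True
      then show ?thesis using elim(1)[rule_format, of n] set_pmf_K_root childrenD by auto
    next
      case False
      then show ?thesis using elim(1)[rule_format, of n] set_pmf_K[OF lam Suc False] childrenD
          butlast_T[OF Suc False] by (auto simp: parent_def)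
    qed
  qed (use elim root_in in simp)
  show ?case
    unfolding tree_path_def
  proof (intro conjI allI)
    fix n
    show "\<omega> (Suc n) \<in> children T (\<omega> n) \<or> \<omega> n \<noteq> [a0] \<and> \<omega> (Suc n) = parent (\<omega> n)"
      using elim(1)[rule_format, of n] set_pmf_K_root set_pmf_K[OF lam T, of n]
      by (cases "\<omega> n = [a0]") auto
  qed (use elim T in auto)
qed

definition return_prob :: real where
  "return_prob = (\<integral>y. hitp KK [a0] y \<partial>measure_pmf (KK [a0]))"

lemma return_prob_eq: "return_prob = 1 - sum (esc T lam) (children T [a0]) / card (children T [a0])"
proof -
  have "card (children T [a0]) > 0" using children_root finite_children by (simp add: card_gt_0_iff)
  moreover have "sum (hitp KK [a0]) (children T [a0]) = (\<Sum>u\<in>children T [a0]. 1 - esc T lam u)"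
    by (intro sum.cong refl hitp_child lam root_in)
  ultimately show ?thesis
    unfolding return_prob_def K_root[OF lam]
    by (subst integral_pmf_of_set[OF children_root finite_children])
       (simp add: K_root[OF lam, symmetric] sum_subtractf diff_divide_distrib)
qed

lemma measure_return: "measure P {\<omega>. \<exists>n>0. \<omega> n = [a0]} = return_prob"
proof -
  have "{\<omega>\<in>space traj. \<exists>n>0. \<omega> n = [a0]} \<in> sets traj" by measurable
  moreover have "case_nat [a0] -` {\<omega>. \<exists>n>0. \<omega> n = [a0]} = {\<omega>. \<exists>i. \<omega> i = [a0]}"
    by (auto simp: gr0_conv_Suc split: nat.splits)
  ultimately show ?thesis
    unfolding return_prob_def hitp_def by (subst measure_markov_law_step) simp_all
qed

lemma RW_recurrent_iff_children:
  "RW_recurrent T [a0] lam \<longleftrightarrow> sum (esc T lam) (children T [a0]) = 0"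
proof -
  have s: "{\<omega>. \<exists>n>0. \<omega> n = [a0]} \<in> sets traj"
  proof -
    have "{\<omega>\<in>space traj. \<exists>n>0. \<omega> n = [a0]} \<in> sets traj" by measurable
    then show ?thesis by simp
  qed
  have "RW_recurrent T [a0] lam \<longleftrightarrow> measure P {\<omega>. \<exists>n>0. \<omega> n = [a0]} = 1"
    unfolding RW_recurrent_def RW_def using s by (subst ml.prob_eq_1) simp_all
  also have "\<dots> \<longleftrightarrow> sum (esc T lam) (children T [a0]) = 0"
    unfolding measure_return return_prob_eq using children_root finite_children by simp
  finally show ?thesis .
qed

text \<open>The root has no parent, so \<open>esc\<close> at the root is not itself an escape
  probability of the chain; but it vanishes exactly when all children have escape probability
  0.\<close>

lemma RW_recurrent_iff: "RW_recurrent T [a0] lam \<longleftrightarrow> esc T lam [a0] = 0"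
  unfolding RW_recurrent_iff_children esc_eq[OF less_imp_le[OF lam] root_in] using lam
  by (subst netf_eq_0_iff) auto

lemma Kpow_1: "Kpow K' 1 x = K' x"
  unfolding One_nat_def Kpow.simps by (simp add: bind_return_pmf')

lemma Kpow_root_pos: "y \<in> T \<Longrightarrow> \<exists>d. pmf (Kpow KK d y) [a0] > 0"
proof (induction y rule: rev_induct)
  case (snoc z x)
  show ?case
  proof (cases "x @ [z] = [a0]")
    case True
    then show ?thesis by (intro exI[of _ 0]) simp
  next
    case False
    then have "x \<in> T" using butlast_T[OF snoc.prems] by simp
    then obtain d where d: "pmf (Kpow KK d x) [a0] > 0" using snoc.IH by auto
    have "x \<in> set_pmf (KK (x @ [z]))"
      using set_pmf_K[OF lam snoc.prems False] by (simp add: parent_def)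
    then have "pmf (Kpow KK 1 (x @ [z])) x > 0"
      unfolding Kpow_1 by (simp add: pmf_positive)
    then have "0 < pmf (Kpow KK 1 (x @ [z])) x * pmf (Kpow KK d x) [a0]" using d by simp
    also have "\<dots> \<le> pmf (Kpow KK (1 + d) (x @ [z])) [a0]" by (rule Kpow_add_ge)
    finally show ?thesis by blast
  qed
qed (use Nil_notin_T in simp)

section \<open>The transient case: Green function and last exits\<close>

context
  assumes transient: "esc T lam [a0] > 0"
begin

lemma return_prob_less_1: "return_prob < 1"
proof -
  have "sum (esc T lam) (children T [a0]) \<noteq> 0"
    using transient RW_recurrent_iff RW_recurrent_iff_children by simp
  then have "sum (esc T lam) (children T [a0]) > 0"
    by (simp add: order_less_le)
  then show ?thesis
    unfolding return_prob_eq using children_root finite_children by (simp add: card_gt_0_iff)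
qed

text \<open>The right-hand side satisfies the first-step recursion of the Green function at the
  root, with source 1 there, so the truncated sums stay below it by induction.\<close>

lemma green_root_bound:
  "(\<Sum>n<N. pmf (Kpow KK n x) [a0]) \<le> hitp KK [a0] x / (1 - return_prob)"
proof (induction N arbitrary: x)
  case 0
  then show ?case using return_prob_less_1 by simp
next
  case (Suc N)
  have int: "integrable (measure_pmf p) (\<lambda>y. pmf (Kpow KK n y) z)" for p n z
    by (intro measure_pmf.integrable_const_bound[where B = 1]) (auto simp: pmf_le_1)
  have inth: "integrable (measure_pmf p) (hitp KK a)" for p a
    by (intro measure_pmf.integrable_const_bound[where B = 1]) auto
  have "(\<Sum>n<Suc N. pmf (Kpow KK n x) [a0]) = of_bool (x = [a0]) + (\<Sum>n<N. pmf (Kpow KK (Suc n) x) [a0])"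
    by (subst sum.lessThan_Suc_shift) (simp add: pmf_return indicator_def)
  also have "(\<Sum>n<N. pmf (Kpow KK (Suc n) x) [a0])
      = (\<integral>y. (\<Sum>n<N. pmf (Kpow KK n y) [a0]) \<partial>measure_pmf (KK x))"
    by (simp add: pmf_bind int)
  also have "\<dots> \<le> (\<integral>y. hitp KK [a0] y / (1 - return_prob) \<partial>measure_pmf (KK x))"
    using Suc.IH by (intro integral_mono Bochner_Integration.integrable_sum int integrable_divide inth)
  also have "\<dots> = (\<integral>y. hitp KK [a0] y \<partial>measure_pmf (KK x)) / (1 - return_prob)"
    by simp
  also have "of_bool (x = [a0]) + \<dots> \<le> hitp KK [a0] x / (1 - return_prob)"
  proof (cases "x = [a0]")
    case True
    then show ?thesis using return_prob_less_1
      by (simp add: return_prob_def[symmetric] hitp_self field_simps)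
  next
    case False
    then show ?thesis using hitp_step[OF False, of KK] by simp
  qed
  finally show ?case by simp
qed

text \<open>From \<open>y\<close> the root is reached in some fixed number \<open>d\<close> of steps
  with positive probability, so each visit to \<open>y\<close> is paid for by expected visits to the
  root.\<close>

lemma green_summable:
  assumes "y \<in> T"
  shows "summable (\<lambda>n. pmf (Kpow KK n [a0]) y)"
proof -
  have root: "summable (\<lambda>n. pmf (Kpow KK n [a0]) [a0])"
    using green_root_bound[of "[a0]"] by (intro summableI_nonneg_bounded) auto
  obtain d where d: "pmf (Kpow KK d y) [a0] > 0" using Kpow_root_pos[OF assms] by blast
  have "summable (\<lambda>n. pmf (Kpow KK n [a0]) y * pmf (Kpow KK d y) [a0])"
  proof (rule summable_comparison_test')
    show "summable (\<lambda>n. pmf (Kpow KK (n + d) [a0]) [a0])"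
      using root by (rule summable_ignore_initial_segment)
    show "norm (pmf (Kpow KK n [a0]) y * pmf (Kpow KK d y) [a0]) \<le> pmf (Kpow KK (n + d) [a0]) [a0]"
      if "n \<ge> 0" for n
      using Kpow_add_ge[where K = KK and m = n and x = "[a0]" and y = y and n = d and z = "[a0]"] by simp
  qed
  then show ?thesis
    using d summable_mult_D[of "pmf (Kpow KK d y) [a0]"] by (simp add: mult.commute)
qed

lemma measure_at: "measure P {\<omega>. \<omega> n = y} = pmf (Kpow KK n [a0]) y"
  using markov_property[OF UNIV_traj, of KK "[a0]" n y]
  by (simp add: ml.emeasure_eq_measure ml.prob_space[simplified])

lemma sets_at: "{\<omega>. \<omega> n = y} \<in> sets traj"
proof -
  have "{\<omega>\<in>space traj. \<omega> n = y} \<in> sets traj" by measurable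
  then show ?thesis by simp
qed

lemma AE_finite_visits: "AE \<omega> in P. \<forall>y\<in>T. \<forall>\<^sub>F n in sequentially. \<omega> n \<noteq> y"
proof -
  have "AE \<omega> in P. \<forall>\<^sub>F n in sequentially. \<omega> \<in> space P - {\<omega>. \<omega> n = y}" if "y \<in> T" for y
    by (rule borel_cantelli_AE1)
       (use green_summable[OF that] in \<open>simp_all add: measure_at sets_at ml.emeasure_eq_measure\<close>)
  then have "AE \<omega> in P. y \<in> T \<longrightarrow> (\<forall>\<^sub>F n in sequentially. \<omega> n \<noteq> y)" for y
    by (cases "y \<in> T") auto
  then have "AE \<omega> in P. \<forall>y. y \<in> T \<longrightarrow> (\<forall>\<^sub>F n in sequentially. \<omega> n \<noteq> y)"
    by (simp add: AE_all_countable)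
  then show ?thesis by eventually_elim auto
qed

lemma AE_has_limit:
  "AE \<omega> in P. \<omega> \<in> (\<Inter>i. \<Union>v\<in>{v\<in>T. length v = Suc i}. tail_in v)"
  using AE_tree_path AE_finite_visits
proof eventually_elim
  case (elim \<omega>)
  have "\<exists>v\<in>T. length v = Suc i \<and> \<omega> \<in> tail_in v" for i
  proof (induction i)
    case 0
    have "\<omega> n \<in> descs [a0]" for n
      using elim(1) tree_path_root_in[of \<omega> n] by (simp add: tree_path_def)
    then show ?case using root_in by (auto simp: tail_in_def intro!: bexI[of _ "[a0]"])
  next
    case (Suc i)
    then obtain v where v: "v \<in> T" "length v = Suc i" "\<omega> \<in> tail_in v" by blast
    obtain w where w: "w \<in> children T v" "\<omega> \<in> tail_in w"
      using tree_path_tail_children[OF elim(1) _ v(1,3)] elim(2) by blast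
    then show ?case using v by (intro bexI[of _ w]) (auto simp: children_def)
  qed
  then show ?case by auto
qed

lemma limit_walk_prob_eq:
  assumes "\<gamma> \<in> T"
  shows "limit_walk_prob T [a0] lam \<gamma> = measure P (tail_in \<gamma>)"
proof -
  have m: "(\<Inter>i. \<Union>v\<in>{v\<in>T. length v = Suc i}. tail_in v) \<in> sets traj"
    by (intro sets.countable_INT'' sets.countable_UN'' countableI_type) auto
  have "measure P (tail_in \<gamma> \<inter> (\<Inter>i. \<Union>v\<in>{v\<in>T. length v = Suc i}. tail_in v)) = measure P (tail_in \<gamma>)"
    using AE_has_limit m by (intro measure_eq_AE sets.Int) auto
  then show ?thesis
    using limit_walk_event[OF assms] by (simp add: limit_walk_prob_def RW_def)
qed

text \<open>Sums over the time of the last visit to \<open>v\<close>. The Markov property splits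
  each term into the probability of being at \<open>v\<close>, the step to \<open>w\<close>, and the
  escape from \<open>w\<close> without returning to \<open>v\<close>.\<close>

lemma measure_tail_in_child:
  assumes v: "v \<in> T" and w: "w \<in> children T v"
  shows "measure P (tail_in w) = (\<Sum>n. pmf (Kpow KK n [a0]) v) * (pmf (KK v) w * esc T lam w)"
proof -
  let ?B = "{\<omega> :: nat \<Rightarrow> 'a list. \<omega> 1 = w \<and> (\<forall>j>0. \<omega> j \<noteq> v)}"
  have B: "?B \<in> sets traj"
  proof -
    have "{\<omega>\<in>space traj. \<omega> 1 = w \<and> (\<forall>j>0. \<omega> j \<noteq> v)} \<in> sets traj" by measurable
    then show ?thesis by simp
  qed
  have vw: "v \<noteq> w" using w by (auto simp: children_def)
  have pB: "measure (markov_law KK v) ?B = pmf (KK v) w * esc T lam w"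
  proof -
    have v': "case_nat v -` ?B = {\<omega>. \<omega> 0 = w \<and> (\<forall>j. \<omega> j \<noteq> v)}"
      by (auto simp: gr0_conv_Suc split: nat.splits)
    have C: "{\<omega>. \<omega> 0 = w \<and> (\<forall>j. \<omega> j \<noteq> v)} \<in> sets traj"
    proof -
      have "{\<omega>\<in>space traj. \<omega> 0 = w \<and> (\<forall>j. \<omega> j \<noteq> v)} \<in> sets traj" by measurable
      then show ?thesis by simp
    qed
    have "measure (markov_law KK y) {\<omega>. \<omega> 0 = w \<and> (\<forall>j. \<omega> j \<noteq> v)} = esc T lam w * indicator {w} y" for y
    proof (cases "y = w")
      case True
      have "measure (markov_law KK w) {\<omega>. \<omega> 0 = w \<and> (\<forall>j. \<omega> j \<noteq> v)}
          = measure (markov_law KK w) (space (markov_law KK w) - {\<omega>. \<exists>j. \<omega> j = v})"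
        using AE_markov_law_start[of w KK] C
        by (intro measure_eq_AE) (auto elim!: eventually_mono)
      also have "\<dots> = 1 - hitp KK v w"
        unfolding hitp_def by (rule ml.prob_compl) simp
      also have "\<dots> = esc T lam w"
        using hitp_child[OF lam v w] by simp
      finally show ?thesis using True by simp
    next
      case False
      have "measure (markov_law KK y) {\<omega>. \<omega> 0 = w \<and> (\<forall>j. \<omega> j \<noteq> v)} = 0"
        using AE_markov_law_start[of y KK] C False
        by (subst ml.prob_eq_0) (auto elim!: eventually_mono)
      then show ?thesis using False by simp
    qed
    then show ?thesis
      unfolding measure_markov_law_step[OF B] v' by (simp add: measure_pmf_single mult.commute)
  qed
  define A where "A n = {\<omega> :: nat \<Rightarrow> 'a list. \<omega> n = v \<and> (\<lambda>i. \<omega> (i + n)) \<in> ?B}" for n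
  have Aset: "A n \<in> sets traj" for n unfolding A_def by (rule shift_set_measurable[OF B])
  have A_iff: "\<omega> \<in> A n \<longleftrightarrow> \<omega> n = v \<and> \<omega> (Suc n) = w \<and> (\<forall>j>n. \<omega> j \<noteq> v)" for \<omega> n
  proof -
    have "(\<forall>j>0. \<omega> (j + n) \<noteq> v) \<longleftrightarrow> (\<forall>j>n. \<omega> j \<noteq> v)"
      by (metis add.commute add_diff_inverse_nat less_add_same_cancel2 not_less_iff_gr_or_eq zero_less_diff)
    then show ?thesis by (auto simp: A_def)
  qed
  have "measure P (tail_in w) = measure P (\<Union>n. A n)"
  proof (rule measure_eq_AE)
    show "AE \<omega> in P. \<omega> \<in> tail_in w \<longleftrightarrow> \<omega> \<in> (\<Union>n. A n)"
      using AE_tree_path by eventually_elim (simp add: tree_path_last_exit[OF _ v w] A_iff)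
  qed (use Aset in auto)
  also have "\<dots> = (\<Sum>n. measure P (A n))"
  proof (rule sums_unique, rule ml.finite_measure_UNION)
    have "A m \<inter> A n = {}" if "m < n" for m n
      using that by (auto simp: A_iff)
    then show "disjoint_family A"
      unfolding disjoint_family_on_def by (metis Int_commute nat_neq_iff)
  qed (use Aset in auto)
  also have "\<dots> = (\<Sum>n. pmf (Kpow KK n [a0]) v * (pmf (KK v) w * esc T lam w))"
  proof -
    have "measure P (A n) = pmf (Kpow KK n [a0]) v * (pmf (KK v) w * esc T lam w)" for n
      using markov_property[OF B, of KK "[a0]" n v] pB
      by (simp add: A_def ml.emeasure_eq_measure ennreal_mult'[symmetric])
    then show ?thesis by simp
  qed
  also have "\<dots> = (\<Sum>n. pmf (Kpow KK n [a0]) v) * (pmf (KK v) w * esc T lam w)"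
    by (rule suminf_mult2[symmetric, OF green_summable[OF v]])
  finally show ?thesis .
qed

lemma measure_tail_in_sum:
  assumes v: "v \<in> T"
  shows "measure P (tail_in v) = (\<Sum>w\<in>children T v. measure P (tail_in w))"
proof -
  have "measure P (tail_in v) = measure P (\<Union>w\<in>children T v. tail_in w)"
  proof (rule measure_eq_AE)
    show "AE \<omega> in P. \<omega> \<in> tail_in v \<longleftrightarrow> \<omega> \<in> (\<Union>w\<in>children T v. tail_in w)"
      using AE_tree_path AE_finite_visits
    proof eventually_elim
      case (elim \<omega>)
      have "\<omega> \<in> tail_in v" if "w \<in> children T v" "\<omega> \<in> tail_in w" for w
        using that by (auto simp: tail_in_def children_def elim!: eventually_mono append_prefixD)
      then show ?case using tree_path_tail_children[OF elim(1) _ v] elim(2) by blast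
    qed
  qed (auto intro!: sets.countable_UN'' countableI_type)
  also have "\<dots> = (\<Sum>w\<in>children T v. measure P (tail_in w))"
  proof (rule ml.finite_measure_finite_Union)
    show "disjoint_family_on tail_in (children T v)"
      unfolding disjoint_family_on_def
    proof (intro ballI impI)
      fix w w' assume w: "w \<in> children T v" "w' \<in> children T v" "w \<noteq> w'"
      then have l: "length w = length w'" by (auto simp: children_def)
      then show "tail_in w \<inter> tail_in w' = {}"
        unfolding disjoint_iff
        using tail_in_unique[OF _ _ eq_imp_le[OF l]] w(3) prefix_same_length[OF _ l] by metis
    qed
  qed (use finite_children in auto)
  finally show ?thesis .
qed

lemma limit_walk_prob_root: "limit_walk_prob T [a0] lam [a0] = 1"
proof -
  have "AE \<omega> in P. \<omega> \<in> tail_in [a0]"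
    using AE_tree_path
  proof eventually_elim
    case (elim \<omega>)
    have "\<omega> n \<in> descs [a0]" for n
      using elim tree_path_root_in[of \<omega> n] by (simp add: tree_path_def)
    then show ?case by (auto simp: tail_in_def)
  qed
  then show ?thesis
    unfolding limit_walk_prob_eq[OF root_in] by (subst ml.prob_eq_1) auto
qed

lemma limit_walk_prob_children:
  assumes v: "v \<in> T"
  obtains c where "c \<ge> 0" "\<And>w. w \<in> children T v \<Longrightarrow> limit_walk_prob T [a0] lam w = c * esc T lam w"
    "limit_walk_prob T [a0] lam v = c * sum (esc T lam) (children T v)"
proof -
  \<comment> \<open>All children of \<open>v\<close> are chosen with this same probability, so the
    law of the limit walk distinguishes them only through \<open>esc\<close>.\<close>
  define \<kappa> where "\<kappa> = (if v = [a0] then 1 / card (children T v)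
     else lam / (1 + real (card (children T v)) * lam))"
  have \<kappa>: "pmf (KK v) w = \<kappa>" if "w \<in> children T v" for w
  proof (cases "v = [a0]")
    case True
    then show ?thesis using that finite_children children_root by (simp add: \<kappa>_def K_root[OF lam])
  next
    case False
    then show ?thesis
      using that parent_notin_children[OF v] by (auto simp: \<kappa>_def pmf_K[OF lam v False])
  qed
  define c where "c = (\<Sum>n. pmf (Kpow KK n [a0]) v) * \<kappa>"
  have child: "limit_walk_prob T [a0] lam w = c * esc T lam w" if w: "w \<in> children T v" for w
    using measure_tail_in_child[OF v w] \<kappa>[OF w] childrenD[OF w]
    by (simp add: limit_walk_prob_eq c_def mult.assoc)
  have "limit_walk_prob T [a0] lam v = (\<Sum>w\<in>children T v. limit_walk_prob T [a0] lam w)"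
    unfolding limit_walk_prob_eq[OF v] measure_tail_in_sum[OF v]
    using childrenD by (intro sum.cong refl) (simp add: limit_walk_prob_eq)
  also have "\<dots> = c * sum (esc T lam) (children T v)"
    using child by (simp add: sum_distrib_left)
  finally have sum: "limit_walk_prob T [a0] lam v = c * sum (esc T lam) (children T v)" .
  have "c \<ge> 0"
    unfolding c_def \<kappa>_def using lam green_summable[OF v]
    by (intro mult_nonneg_nonneg suminf_nonneg) (auto intro!: divide_nonneg_nonneg add_nonneg_nonneg)
  then show ?thesis using that child sum by blast
qed

text \<open>The product form avoids division by a sum that may vanish below a trapped walk; the
  second claim supplies the value in that degenerate case.\<close>

lemma limit_walk_prob_child:
  assumes v: "v \<in> T" and w: "w \<in> children T v"
  shows "limit_walk_prob T [a0] lam w * sum (esc T lam) (children T v)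
      = esc T lam w * limit_walk_prob T [a0] lam v"
    and "esc T lam w = 0 \<Longrightarrow> limit_walk_prob T [a0] lam w = 0"
proof -
  obtain c where c: "limit_walk_prob T [a0] lam w = c * esc T lam w"
    "limit_walk_prob T [a0] lam v = c * sum (esc T lam) (children T v)"
    using limit_walk_prob_children[OF v] w by blast
  show "limit_walk_prob T [a0] lam w * sum (esc T lam) (children T v)
      = esc T lam w * limit_walk_prob T [a0] lam v"
    unfolding c by (simp only: mult_ac)
  show "limit_walk_prob T [a0] lam w = 0" if "esc T lam w = 0"
    unfolding c that by simp
qed

end

end

end


section \<open>Lattice walks as step sequences\<close>

definition dirs :: "point set" where
  "dirs = {(1, 0), (-1, 0), (0, 1), (0, -1)}"

text \<open>Walks are handled through their step sequences: translation becomes invisible and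
  concatenation becomes \<open>@\<close>. The predicates below are statements about steps,
  independent of the starting point.\<close>

primrec walk :: "point \<Rightarrow> point list \<Rightarrow> point list" where
  "walk p [] = [p]"
| "walk p (d # s) = p # walk (p + d) s"

definition pos :: "point list \<Rightarrow> nat \<Rightarrow> point" where
  "pos s i = sum_list (take i s)"

definition ht :: "point list \<Rightarrow> int" where
  "ht s = snd (sum_list s)"

definition saw_steps :: "point list \<Rightarrow> bool" where
  "saw_steps s \<longleftrightarrow> set s \<subseteq> dirs \<and> distinct (walk 0 s)"

lemma lattice_adj_iff: "lattice_adj u v \<longleftrightarrow> v - u \<in> dirs"
proof -
  obtain a b c d where uv: "u = (a, b)" "v = (c, d)" by (cases u, cases v) auto
  show ?thesis unfolding lattice_adj_def dirs_def uv by (auto simp: abs_if split: if_splits)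
qed

lemma finite_dirs [simp]: "finite dirs"
  by (simp add: dirs_def)

lemma length_walk [simp]: "length (walk p s) = Suc (length s)"
  by (induction s arbitrary: p) auto

lemma walk_ne [simp]: "walk p s \<noteq> []" "[] \<noteq> walk p s"
  by (cases s; simp)+

lemma hd_walk [simp]: "hd (walk p s) = p"
  by (cases s) auto

lemma nth_walk: "i \<le> length s \<Longrightarrow> walk p s ! i = p + pos s i"
proof (induction s arbitrary: p i)
  case (Cons d s)
  then show ?case by (cases i) (auto simp: pos_def add.assoc)
qed (simp add: pos_def)

lemma last_walk: "last (walk p s) = p + sum_list s"
  by (induction s arbitrary: p) (auto simp: add.assoc)

lemma walk_append: "walk p (s @ t) = walk p s @ tl (walk (p + sum_list s) t)"
proof (induction s arbitrary: p)
  case Nil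
  then show ?case by (cases t) auto
qed (auto simp: add.assoc)

lemma take_walk: "take (Suc i) (walk p s) = walk p (take i s)"
proof (induction s arbitrary: p i)
  case (Cons d s) then show ?case by (cases i) auto
qed simp

lemma drop_walk: "i \<le> length s \<Longrightarrow> drop i (walk p s) = walk (p + pos s i) (drop i s)"
proof (induction s arbitrary: p i)
  case (Cons d s) then show ?case by (cases i) (auto simp: pos_def add.assoc)
qed (simp add: pos_def)

lemma walk_shift: "walk (p + q) s = map ((+) p) (walk q s)"
  by (induction s arbitrary: q) (simp_all add: add.assoc)

lemma walk_inj: "walk p s = walk p t \<longleftrightarrow> s = t"
proof (induction s arbitrary: p t)
  case Nil then show ?case by (cases t) auto
next
  case (Cons d s)
  show ?case
  proof (cases t)
    case (Cons e t')
    show ?thesis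
    proof
      assume "walk p (d # s) = walk p t"
      then have w: "walk (p + d) s = walk (p + e) t'" using Cons by simp
      then have "p + d = p + e" using hd_walk by metis
      then show "d # s = t" using w Cons.IH Cons by simp
    qed auto
  qed auto
qed

lemma successively_walk: "successively lattice_adj (walk p s) \<longleftrightarrow> set s \<subseteq> dirs"
proof (induction s arbitrary: p)
  case (Cons d s)
  have "successively lattice_adj (walk p (d # s)) \<longleftrightarrow>
      lattice_adj p (hd (walk (p + d) s)) \<and> successively lattice_adj (walk (p + d) s)"
    by (cases "walk (p + d) s") auto
  then show ?case using Cons.IH by (simp add: lattice_adj_iff)
qed simp

lemma walk_exists: "w \<noteq> [] \<Longrightarrow> \<exists>s. w = walk (hd w) s"
proof (induction w)
  case (Cons p w)
  show ?case
  proof (cases w)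
    case Nil then show ?thesis by (intro exI[of _ "[]"]) simp
  next
    case (Cons q w')
    then obtain s where "w = walk q s" using Cons.IH by auto
    then show ?thesis by (intro exI[of _ "(q - p) # s"]) simp
  qed
qed simp

lemma saw_walk: "self_avoiding_walk lattice_adj (walk p s) \<longleftrightarrow> saw_steps s"
proof -
  have "walk p s = map ((+) p) (walk 0 s)" using walk_shift[of p 0 s] by simp
  then have "distinct (walk p s) \<longleftrightarrow> distinct (walk 0 s)"
    by (simp add: distinct_map)
  then show ?thesis by (simp add: self_avoiding_walk_def saw_steps_def successively_walk)
qed

lemma saw_steps_iff:
  "saw_steps s \<longleftrightarrow> set s \<subseteq> dirs \<and> (\<forall>i j. i < j \<longrightarrow> j \<le> length s \<longrightarrow> pos s i \<noteq> pos s j)"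
proof -
  have "distinct (walk 0 s) \<longleftrightarrow> (\<forall>i j. i < j \<longrightarrow> j \<le> length s \<longrightarrow> pos s i \<noteq> pos s j)"
    unfolding distinct_conv_nth by (auto simp: less_Suc_eq_le nth_walk) (metis linorder_neqE_nat)
  then show ?thesis by (simp add: saw_steps_def)
qed

lemma pos_append: "pos (s @ t) i = (if i \<le> length s then pos s i else sum_list s + pos t (i - length s))"
  by (simp add: pos_def)

lemma pos_0 [simp]: "pos s 0 = 0" and pos_length [simp]: "pos s (length s) = sum_list s"
  by (simp_all add: pos_def)

lemma ht_Nil [simp]: "ht [] = 0" and ht_append: "ht (s @ t) = ht s + ht t"
  by (simp_all add: ht_def)

lemma ht_take: "ht (take i s) = snd (pos s i)"
  by (simp add: ht_def pos_def)

lemma saw_steps_appendD: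
  assumes "saw_steps (s @ t)"
  shows "saw_steps s" "saw_steps t"
proof -
  have a: "i < j \<Longrightarrow> j \<le> length s + length t \<Longrightarrow> pos (s @ t) i \<noteq> pos (s @ t) j" for i j
    using assms by (auto simp: saw_steps_iff)
  have "pos s i \<noteq> pos s j" if "i < j" "j \<le> length s" for i j
    using a[of i j] that by (simp add: pos_append)
  then show "saw_steps s" using assms by (auto simp: saw_steps_iff)
  have "pos t i \<noteq> pos t j" if "i < j" "j \<le> length t" for i j
  proof -
    have *: "pos (s @ t) (length s + k) = sum_list s + pos t k" for k
      by (simp add: pos_def)
    show ?thesis using a[of "length s + i" "length s + j"] that by (simp add: *)
  qed
  then show "saw_steps t" using assms by (auto simp: saw_steps_iff)
qed

lemma saw_steps_Nil [simp]: "saw_steps []"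
  by (simp add: saw_steps_iff)

lemma saw_steps_image:
  assumes s: "saw_steps s" and f: "\<And>x y. f (x + y) = f x + f y" "f 0 = (0 :: point)" "inj f" "f ` dirs \<subseteq> dirs"
  shows "saw_steps (map f s)"
proof -
  have "pos (map f s) i = f (pos s i)" for i
  proof -
    have "sum_list (map f t) = f (sum_list t)" for t by (induction t) (auto simp: f)
    then show ?thesis by (simp add: pos_def take_map)
  qed
  then show ?thesis using s f(4) by (auto simp: saw_steps_iff inj_eq[OF f(3)])
qed

definition flip :: "point \<Rightarrow> point" where "flip d = (fst d, - snd d)"
definition mirror :: "point \<Rightarrow> point" where "mirror d = (- fst d, snd d)"

lemma flip_flip [simp]: "flip (flip d) = d" and mirror_mirror [simp]: "mirror (mirror d) = d"
  by (simp_all add: flip_def mirror_def)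

lemma saw_steps_flip: "saw_steps s \<Longrightarrow> saw_steps (map flip s)"
  by (rule saw_steps_image) (auto simp: flip_def dirs_def inj_def prod_eq_iff)

lemma saw_steps_mirror: "saw_steps s \<Longrightarrow> saw_steps (map mirror s)"
  by (rule saw_steps_image) (auto simp: mirror_def dirs_def inj_def prod_eq_iff)

lemma sum_list_flip: "sum_list (map flip s) = flip (sum_list s)"
  by (induction s) (auto simp: flip_def prod_eq_iff)

lemma sum_list_mirror: "sum_list (map mirror s) = mirror (sum_list s)"
  by (induction s) (auto simp: mirror_def prod_eq_iff)

lemma abs_sum_dirs: "set s \<subseteq> dirs \<Longrightarrow> \<bar>fst (sum_list s)\<bar> \<le> int (length s) \<and> \<bar>snd (sum_list s)\<bar> \<le> int (length s)"
  by (induction s) (auto simp: dirs_def)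

lemma num_saws_eq: "num_saws n = card {s. saw_steps s \<and> length s = n}"
proof -
  have "{w. self_avoiding_walk lattice_adj w \<and> walk_length w = n \<and> hd w = (0, 0)}
      = walk 0 ` {s. saw_steps s \<and> length s = n}" (is "?L = ?R")
  proof (intro equalityI subsetI)
    fix w assume w: "w \<in> ?L"
    then have "w \<noteq> []" by (simp add: self_avoiding_walk_def)
    then obtain s where s: "w = walk (hd w) s" using walk_exists by blast
    moreover have "hd w = 0" using w by (simp add: zero_prod_def)
    ultimately have "w = walk 0 s" by simp
    then show "w \<in> ?R" using w by (auto simp: saw_walk walk_length_def)
  next
    fix w assume "w \<in> ?R"
    then show "w \<in> ?L" by (auto simp: saw_walk walk_length_def) (simp add: zero_prod_def)
  qed
  moreover have "inj_on (walk 0) A" for A by (auto simp: inj_on_def walk_inj)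
  ultimately show ?thesis by (simp add: num_saws_def card_image)
qed

lemma finite_steps_le: "finite {s. set s \<subseteq> dirs \<and> length s \<le> n}"
  by (rule finite_lists_length_le) simp

lemma finite_saw_steps: "finite {s. saw_steps s \<and> length s \<le> n}" "finite {s. saw_steps s \<and> length s = n}"
  by (rule finite_subset[OF _ finite_steps_le[of n]], auto simp: saw_steps_def)+

lemma num_saws_submult: "num_saws (m + n) \<le> num_saws m * num_saws n"
proof -
  have "card {s. saw_steps s \<and> length s = m + n}
      \<le> card ({s. saw_steps s \<and> length s = m} \<times> {s. saw_steps s \<and> length s = n})"
  proof (rule card_inj_on_le[where f = "\<lambda>s. (take m s, drop m s)"])
    show "inj_on (\<lambda>s. (take m s, drop m s)) {s. saw_steps s \<and> length s = m + n}"
      by (rule inj_onI) (metis append_take_drop_id prod.inject)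
    show "(\<lambda>s. (take m s, drop m s)) ` {s. saw_steps s \<and> length s = m + n}
        \<subseteq> {s. saw_steps s \<and> length s = m} \<times> {s. saw_steps s \<and> length s = n}"
    proof
      fix x assume "x \<in> (\<lambda>s. (take m s, drop m s)) ` {s. saw_steps s \<and> length s = m + n}"
      then obtain s where s: "saw_steps s" "length s = m + n" "x = (take m s, drop m s)" by blast
      then show "x \<in> {s. saw_steps s \<and> length s = m} \<times> {s. saw_steps s \<and> length s = n}"
        using saw_steps_appendD[of "take m s" "drop m s"] by simp
    qed
  qed (simp add: finite_saw_steps)
  then show ?thesis by (simp add: num_saws_eq card_cartesian_product)
qed

lemma saw_steps_straight: "saw_steps (replicate n (0, 1))"
proof -
  have "pos (replicate n (0, 1)) i = (0, int i)" if "i \<le> n" for i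
  proof -
    have "sum_list (replicate k (0, 1)) = (0 :: int, int k)" for k
      by (induction k) (auto simp: zero_prod_def)
    then show ?thesis using that by (simp add: pos_def min_def)
  qed
  then show ?thesis by (auto simp: saw_steps_iff dirs_def)
qed

lemma num_saws_pos: "num_saws n \<ge> 1"
proof -
  have "replicate n (0, 1) \<in> {s. saw_steps s \<and> length s = n}" using saw_steps_straight by simp
  then have "card {s. saw_steps s \<and> length s = n} > 0"
    using finite_saw_steps(2) by (metis card_gt_0_iff empty_iff)
  then show ?thesis by (simp add: num_saws_eq)
qed


section \<open>The connective constant\<close>

text \<open>Fekete's subadditive lemma, with the limit identified as the infimum; the lower bound on
  every term is what later gives the number of walks at least the power of the connective
  constant.\<close>

lemma fekete:
  fixes a :: "nat \<Rightarrow> real"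
  assumes sub: "\<And>m n. a (m + n) \<le> a m + a n" and nn: "\<And>n. 0 \<le> a n"
  obtains L where "(\<lambda>n. a n / n) \<longlonglongrightarrow> L" "\<And>n. n \<ge> 1 \<Longrightarrow> L \<le> a n / n"
proof -
  define L where "L = (INF n\<in>{1..}. a n / real n)"
  have bdd: "bdd_below ((\<lambda>n. a n / real n) ` {1..})"
    using nn by (auto intro!: bdd_belowI[where m = 0])
  have L_le: "L \<le> a n / n" if "n \<ge> 1" for n
    unfolding L_def using that by (intro cINF_lower bdd) auto
  \<comment> \<open>Division with remainder by a nearly optimal \<open>m\<close>; the remainder
    contributes a bounded amount \<open>C\<close>, negligible after division by
    \<open>n\<close>.\<close>
  have mult: "a (q * m + r) \<le> real q * a m + a r" for q m r
  proof (induction q)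
    case (Suc q)
    have "a (Suc q * m + r) = a (m + (q * m + r))" by (simp add: ac_simps)
    also have "\<dots> \<le> a m + a (q * m + r)" by (rule sub)
    finally show ?case using Suc by (simp add: algebra_simps)
  qed simp
  have "(\<lambda>n. a n / n) \<longlonglongrightarrow> L"
  proof (rule LIMSEQ_I)
    fix e :: real assume e: "e > 0"
    have "L < L + e / 2" using e by simp
    then obtain m where m: "m \<ge> 1" "a m / real m < L + e / 2"
      unfolding L_def using cINF_less_iff[OF _ bdd] by (metis atLeast_iff empty_iff order_refl)
    define C where "C = (\<Sum>r<m. a r)"
    have C: "a r \<le> C" if "r < m" for r
      unfolding C_def using that nn by (intro member_le_sum) auto
    obtain N :: nat where N: "real N > 2 * C / e" using reals_Archimedean2 by blast
    show "\<exists>no. \<forall>n\<ge>no. norm (a n / real n - L) < e"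
    proof (intro exI allI impI)
      fix n assume n: "n \<ge> max 1 N"
      have n0: "real n > 0" using n by simp
      have "a n \<le> real (n div m) * a m + a (n mod m)"
        using mult[of "n div m" m "n mod m"] by simp
      also have "\<dots> \<le> real n / real m * a m + C"
      proof (intro add_mono mult_right_mono)
        have "real (n div m) * real m \<le> real n"
          by (metis div_times_less_eq_dividend of_nat_le_iff of_nat_mult)
        then show "real (n div m) \<le> real n / real m" using m by (simp add: field_simps)
      qed (use m C[of "n mod m"] nn[of m] in auto)
      finally have "a n / n \<le> (real n / real m * a m + C) / n"
        using n0 by (intro divide_right_mono) auto
      also have "\<dots> = a m / m + C / n" using n0 by (simp add: field_simps)
      also have "C / n < e / 2"
      proof -
        have "2 * C / e < n" using N n by simp
        then show ?thesis using e n0 by (simp add: field_simps)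
      qed
      finally have "a n / n < L + e" using m by simp
      moreover have "L \<le> a n / n" using L_le n by simp
      ultimately show "norm (a n / real n - L) < e" by simp
    qed
  qed
  then show ?thesis using L_le that by blast
qed

lemma connective_constant:
  shows num_saws_root_tendsto: "(\<lambda>n. root n (real (num_saws n))) \<longlonglongrightarrow> connective_constant"
    and num_saws_ge: "real (num_saws n) \<ge> connective_constant ^ n"
    and connective_constant_ge_1: "connective_constant \<ge> 1"
proof -
  define a where "a n = ln (real (num_saws n))" for n
  have c: "real (num_saws n) \<ge> 1" for n using num_saws_pos[of n] by simp
  have ex: "real (num_saws n) = exp (a n)" for n using c[of n] by (simp add: a_def)
  have "a (m + n) \<le> a m + a n" for m n
  proof -
    have "real (num_saws (m + n)) \<le> real (num_saws m) * real (num_saws n)"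
      using num_saws_submult[of m n] by (metis of_nat_le_iff of_nat_mult)
    then have "exp (a (m + n)) \<le> exp (a m + a n)" by (simp add: ex[symmetric] exp_add)
    then show ?thesis by simp
  qed
  moreover have "0 \<le> a n" for n using c[of n] by (simp add: a_def)
  ultimately obtain L where L: "(\<lambda>n. a n / n) \<longlonglongrightarrow> L" "\<And>n. n \<ge> 1 \<Longrightarrow> L \<le> a n / n"
    using fekete by blast
  have rt: "root n (real (num_saws n)) = exp (a n / n)" if "n \<ge> 1" for n
  proof (rule real_root_pos_unique)
    show "exp (a n / real n) ^ n = real (num_saws n)"
      using that by (simp add: exp_of_nat_mult[symmetric] ex)
  qed (use that in auto)
  have lim: "(\<lambda>n. root n (real (num_saws n))) \<longlonglongrightarrow> exp L"
  proof (rule Lim_transform_eventually)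
    show "(\<lambda>n. exp (a n / n)) \<longlonglongrightarrow> exp L" by (intro tendsto_exp L)
    show "\<forall>\<^sub>F n in sequentially. exp (a n / n) = root n (real (num_saws n))"
      using eventually_ge_at_top[of 1] by eventually_elim (simp add: rt)
  qed
  then have mu: "connective_constant = exp L"
    unfolding connective_constant_def by (rule limI)
  show "(\<lambda>n. root n (real (num_saws n))) \<longlonglongrightarrow> connective_constant" using lim mu by simp
  show "real (num_saws n) \<ge> connective_constant ^ n"
  proof (cases "n = 0")
    case True then show ?thesis using c[of 0] by simp
  next
    case False
    then have "n * L \<le> a n" using L(2)[of n] by (simp add: field_simps)
    then show ?thesis unfolding mu ex by (simp add: exp_of_nat_mult[symmetric])
  qed
  have "0 \<le> L"
    using c by (intro LIMSEQ_le_const[OF L(1)]) (auto simp: a_def)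
  then show "connective_constant \<ge> 1" unfolding mu by simp
qed

lemma num_saws_summable:
  assumes "0 \<le> z" "z < inverse connective_constant"
  shows "summable (\<lambda>n. real (num_saws n) * z ^ n)"
proof -
  let ?\<mu> = connective_constant
  have mu: "?\<mu> > 0" using connective_constant_ge_1 by simp
  obtain q where q: "z < q" "q < inverse ?\<mu>" using assms dense by blast
  have q0: "q > 0" using assms q by simp
  have lt: "?\<mu> < inverse q" using q mu q0 by (simp add: field_simps)
  have "\<forall>\<^sub>F n in sequentially. root n (real (num_saws n)) < inverse q"
    using order_tendstoD(2)[OF num_saws_root_tendsto lt] .
  then have ev: "\<forall>\<^sub>F n in sequentially. norm (real (num_saws n) * z ^ n) \<le> (z / q) ^ n"
    using eventually_ge_at_top[of 1]
  proof eventually_elim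
    case (elim n)
    have "real (num_saws n) = root n (real (num_saws n)) ^ n" using elim by simp
    also have "\<dots> \<le> (inverse q) ^ n" using elim by (intro power_mono) auto
    finally have "real (num_saws n) * z ^ n \<le> (inverse q) ^ n * z ^ n"
      using assms by (intro mult_right_mono) auto
    then show ?case using assms by (simp add: power_divide field_simps power_inverse)
  qed
  have "summable (\<lambda>n. (z / q) ^ n)" using q assms q0 by (intro summable_geometric) auto
  then show ?thesis by (rule summable_comparison_test_ev[OF ev])
qed


section \<open>Bridges and the Hammersley-Welsh bound\<close>

definition bridge :: "point list \<Rightarrow> bool" where
  "bridge s \<longleftrightarrow> saw_steps s \<and> s \<noteq> [] \<and>
     (\<forall>i\<in>{1..length s}. 0 < ht (take i s) \<and> ht (take i s) \<le> ht s)"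

text \<open>Half-plane walks: strictly above the start after time 0. Started at \<open>ast\<close>
  they are exactly the vertices of the self-avoiding tree, see \<open>saw_tree_eq\<close>.\<close>

definition half :: "point list \<Rightarrow> bool" where
  "half s \<longleftrightarrow> saw_steps s \<and> (\<forall>i\<in>{1..length s}. 0 < ht (take i s))"

definition irr :: "point list \<Rightarrow> bool" where
  "irr s \<longleftrightarrow> bridge s \<and> \<not> (\<exists>i\<in>{1..<length s}. bridge (take i s) \<and> bridge (drop i s))"

definition gf :: "real \<Rightarrow> point list set \<Rightarrow> real" where
  "gf z A = (\<Sum>s\<in>A. z ^ length s)"

abbreviation "bridges_le N \<equiv> {s. bridge s \<and> length s \<le> N}"
abbreviation "irr_le N \<equiv> {s. irr s \<and> length s \<le> N}"

lemma bridge_saw: "bridge s \<Longrightarrow> saw_steps s" and half_saw: "half s \<Longrightarrow> saw_steps s"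
  and irr_bridge: "irr s \<Longrightarrow> bridge s"
  by (simp_all add: bridge_def half_def irr_def)

lemma bridge_ne: "bridge s \<Longrightarrow> s \<noteq> []"
  by (simp add: bridge_def)

lemma finite_bridges [simp]: "finite (bridges_le N)" "finite (irr_le N)"
  "finite {s. half s \<and> length s \<le> N}" "finite {s. bridge s \<and> length s = N}"
  by (rule finite_subset[OF _ finite_saw_steps(1)[of N]], auto dest: bridge_saw half_saw irr_bridge)+

lemma gf_nonneg: "0 \<le> z \<Longrightarrow> 0 \<le> gf z A"
  by (simp add: gf_def sum_nonneg)

lemma gf_mono: "0 \<le> z \<Longrightarrow> A \<subseteq> B \<Longrightarrow> finite B \<Longrightarrow> gf z A \<le> gf z B"
  unfolding gf_def by (intro sum_mono2) auto

lemma gf_mono_z: "0 \<le> z \<Longrightarrow> z \<le> z' \<Longrightarrow> gf z A \<le> gf z' A"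
  unfolding gf_def by (intro sum_mono power_mono) auto

lemma gf_product:
  "(\<Sum>(s, t)\<in>A \<times> B. z ^ (length s + length t)) = gf z A * gf z B"
  unfolding gf_def by (simp add: sum_product sum.cartesian_product power_add)

text \<open>An upper bound needs only a covering by concatenations, so injectivity is never checked
  here.\<close>

lemma gf_image_le:
  assumes "0 \<le> z" "finite A" "finite B" "C \<subseteq> f ` (A \<times> B)"
    and len: "\<And>s t. s \<in> A \<Longrightarrow> t \<in> B \<Longrightarrow> length (f (s, t)) = length s + length t"
  shows "gf z C \<le> gf z A * gf z B"
proof -
  have "gf z C \<le> gf z (f ` (A \<times> B))" using assms by (intro gf_mono) auto
  also have "\<dots> \<le> (\<Sum>x\<in>A \<times> B. z ^ length (f x))"
    unfolding gf_def using assms by (intro order_trans[OF sum_image_le]) (auto simp: o_def)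
  also have "\<dots> = (\<Sum>(s, t)\<in>A \<times> B. z ^ (length s + length t))"
    using len by (intro sum.cong) auto
  finally show ?thesis by (simp add: gf_product)
qed

lemma saw_steps_take: "saw_steps s \<Longrightarrow> saw_steps (take i s)"
  using saw_steps_appendD(1)[of "take i s" "drop i s"] by simp

lemma saw_steps_drop: "saw_steps s \<Longrightarrow> saw_steps (drop i s)"
  using saw_steps_appendD(2)[of "take i s" "drop i s"] by simp

lemma ht_flip: "ht (map flip s) = - ht s"
  by (simp add: ht_def sum_list_flip flip_def)

lemma ht_drop_take: "m \<le> length s \<Longrightarrow> ht (take i (drop m s)) = ht (take (m + i) s) - ht (take m s)"
  by (simp add: take_add ht_append)

lemma abs_ht_le: "set s \<subseteq> dirs \<Longrightarrow> \<bar>ht s\<bar> \<le> int (length s)"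
  using abs_sum_dirs by (simp add: ht_def)

abbreviation "half_below N A \<equiv> {s. half s \<and> length s \<le> N \<and> (\<forall>i\<le>length s. ht (take i s) \<le> int A)}"
abbreviation "bridge_height N A \<equiv> {s. bridge s \<and> length s \<le> N \<and> ht s = int A}"

lemma finite_half_below [simp]: "finite (half_below N A)" "finite (bridge_height N A)"
  by (rule finite_subset[OF _ finite_bridges(3)[of N]], force)
     (rule finite_subset[OF _ finite_bridges(1)[of N]], force)

text \<open>One Hammersley-Welsh unfolding step: cut at the last visit to the maximal height. The
  first piece is a bridge; the rest, reflected, is a half-plane walk of smaller height.\<close>

lemma half_below_split:
  assumes s: "s \<in> half_below N (Suc A)" "s \<notin> half_below N A"
  shows "s \<in> (\<lambda>(b, t). b @ map flip t) ` (bridge_height N (Suc A) \<times> half_below N A)"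
proof -
  let ?P = "\<lambda>i. i \<le> length s \<and> ht (take i s) = int (Suc A)"
  have "\<exists>i. ?P i"
  proof -
    obtain i where "i \<le> length s" "\<not> ht (take i s) \<le> int A" using s by auto
    moreover then have "ht (take i s) \<le> int (Suc A)" using s by auto
    ultimately have "?P i" by auto
    then show ?thesis by blast
  qed
  moreover have bnd: "\<forall>i. ?P i \<longrightarrow> i \<le> length s" by blast
  ultimately have P: "?P (Greatest ?P)" using GreatestI_ex_nat[of ?P "length s"] by blast
  define m where "m = Greatest ?P"
  have m: "m \<le> length s" "ht (take m s) = int (Suc A)" using P by (auto simp: m_def)
  have after: "ht (take i s) \<le> int A" if "m < i" "i \<le> length s" for i
  proof -
    have "\<not> ?P i" using Greatest_le_nat[of ?P i] bnd that(1) by (auto simp: m_def)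
    moreover have "ht (take i s) \<le> int (Suc A)" using s(1) that by auto
    ultimately show ?thesis using that by auto
  qed
  have "m \<noteq> 0" using m by (intro notI) simp
  have "take m s \<in> bridge_height N (Suc A)"
    using s(1) m \<open>m \<noteq> 0\<close>
    by (auto simp: bridge_def half_def saw_steps_take min_def)
  moreover have "map flip (drop m s) \<in> half_below N A"
  proof -
    have h: "ht (take i (map flip (drop m s))) = int (Suc A) - ht (take (m + i) s)" for i
      using m by (simp add: take_map ht_flip ht_drop_take)
    have "0 < ht (take (m + i) s)" if "i \<le> length s - m" for i
      using s(1) m that \<open>m \<noteq> 0\<close> by (auto simp: half_def)
    \<comment> \<open>The reflected height is at most \<open>A\<close> rather than
      \<open>Suc A\<close> because a half-plane walk never returns to height 0.\<close>
    then have "int (Suc A) - ht (take (m + i) s) \<le> int A" if "i \<le> length s - m" for i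
      using that by force
    moreover have "0 < int (Suc A) - ht (take (m + i) s)" if "1 \<le> i" "i \<le> length s - m" for i
    proof -
      have "m < m + i" "m + i \<le> length s" using that m(1) by linarith+
      then show ?thesis using after[of "m + i"] by simp
    qed
    ultimately show ?thesis
      using s(1) m saw_steps_flip[OF saw_steps_drop, of s m]
      by (auto simp: half_def h simp del: of_nat_Suc)
  qed
  moreover have "s = (\<lambda>(b, t). b @ map flip t) (take m s, map flip (drop m s))"
    by (simp add: o_def)
  ultimately show ?thesis by blast
qed

lemma half_below_step:
  assumes "0 \<le> z"
  shows "gf z (half_below N (Suc A)) \<le> gf z (half_below N A) * (1 + gf z (bridge_height N (Suc A)))"
proof -
  let ?D = "half_below N (Suc A) - half_below N A"
  have "gf z ?D \<le> gf z (bridge_height N (Suc A)) * gf z (half_below N A)"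
    using half_below_split
    by (intro gf_image_le[OF assms, where f = "\<lambda>(b, t). b @ map flip t"] finite_half_below) auto
  moreover have "gf z (half_below N (Suc A)) \<le> gf z (half_below N A \<union> ?D)"
  proof (rule gf_mono[OF assms])
    show "finite (half_below N A \<union> ?D)" by (intro finite_UnI finite_Diff finite_half_below)
  qed blast
  moreover have "gf z (half_below N A \<union> ?D) = gf z (half_below N A) + gf z ?D"
    unfolding gf_def by (intro sum.union_disjoint finite_Diff finite_half_below) blast
  ultimately show ?thesis by (simp add: algebra_simps)
qed

lemma half_below_0: "half_below N 0 = {[]}"
proof -
  have "s = []" if "half s" "\<forall>i\<le>length s. ht (take i s) \<le> 0" for s
  proof (rule ccontr)
    assume "s \<noteq> []"
    then have "length s \<in> {1..length s}" by (cases s) auto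
    then have "0 < ht (take (length s) s)" using that(1) unfolding half_def by blast
    then show False using that(2) by (metis linorder_not_less order_refl)
  qed
  then show ?thesis by (auto simp: half_def)
qed

text \<open>The unfolded bridges have strictly decreasing heights, so each height contributes at
  most one factor \<open>1 + x\<close>, and the product over heights is bounded by an
  exponential.\<close>

lemma half_bound:
  assumes "0 \<le> z"
  shows "gf z {s. half s \<and> length s \<le> N} \<le> exp (gf z (bridges_le N))"
proof -
  have step: "gf z (half_below N A) \<le> exp (\<Sum>a=1..A. gf z (bridge_height N a))" for A
  proof (induction A)
    case 0
    show ?case unfolding half_below_0 by (simp add: gf_def)
  next
    case (Suc A)
    have "gf z (half_below N (Suc A)) \<le> gf z (half_below N A) * (1 + gf z (bridge_height N (Suc A)))"
      by (rule half_below_step[OF assms])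
    also have "\<dots> \<le> exp (\<Sum>a=1..A. gf z (bridge_height N a)) * exp (gf z (bridge_height N (Suc A)))"
      using Suc gf_nonneg[OF assms] exp_ge_add_one_self by (intro mult_mono) auto
    finally show ?case by (simp add: exp_add)
  qed
  have "{s. half s \<and> length s \<le> N} = half_below N N"
  proof -
    have "ht (take i s) \<le> int N" if "half s" "length s \<le> N" for s i
    proof -
      have "set (take i s) \<subseteq> dirs" using that(1) set_take_subset by (fastforce simp: half_def saw_steps_def)
      then show ?thesis using abs_ht_le[of "take i s"] that(2) by simp
    qed
    then show ?thesis by auto
  qed
  then have "gf z {s. half s \<and> length s \<le> N} \<le> exp (\<Sum>a=1..N. gf z (bridge_height N a))"
    using step[of N] by simp
  also have "(\<Sum>a=1..N. gf z (bridge_height N a)) = gf z (\<Union>a\<in>{1..N}. bridge_height N a)"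
    unfolding gf_def by (rule sum.UNION_disjoint[symmetric]) auto
  also have "\<dots> \<le> gf z (bridges_le N)"
    using assms by (intro gf_mono) auto
  finally show ?thesis by simp
qed

lemma sum_list_uminus: "sum_list (map uminus t) = - sum_list (t :: point list)"
  by (induction t) auto

lemma saw_steps_rev: "saw_steps s \<Longrightarrow> saw_steps (rev (map uminus s))"
proof -
  assume s: "saw_steps s"
  have p: "pos (rev (map uminus s)) i = pos s (length s - i) - sum_list s" if "i \<le> length s" for i
  proof -
    have "take i (rev (map uminus s)) = rev (map uminus (drop (length s - i) s))"
      by (simp add: take_rev drop_map)
    then have "pos (rev (map uminus s)) i = - sum_list (drop (length s - i) s)"
      by (simp add: pos_def sum_list_uminus)
    moreover have "sum_list s = pos s (length s - i) + sum_list (drop (length s - i) s)"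
      unfolding pos_def by (metis append_take_drop_id sum_list_append)
    ultimately show ?thesis by simp
  qed
  have "pos s (length s - i) \<noteq> pos s (length s - j)" if "i < j" "j \<le> length s" for i j
    using s that unfolding saw_steps_iff by (metis diff_le_self diff_less_mono2 order_less_le_trans)
  moreover have "uminus ` dirs \<subseteq> dirs" by (auto simp: dirs_def)
  then have "set (rev (map uminus s)) \<subseteq> dirs"
    using s unfolding saw_steps_iff set_rev set_map by blast
  ultimately show ?thesis by (simp add: saw_steps_iff p)
qed

lemma ht_rev: "ht (take i (rev (map uminus s))) = ht (take (length s - i) s) - ht s"
proof -
  have "take i (rev (map uminus s)) = rev (map uminus (drop (length s - i) s))"
    by (simp add: take_rev drop_map)
  then have "ht (take i (rev (map uminus s))) = - ht (drop (length s - i) s)"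
    by (simp add: ht_def sum_list_uminus)
  moreover have "ht s = ht (take (length s - i) s) + ht (drop (length s - i) s)"
    by (metis append_take_drop_id ht_append)
  ultimately show ?thesis by simp
qed

text \<open>Cut at the last visit to the minimal height: what follows is a half-plane walk, and what
  precedes becomes one after reversal and one extra step.\<close>

lemma saw_split_half:
  assumes "saw_steps s" "length s \<le> N"
  shows "s \<in> (\<lambda>(t, u). rev (map uminus (tl t)) @ u) `
     ({t. half t \<and> length t \<le> Suc N \<and> t \<noteq> []} \<times> {u. half u \<and> length u \<le> Suc N})"
proof -
  define h where "h = Min ((\<lambda>i. ht (take i s)) ` {..length s})"
  have h_le: "h \<le> ht (take i s)" if "i \<le> length s" for i
    unfolding h_def using that by (intro Min_le) auto
  let ?P = "\<lambda>i. i \<le> length s \<and> ht (take i s) = h"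
  have "h \<in> (\<lambda>i. ht (take i s)) ` {..length s}"
    unfolding h_def by (intro Min_in) auto
  then have "\<exists>i. ?P i" by auto
  moreover have bnd: "\<forall>i. ?P i \<longrightarrow> i \<le> length s" by blast
  ultimately have P: "?P (Greatest ?P)" using GreatestI_ex_nat[of ?P "length s"] by blast
  define m where "m = Greatest ?P"
  have m: "m \<le> length s" "ht (take m s) = h" using P by (auto simp: m_def)
  have after: "h < ht (take i s)" if "m < i" "i \<le> length s" for i
  proof -
    have "\<not> ?P i" using Greatest_le_nat[of ?P i] bnd that(1) by (auto simp: m_def)
    then show ?thesis using h_le[of i] that by auto
  qed
  define r where "r = rev (map uminus (take m s))"
  have lr: "length r = m" using m by (simp add: r_def)
  have hr: "ht (take i r) = ht (take (m - i) s) - h" for i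
    using m ht_rev[of i "take m s"] by (simp add: r_def)
  \<comment> \<open>The reversed piece may revisit its starting height, so an upward step is put in
    front to make the inequality strict; \<open>tl\<close> in the statement removes it
    again.\<close>
  have "half ((0, 1) # r)"
    unfolding half_def
  proof (intro conjI ballI)
    have hge: "0 \<le> ht (take i r)" for i using hr[of i] h_le[of "m - i"] m by simp
    have ht1: "ht ((0, 1) # t) = 1 + ht t" for t by (simp add: ht_def)
    show "0 < ht (take i ((0, 1) # r))" if "i \<in> {1..length ((0, 1) # r)}" for i
      using that hge[of "i - 1"] by (cases i) (auto simp: ht1)
    have sr: "saw_steps r" unfolding r_def using assms by (intro saw_steps_rev saw_steps_take)
    have pc: "pos ((0, 1) # r) (Suc i) = (0, 1) + pos r i" for i by (simp add: pos_def)
    show "saw_steps ((0, 1) # r)"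
      unfolding saw_steps_iff
    proof (intro conjI allI impI)
      show "set ((0, 1) # r) \<subseteq> dirs" using sr by (auto simp: saw_steps_iff dirs_def)
      fix i j assume ij: "i < j" "j \<le> length ((0, 1) # r)"
      then obtain j' where j': "j = Suc j'" "j' \<le> length r" by (cases j) auto
      show "pos ((0, 1) # r) i \<noteq> pos ((0, 1) # r) j"
      proof (cases i)
        case 0
        have "snd (pos r j') \<ge> 0" using hge[of j'] by (simp add: ht_take)
        then have "snd (pos ((0, 1) # r) j) > 0" by (simp add: j' pc)
        then show ?thesis using 0 by auto
      next
        case (Suc i')
        then show ?thesis using sr ij j' by (auto simp: pc saw_steps_iff)
      qed
    qed
  qed
  moreover have "half (drop m s)"
    unfolding half_def using assms after m
    by (auto simp: saw_steps_drop ht_drop_take)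
  moreover have "s = (\<lambda>(t, u). rev (map uminus (tl t)) @ u) ((0, 1) # r, drop m s)"
    by (simp add: r_def rev_map o_def)
  ultimately show ?thesis
    using assms m lr by (intro image_eqI[of _ _ "((0, 1) # r, drop m s)"]) auto
qed

text \<open>The Hammersley-Welsh inequality for generating functions. The factor
  \<open>1 / z\<close> accounts for the extra upward step.\<close>

lemma saw_bound:
  assumes "0 < z"
  shows "gf z {s. saw_steps s \<and> length s \<le> N} \<le> exp (2 * gf z (bridges_le (Suc N))) / z"
proof -
  let ?H = "{u. half u \<and> length u \<le> Suc N}" and ?T = "{t. half t \<and> length t \<le> Suc N \<and> t \<noteq> []}"
  let ?f = "\<lambda>(t, u). rev (map uminus (tl t)) @ (u :: point list)"
  have fT: "finite ?T" by (rule finite_subset[OF _ finite_bridges(3)[of "Suc N"]]) auto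
  have "gf z {s. saw_steps s \<and> length s \<le> N} \<le> gf z (?f ` (?T \<times> ?H))"
    using assms saw_split_half fT by (intro gf_mono) auto
  also have "\<dots> \<le> (\<Sum>x\<in>?T \<times> ?H. z ^ length (?f x))"
    unfolding gf_def using assms fT by (intro order_trans[OF sum_image_le]) (auto simp: o_def)
  also have "\<dots> = (\<Sum>(t, u)\<in>?T \<times> ?H. z ^ (length t + length u) / z)"
  proof (intro sum.cong refl, clarify)
    fix t u :: "point list" assume "t \<noteq> []"
    then obtain a t' where "t = a # t'" by (cases t) auto
    then show "z ^ length (rev (map uminus (tl t)) @ u) = z ^ (length t + length u) / z"
      using assms by simp
  qed
  also have "\<dots> = gf z ?T * gf z ?H / z"
    by (simp add: gf_product[symmetric] sum_divide_distrib case_prod_unfold)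
  also have "\<dots> \<le> exp (gf z (bridges_le (Suc N))) * exp (gf z (bridges_le (Suc N))) / z"
  proof (intro divide_right_mono mult_mono)
    show "gf z ?H \<le> exp (gf z (bridges_le (Suc N)))" using half_bound[of z] assms by simp
    have "gf z ?T \<le> gf z ?H" using assms by (intro gf_mono) auto
    then show "gf z ?T \<le> exp (gf z (bridges_le (Suc N)))" using half_bound[of z "Suc N"] assms by simp
  qed (use assms in \<open>auto intro: gf_nonneg\<close>)
  finally show ?thesis by (simp add: exp_add[symmetric])
qed

lemma gf_saw: "gf z {s. saw_steps s \<and> length s \<le> N} = (\<Sum>n\<le>N. real (num_saws n) * z ^ n)"
proof -
  have "{s. saw_steps s \<and> length s \<le> N} = (\<Union>n\<in>{..N}. {s. saw_steps s \<and> length s = n})" by auto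
  then have "gf z {s. saw_steps s \<and> length s \<le> N} = (\<Sum>n\<le>N. gf z {s. saw_steps s \<and> length s = n})"
    unfolding gf_def by (simp only:) (rule sum.UNION_disjoint; auto simp: finite_saw_steps)
  also have "\<dots> = (\<Sum>n\<le>N. real (num_saws n) * z ^ n)"
    by (intro sum.cong refl) (simp add: gf_def num_saws_eq)
  finally show ?thesis .
qed

text \<open>Every term of the series of all walks is at least 1 here, so its partial sums diverge,
  and \<open>saw_bound\<close> passes the divergence on to bridges.\<close>

lemma bridges_unbounded:
  assumes "z \<ge> inverse connective_constant"
  shows "\<exists>N. gf z (bridges_le N) > C"
proof (rule ccontr)
  assume "\<not> ?thesis"
  then have C: "gf z (bridges_le N) \<le> C" for N by (auto simp: not_less)
  have mu: "connective_constant > 0" using connective_constant_ge_1 by simp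
  then have z: "z > 0" using assms by (meson inverse_positive_iff_positive less_le_trans)
  obtain N :: nat where N: "real N > exp (2 * C) / z" using reals_Archimedean2 by blast
  have "1 \<le> real (num_saws n) * z ^ n" for n
  proof -
    have "1 = connective_constant ^ n * inverse connective_constant ^ n"
      using mu by (simp add: power_mult_distrib[symmetric])
    also have "\<dots> \<le> real (num_saws n) * z ^ n"
      using mu assms num_saws_ge[of n] by (intro mult_mono power_mono) auto
    finally show ?thesis .
  qed
  then have "real (card {..N}) * 1 \<le> (\<Sum>n\<le>N. real (num_saws n) * z ^ n)"
    by (intro sum_bounded_below)
  also have "\<dots> \<le> exp (2 * gf z (bridges_le (Suc N))) / z"
    using saw_bound[OF z] gf_saw by metis
  also have "\<dots> \<le> exp (2 * C) / z" using C z by (intro divide_right_mono) auto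
  finally show False using N by simp
qed

lemma bridges_bounded:
  assumes "0 \<le> z" "z < inverse connective_constant"
  obtains C where "\<And>N. gf z (bridges_le N) \<le> C"
proof -
  have "gf z (bridges_le N) \<le> (\<Sum>n. real (num_saws n) * z ^ n)" for N
  proof -
    have "gf z (bridges_le N) \<le> gf z {s. saw_steps s \<and> length s \<le> N}"
      using assms by (intro gf_mono finite_saw_steps) (auto dest: bridge_saw)
    also have "\<dots> \<le> (\<Sum>n. real (num_saws n) * z ^ n)"
      unfolding gf_saw using assms by (intro sum_le_suminf num_saws_summable) auto
    finally show ?thesis .
  qed
  then show ?thesis using that by blast
qed

section \<open>Decomposition of bridges into irreducible bridges\<close>

lemma ht_take_bridge: "bridge s \<Longrightarrow> 1 \<le> i \<Longrightarrow> i \<le> length s \<Longrightarrow> 0 < ht (take i s) \<and> ht (take i s) \<le> ht s"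
  by (simp add: bridge_def)

lemma ht_bridge_pos: "bridge s \<Longrightarrow> 0 < ht s"
  using ht_take_bridge[of s "length s"] by (cases s) (auto simp: bridge_def)

lemma bridge_append:
  assumes b: "bridge b" and t: "bridge t"
  shows "bridge (b @ t)"
  unfolding bridge_def
proof (intro conjI ballI)
  have hb: "ht (take i b) \<le> ht b" if "i \<le> length b" for i
    using ht_take_bridge[OF b, of i] ht_bridge_pos[OF b] that by (cases i) auto
  show "saw_steps (b @ t)"
    unfolding saw_steps_iff
  proof (intro conjI allI impI)
    show "set (b @ t) \<subseteq> dirs" using b t by (auto simp: bridge_def saw_steps_iff)
    fix i j assume ij: "i < j" "j \<le> length (b @ t)"
    consider "j \<le> length b" | "i > length b" | "i \<le> length b" "length b < j" using ij by linarith
    then show "pos (b @ t) i \<noteq> pos (b @ t) j"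
    proof cases
      case 1
      then show ?thesis using b ij by (simp add: pos_append bridge_def saw_steps_iff)
    next
      case 2
      moreover have "pos t (i - length b) \<noteq> pos t (j - length b)"
        using t ij 2 unfolding bridge_def saw_steps_iff by auto
      ultimately show ?thesis using ij by (simp add: pos_append)
    next
      case 3
      then have "0 < ht (take (j - length b) t)" using ht_take_bridge[OF t, of "j - length b"] ij by auto
      then have "ht (take i (b @ t)) < ht (take j (b @ t))" using hb[of i] 3 by (simp add: ht_append)
      then show ?thesis unfolding ht_take by auto
    qed
  qed
  fix i assume i: "i \<in> {1..length (b @ t)}"
  have "0 < ht (take i (b @ t)) \<and> ht (take i (b @ t)) \<le> ht b + ht t"
  proof (cases "i \<le> length b")
    case True
    then show ?thesis using ht_take_bridge[OF b, of i] i ht_bridge_pos[OF t] by auto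
  next
    case False
    then have "1 \<le> i - length b" "i - length b \<le> length t" using i by auto
    then show ?thesis using ht_take_bridge[OF t, of "i - length b"] False ht_bridge_pos[OF b]
      by (simp add: ht_append)
  qed
  then show "0 < ht (take i (b @ t))" "ht (take i (b @ t)) \<le> ht (b @ t)" by (simp_all add: ht_append)
qed (use b in \<open>simp add: bridge_def\<close>)

lemma bridge_decompose:
  assumes "bridge s"
  shows "irr s \<or> (\<exists>b t. irr b \<and> bridge t \<and> s = b @ t)"
proof (cases "irr s")
  case False
  let ?P = "\<lambda>i. i \<in> {1..<length s} \<and> bridge (take i s) \<and> bridge (drop i s)"
  have ex: "\<exists>i. ?P i" using False assms by (auto simp: irr_def)
  \<comment> \<open>The first admissible cut: an earlier cut of the first piece would also cut the
    whole bridge, so the first piece is irreducible.\<close>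
  define i where "i = (LEAST i. ?P i)"
  have i: "?P i" unfolding i_def using LeastI_ex[OF ex] .
  have "irr (take i s)"
    unfolding irr_def
  proof (intro conjI notI)
    assume "\<exists>j\<in>{1..<length (take i s)}. bridge (take j (take i s)) \<and> bridge (drop j (take i s))"
    then obtain j where j: "1 \<le> j" "j < i" "bridge (take j s)" "bridge (drop j (take i s))"
      by auto
    have "drop j s = drop j (take i s) @ drop i s"
      using j i by (metis append_take_drop_id drop_append diff_is_0_eq drop0 length_take min.absorb2
            atLeastLessThan_iff less_imp_le)
    then have "bridge (drop j s)" using bridge_append j i by simp
    then have "?P j" using j i by auto
    then show False using not_less_Least[of j ?P] j(2) by (simp add: i_def)
  qed (use i in blast)
  then show ?thesis using i by (metis append_take_drop_id)
qed simp

text \<open>If one first factor were longer, its surplus \<open>u\<close> would be a bridge: the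
  lower bound comes from being an initial part of the bridge \<open>t\<close>, the upper one from
  being a final part of the bridge \<open>b'\<close>. This contradicts irreducibility of
  \<open>b'\<close>.\<close>

lemma irr_append_unique:
  assumes "irr b" "bridge t" "irr b'" "bridge t'" "b @ t = b' @ t'"
  shows "b = b' \<and> t = t'"
proof -
  have aux: "length b \<ge> length b'"
    if b: "irr b" and t: "bridge t" and b': "irr b'" and eq: "b @ t = b' @ t'"
    for b t b' t' :: "point list"
  proof (rule ccontr)
    assume "\<not> length b \<ge> length b'"
    then obtain u where u: "b' = b @ u" "t = u @ t'" "u \<noteq> []"
      using eq by (auto simp: append_eq_append_conv2)
    have "bridge u"
      unfolding bridge_def
    proof (intro conjI ballI)
      show "saw_steps u" using b' u saw_steps_appendD(2) by (metis irr_bridge bridge_saw)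
      fix i assume i: "i \<in> {1..length u}"
      show "0 < ht (take i u)" using ht_take_bridge[OF t, of i] i u by simp
      have "ht (take (length b + i) b') \<le> ht b'"
        using ht_take_bridge[OF irr_bridge[OF b'], of "length b + i"] i u by auto
      then show "ht (take i u) \<le> ht u" by (simp add: u ht_append)
    qed fact
    then have "length b \<in> {1..<length b'}" "bridge (take (length b) b')" "bridge (drop (length b) b')"
      using u b bridge_ne[OF irr_bridge[OF b]] by (auto simp: irr_bridge Suc_le_eq)
    then show False using b' unfolding irr_def by blast
  qed
  have "length b = length b'" using aux[OF assms(1-3,5)] aux[OF assms(3,4,1) assms(5)[symmetric]] by simp
  then show ?thesis using assms(5) by simp
qed

text \<open>One half of the renewal equation B = I + I * B in truncated form; the companion
  \<open>gf_bridges_ge\<close> uses that the decomposition is unique.\<close>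

lemma gf_bridges_le:
  assumes "0 \<le> z"
  shows "gf z (bridges_le N) \<le> gf z (irr_le N) + gf z (irr_le N) * gf z (bridges_le N)"
proof -
  let ?D = "bridges_le N - irr_le N"
  have "gf z ?D \<le> gf z (irr_le N) * gf z (bridges_le N)"
  proof (rule gf_image_le[OF assms, where f = "\<lambda>(b, t). b @ t"])
    show "?D \<subseteq> (\<lambda>(b, t). b @ t) ` (irr_le N \<times> bridges_le N)"
      using bridge_decompose by fastforce
  qed auto
  moreover have "gf z (bridges_le N) \<le> gf z (irr_le N \<union> ?D)"
    using assms by (intro gf_mono) auto
  moreover have "gf z (irr_le N \<union> ?D) = gf z (irr_le N) + gf z ?D"
    unfolding gf_def by (rule sum.union_disjoint) auto
  ultimately show ?thesis by simp
qed

lemma gf_bridges_ge: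
  assumes "0 \<le> z"
  shows "gf z (irr_le m) * gf z (bridges_le N) \<le> gf z (bridges_le (m + N))"
proof -
  let ?f = "\<lambda>(b, t). b @ (t :: point list)"
  have inj: "inj_on ?f (irr_le m \<times> bridges_le N)"
    using irr_append_unique by (auto simp: inj_on_def)
  have "gf z (irr_le m) * gf z (bridges_le N) = (\<Sum>x\<in>irr_le m \<times> bridges_le N. z ^ length (?f x))"
    unfolding gf_product[symmetric] by (intro sum.cong) auto
  also have "\<dots> = gf z (?f ` (irr_le m \<times> bridges_le N))"
    unfolding gf_def using sum.reindex[OF inj, of "\<lambda>s. z ^ length s"] by (simp add: o_def)
  also have "\<dots> \<le> gf z (bridges_le (m + N))"
    using assms by (intro gf_mono) (auto intro: bridge_append irr_bridge)
  finally show ?thesis .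
qed


section \<open>Critical parameters of truncated irreducible bridges\<close>

lemma saw_steps_up: "saw_steps [(0, 1)]"
  using saw_steps_straight[of 1] by simp

lemma irr_up: "irr [(0, 1)]"
  using saw_steps_up by (auto simp: irr_def bridge_def ht_def)

lemma continuous_gf: "continuous_on UNIV (\<lambda>z. gf z A)"
  unfolding gf_def by (intro continuous_intros)

lemma gf_irr_strict_mono:
  assumes "0 \<le> z" "z < z'" "m \<ge> 1"
  shows "gf z (irr_le m) < gf z' (irr_le m)"
  unfolding gf_def
proof (rule sum_strict_mono_ex1)
  show "\<forall>s\<in>irr_le m. z ^ length s \<le> z' ^ length s" using assms by (auto intro: power_mono)
  show "\<exists>s\<in>irr_le m. z ^ length s < z' ^ length s"
    using assms irr_up by (intro bexI[of _ "[(0, 1)]"]) auto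
qed simp

text \<open>The renewal parameter at which the truncated irreducible bridges carry total weight 1;
  it turns out to be the critical value in \<open>lambda_crit_eq\<close>.\<close>

definition zc :: "nat \<Rightarrow> real" where
  "zc m = (SOME z. 0 < z \<and> z \<le> 1 \<and> gf z (irr_le m) = 1)"

lemma zc:
  assumes "m \<ge> 1"
  shows "0 < zc m" "zc m \<le> 1" "gf (zc m) (irr_le m) = 1"
proof -
  have g0: "gf 0 (irr_le m) = 0"
    unfolding gf_def by (intro sum.neutral) (auto dest!: irr_bridge bridge_ne)
  \<comment> \<open>The single upward step is an irreducible bridge, so the total weight at 1 is at
    least 1 and the intermediate value theorem applies.\<close>
  have "gf 1 {[(0, 1)]} \<le> gf 1 (irr_le m)"
    using assms irr_up by (intro gf_mono) auto
  then have g1: "1 \<le> gf 1 (irr_le m)" by (simp add: gf_def)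
  obtain z where z: "0 \<le> z" "z \<le> 1" "gf z (irr_le m) = 1"
    using IVT'[of "\<lambda>z. gf z (irr_le m)" 0 1 1] g0 g1 continuous_on_subset[OF continuous_gf] by auto
  moreover have "z \<noteq> 0" using z g0 by auto
  ultimately have "0 < z \<and> z \<le> 1 \<and> gf z (irr_le m) = 1" by auto
  then have "0 < zc m \<and> zc m \<le> 1 \<and> gf (zc m) (irr_le m) = 1"
    unfolding zc_def by (rule someI)
  then show "0 < zc m" "zc m \<le> 1" "gf (zc m) (irr_le m) = 1" by auto
qed

lemma zc_antimono:
  assumes "1 \<le> m" "m \<le> n"
  shows "zc n \<le> zc m"
proof (rule ccontr)
  assume "\<not> zc n \<le> zc m"
  then have "gf (zc m) (irr_le m) < gf (zc n) (irr_le m)"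
    using zc[OF assms(1)] assms by (intro gf_irr_strict_mono) auto
  also have "\<dots> \<le> gf (zc n) (irr_le n)"
    using zc[of n] assms by (intro gf_mono) auto
  finally show False using zc[of m] zc[of n] assms by simp
qed

definition zinf :: real where
  "zinf = (INF m\<in>{1..}. zc m)"

lemma bdd_zc: "bdd_below (zc ` {1..})"
  using zc(1) by (intro bdd_belowI[where m = 0]) (auto intro: less_imp_le)

lemma zinf_le: "m \<ge> 1 \<Longrightarrow> zinf \<le> zc m"
  unfolding zinf_def by (intro cINF_lower bdd_zc) auto

lemma zinf_nonneg: "0 \<le> zinf"
  unfolding zinf_def using zc(1) by (intro cINF_greatest) (auto intro: less_imp_le)

lemma gf_zinf_le_1: "gf zinf (irr_le M) \<le> 1"
proof (cases "M = 0")
  case True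
  then have "irr_le M = {}" by (auto dest!: irr_bridge bridge_ne)
  then show ?thesis unfolding gf_def by (simp only: sum.empty)
next
  case False
  then have "gf zinf (irr_le M) \<le> gf (zc M) (irr_le M)"
    using zinf_le[of M] zinf_nonneg by (intro gf_mono_z) auto
  then show ?thesis using zc(3)[of M] False by simp
qed

lemma irr_gf_less_one_bounded:
  assumes "0 \<le> z" "q < 1" "\<And>M. gf z (irr_le M) \<le> q"
  shows "gf z (bridges_le N) \<le> q / (1 - q)"
proof -
  let ?B = "gf z (bridges_le N)"
  have "?B \<le> gf z (irr_le N) + gf z (irr_le N) * ?B" by (rule gf_bridges_le[OF assms(1)])
  also have "\<dots> \<le> q + q * ?B"
    using assms(3) gf_nonneg[OF assms(1)] by (intro add_mono mult_right_mono) auto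
  finally show ?thesis using assms(2) by (simp add: field_simps)
qed

text \<open>Concatenating \<open>k\<close> irreducible bridges in front of one fixed bridge
  multiplies the weight by a factor above 1 each time.\<close>

lemma irr_gf_greater_one_unbounded:
  assumes "0 < z" "1 < gf z (irr_le m)"
  shows "\<exists>N. C < gf z (bridges_le N)"
proof -
  let ?q = "gf z (irr_le m)"
  have ge: "?q ^ k * z \<le> gf z (bridges_le (k * m + 1))" for k
  proof (induction k)
    case 0
    have "gf z {[(0, 1)]} \<le> gf z (bridges_le 1)"
      using assms irr_bridge[OF irr_up] by (intro gf_mono) auto
    then show ?case by (simp add: gf_def)
  next
    case (Suc k)
    have "?q ^ Suc k * z = ?q * (?q ^ k * z)" by simp
    also have "\<dots> \<le> ?q * gf z (bridges_le (k * m + 1))"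
      using Suc assms by (intro mult_left_mono) auto
    also have "\<dots> \<le> gf z (bridges_le (m + (k * m + 1)))"
      using assms by (intro gf_bridges_ge) auto
    finally show ?case by (simp add: ac_simps)
  qed
  obtain k where "C / z < ?q ^ k" using real_arch_pow[OF assms(2)] by blast
  then have "C < ?q ^ k * z" using assms by (simp add: field_simps)
  then show ?thesis using ge[of k] by (meson less_le_trans)
qed

text \<open>
  Kesten's identity: in the limit no mass escapes to long irreducible bridges.  Otherwise the
  generating function of bridges would be finite at \<^term>\<open>zinf\<close>, which would therefore be
  smaller than the radius of convergence, and just above it that function would be both
  finite and infinite.
\<close>

lemma gf_zinf_tendsto: "(\<lambda>M. gf zinf (irr_le M)) \<longlonglongrightarrow> 1"
proof -
  have mono: "incseq (\<lambda>M. gf zinf (irr_le M))"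
    using zinf_nonneg by (intro incseq_SucI gf_mono) auto
  define q where "q = (SUP M. gf zinf (irr_le M))"
  have bdd: "bdd_above (range (\<lambda>M. gf zinf (irr_le M)))"
    using gf_zinf_le_1 by (intro bdd_aboveI[where M = 1]) auto
  have lim: "(\<lambda>M. gf zinf (irr_le M)) \<longlonglongrightarrow> q"
    unfolding q_def by (rule LIMSEQ_incseq_SUP[OF bdd mono])
  have le: "gf zinf (irr_le M) \<le> q" for M
    unfolding q_def by (intro cSUP_upper bdd) auto
  have "q \<le> 1" unfolding q_def by (intro cSUP_least gf_zinf_le_1) auto
  moreover have "\<not> q < 1"
  proof
    assume q: "q < 1"
    have "zinf < inverse connective_constant"
      using bridges_unbounded[of zinf "q / (1 - q)"] irr_gf_less_one_bounded[OF zinf_nonneg q le]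
      by (meson not_less)
    then obtain z where z: "zinf < z" "z < inverse connective_constant" using dense by blast
    then obtain m where m: "m \<ge> 1" "zc m < z"
      unfolding zinf_def using cINF_less_iff[OF _ bdd_zc] by (metis atLeast_iff empty_iff order_refl)
    have "1 < gf z (irr_le m)"
      using gf_irr_strict_mono[of "zc m" z m] zc[OF m(1)] m by simp
    then have unb: "\<exists>N. C < gf z (bridges_le N)" for C
      using z zinf_nonneg by (intro irr_gf_greater_one_unbounded) auto
    obtain C where "\<And>N. gf z (bridges_le N) \<le> C"
      using bridges_bounded[of z] z zinf_nonneg by auto
    then show False using unb[of C] by (meson not_less)
  qed
  ultimately show ?thesis using lim by simp
qed

lemma zc_tendsto: "zc \<longlonglongrightarrow> zinf"
proof (rule LIMSEQ_I)
  fix e :: real assume "e > 0"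
  then have "zinf < zinf + e" by simp
  then obtain m where m: "m \<ge> 1" "zc m < zinf + e"
    unfolding zinf_def using cINF_less_iff[OF _ bdd_zc] by (metis atLeast_iff empty_iff order_refl)
  show "\<exists>no. \<forall>n\<ge>no. norm (zc n - zinf) < e"
  proof (intro exI allI impI)
    fix n assume "n \<ge> m"
    then have "zc n \<le> zc m" "zinf \<le> zc n" using zc_antimono zinf_le m by auto
    then show "norm (zc n - zinf) < e" using m by simp
  qed
qed

text \<open>At \<open>zinf\<close> the weights of \<open>A\<close> and of its complement both
  increase with \<open>m\<close> and their total tends to 1. At \<open>zc m\<close> the total is
  exactly 1 and both weights are larger than at \<open>zinf\<close>, which traps the weight of
  \<open>A\<close> between two sequences with one limit.\<close>

lemma gf_zc_convergent: "convergent (\<lambda>m. gf (zc m) (A \<inter> irr_le m))"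
proof -
  let ?a = "\<lambda>m. gf zinf (A \<inter> irr_le m)" and ?c = "\<lambda>m. gf zinf (irr_le m - A)"
  have "incseq ?a" using zinf_nonneg by (intro incseq_SucI gf_mono) auto
  moreover have "?a m \<le> 1" for m
  proof -
    have "?a m \<le> gf zinf (irr_le m)" using zinf_nonneg by (intro gf_mono) auto
    then show ?thesis using gf_zinf_le_1[of m] by simp
  qed
  ultimately obtain L where L: "?a \<longlonglongrightarrow> L" using incseq_convergent[of ?a 1] by blast
  have split: "gf z (irr_le m) = gf z (A \<inter> irr_le m) + gf z (irr_le m - A)" for z m
    unfolding gf_def by (subst sum.Int_Diff[of _ _ A]) (auto simp: Int_commute)
  have "(\<lambda>m. 1 - (gf zinf (irr_le m) - ?a m)) \<longlonglongrightarrow> 1 - (1 - L)"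
    by (intro tendsto_intros L gf_zinf_tendsto)
  then have up: "(\<lambda>m. 1 - ?c m) \<longlonglongrightarrow> L" by (simp add: split)
  have ev: "\<forall>\<^sub>F m in sequentially. ?a m \<le> gf (zc m) (A \<inter> irr_le m) \<and> gf (zc m) (A \<inter> irr_le m) \<le> 1 - ?c m"
    using eventually_ge_at_top[of 1]
  proof eventually_elim
    case (elim m)
    have le: "gf zinf B \<le> gf (zc m) B" for B
      using zinf_le[OF elim] zinf_nonneg by (intro gf_mono_z) auto
    show ?case using le[of "A \<inter> irr_le m"] le[of "irr_le m - A"] zc(3)[OF elim] split[of "zc m" m] by simp
  qed
  have "(\<lambda>m. gf (zc m) (A \<inter> irr_le m)) \<longlonglongrightarrow> L"
    by (rule tendsto_sandwich[OF _ _ L up]) (use ev in \<open>auto elim: eventually_mono\<close>)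
  then show ?thesis by (rule convergentI)
qed


section \<open>Bridges without horizontal displacement\<close>

lemma bridge_mirror:
  assumes "bridge s"
  shows "bridge (map mirror s)"
proof -
  have h: "ht (map mirror t) = ht t" for t by (simp add: ht_def sum_list_mirror mirror_def)
  show ?thesis using assms by (auto simp: bridge_def saw_steps_mirror h take_map)
qed

lemma gf_bridges_count:
  "gf z (bridges_le N) = (\<Sum>n\<le>N. real (card {s. bridge s \<and> length s = n}) * z ^ n)"
proof -
  have "bridges_le N = (\<Union>n\<in>{..N}. {s. bridge s \<and> length s = n})" by auto
  then have "gf z (bridges_le N) = (\<Sum>n\<le>N. gf z {s. bridge s \<and> length s = n})"
    unfolding gf_def by (simp only:) (rule sum.UNION_disjoint; auto)
  also have "\<dots> = (\<Sum>n\<le>N. real (card {s. bridge s \<and> length s = n}) * z ^ n)"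
    by (intro sum.cong refl) (simp add: gf_def)
  finally show ?thesis .
qed

text \<open>The number \<open>2 * n + 1\<close> counts the possible horizontal displacements. If the
  bound failed for all \<open>n\<close>, the bridge series at the reciprocal connective constant
  would be dominated by a convergent one, against \<open>bridges_unbounded\<close>.\<close>

lemma many_bridges:
  assumes "lam > inverse connective_constant"
  obtains n where "real (2 * n + 1) \<le> real (card {s. bridge s \<and> length s = n}) * lam ^ n"
proof (rule ccontr)
  let ?b = "\<lambda>n. real (card {s. bridge s \<and> length s = n})" and ?z = "inverse connective_constant"
  assume "\<not> thesis"
  then have small: "?b n * lam ^ n < real (2 * n + 1)" for n using that not_less by blast
  have mu: "?z > 0" using connective_constant_ge_1 by simp
  define q where "q = ?z / lam"
  have q: "0 < q" "q < 1" using mu assms less_trans[OF mu assms] by (simp_all add: q_def)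
  have sm: "(\<lambda>n. 2 * (real (Suc n) * q ^ n)) sums (2 * (1 / (1 - q)\<^sup>2))"
    by (intro sums_mult geometric_deriv_sums) (use q in auto)
  have "?b n * ?z ^ n \<le> 2 * (real (Suc n) * q ^ n)" for n
  proof -
    have "?b n * ?z ^ n = (?b n * lam ^ n) * q ^ n"
      using less_trans[OF mu assms] by (simp add: q_def power_divide)
    also have "\<dots> \<le> real (2 * n + 1) * q ^ n"
      using small[of n] q by (intro mult_right_mono) auto
    also have "\<dots> \<le> 2 * (real (Suc n) * q ^ n)" using q by (simp add: algebra_simps)
    finally show ?thesis .
  qed
  then have "gf ?z (bridges_le N) \<le> (\<Sum>n\<le>N. 2 * (real (Suc n) * q ^ n))" for N
    unfolding gf_bridges_count by (rule sum_mono)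
  also have "(\<Sum>n\<le>N. 2 * (real (Suc n) * q ^ n)) \<le> 2 * (1 / (1 - q)\<^sup>2)" for N
    unfolding sums_unique[OF sm] using q by (intro sum_le_suminf sums_summable[OF sm]) auto
  finally show False using bridges_unbounded[of ?z "2 * (1 / (1 - q)\<^sup>2)"] by (meson not_less order_refl)
qed

text \<open>By pigeonhole, some displacement class alone has total weight at least 1. Following a
  member by the mirror image of another cancels the displacement and squares the weight.\<close>

lemma flat_bridges:
  assumes "lam > inverse connective_constant"
  obtains n S where "S \<subseteq> {s. bridge s \<and> length s = n \<and> fst (sum_list s) = 0}" "n \<ge> 1"
    "1 \<le> real (card S) * lam ^ n"
proof -
  obtain n where n: "real (2 * n + 1) \<le> real (card {s. bridge s \<and> length s = n}) * lam ^ n"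
    using many_bridges[OF assms] .
  have lam: "lam > 0" using assms connective_constant_ge_1
    by (meson inverse_positive_iff_positive less_trans less_le_trans zero_less_one)
  define D where "D d = {s. bridge s \<and> length s = n \<and> fst (sum_list s) = d}" for d
  have finD: "finite (D d)" for d
    by (rule finite_subset[OF _ finite_bridges(4)[of n]]) (auto simp: D_def)
  have "\<exists>d\<in>{- int n..int n}. 1 \<le> real (card (D d)) * lam ^ n"
  proof (rule ccontr)
    assume "\<not> ?thesis"
    then have small: "real (card (D d)) * lam ^ n < 1" if "d \<in> {- int n..int n}" for d
      using that by (meson not_le)
    have "{s. bridge s \<and> length s = n} \<subseteq> (\<Union>d\<in>{- int n..int n}. D d)"
    proof
      fix s assume s: "s \<in> {s. bridge s \<and> length s = n}"
      then have "set s \<subseteq> dirs" by (auto simp: bridge_def saw_steps_def)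
      then have "fst (sum_list s) \<in> {- int n..int n}" using abs_sum_dirs[of s] s by auto
      then show "s \<in> (\<Union>d\<in>{- int n..int n}. D d)" using s by (auto simp: D_def)
    qed
    then have "card {s. bridge s \<and> length s = n} \<le> card (\<Union>d\<in>{- int n..int n}. D d)"
      using finD by (intro card_mono) auto
    also have "\<dots> \<le> (\<Sum>d\<in>{- int n..int n}. card (D d))" by (rule card_UN_le) simp
    finally have "real (card {s. bridge s \<and> length s = n}) * lam ^ n
        \<le> real (\<Sum>d\<in>{- int n..int n}. card (D d)) * lam ^ n"
      using lam by (intro mult_right_mono of_nat_mono) auto
    also have "\<dots> = (\<Sum>d\<in>{- int n..int n}. real (card (D d)) * lam ^ n)"
      by (simp add: sum_distrib_right)
    also have "\<dots> < (\<Sum>d\<in>{- int n..int n}. 1)"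
      using small by (intro sum_strict_mono) auto
    also have "\<dots> = real (2 * n + 1)" by simp
    finally show False using n by simp
  qed
  then obtain d where d: "1 \<le> real (card (D d)) * lam ^ n" by blast
  have n1: "n \<ge> 1"
  proof (rule ccontr)
    assume "\<not> n \<ge> 1"
    then have "n = 0" by simp
    then have "D d = {}" by (auto simp: D_def dest: bridge_ne)
    then show False using d by simp
  qed
  let ?f = "\<lambda>(b, b'). b @ map mirror b'"
  define S where "S = ?f ` (D d \<times> D d)"
  have "inj mirror" by (rule inj_on_inverseI[of _ mirror]) simp
  then have inj: "inj_on ?f (D d \<times> D d)"
    by (auto simp: inj_on_def D_def)
  have "card S = card (D d) * card (D d)"
    unfolding S_def by (simp add: card_image[OF inj] card_cartesian_product)
  then have "real (card S) * lam ^ (2 * n) = (real (card (D d)) * lam ^ n) * (real (card (D d)) * lam ^ n)"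
    by (simp add: mult_2 power_add)
  moreover have "1 * 1 \<le> (real (card (D d)) * lam ^ n) * (real (card (D d)) * lam ^ n)"
    using d by (intro mult_mono) auto
  ultimately have "1 \<le> real (card S) * lam ^ (2 * n)" by simp
  moreover have "S \<subseteq> {s. bridge s \<and> length s = 2 * n \<and> fst (sum_list s) = 0}"
    by (auto simp: S_def D_def sum_list_mirror mirror_def intro!: bridge_append bridge_mirror)
  ultimately show ?thesis using that[of S "2 * n"] n1 by simp
qed


section \<open>Bounds on escape probabilities by flows\<close>

text \<open>A small multiple of a bounded \<open>lam'\<close>-subharmonic function is a subsolution
  at \<open>lam\<close>: the gap between \<open>lam'\<close> and \<open>lam\<close> pays for the
  nonlinearity of \<open>netf\<close>.\<close>

lemma esc_ge_flow:
  assumes lam: "0 < lam'" "lam' < lam" and C: "0 < C"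
    and h: "\<And>v. 0 \<le> h v" "\<And>v. h v \<le> C" "\<And>v. v \<notin> T \<Longrightarrow> h v = 0"
    and sub: "\<And>v. h v \<le> lam' * sum h (children T v)"
  shows "(1 - lam' / lam) * h v / C \<le> esc T lam v"
proof -
  \<comment> \<open>With \<open>r = lam / lam'\<close>, the inequality
    \<open>y \<le> netf (r * y)\<close> holds for nonnegative \<open>y\<close> up to
    \<open>1 - 1 / r\<close>; this scaling makes \<open>1 - 1 / r\<close> the bound for the whole
    function.\<close>
  define \<epsilon> where "\<epsilon> = (1 - lam' / lam) / C"
  have \<epsilon>: "0 < \<epsilon>" using lam C by (simp add: \<epsilon>_def)
  have \<epsilon>C: "\<epsilon> * C = 1 - lam' / lam" using C by (simp add: \<epsilon>_def)
  have le: "\<epsilon> * h v \<le> 1 - lam' / lam" for v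
    using mult_left_mono[OF h(2)[of v], of \<epsilon>] \<epsilon> \<epsilon>C by simp
  have "subsol T lam (\<lambda>v. \<epsilon> * h v)"
    unfolding subsol_def
  proof (intro allI conjI impI)
    fix v
    show "0 \<le> \<epsilon> * h v" using \<epsilon> h by simp
    have "0 \<le> lam' / lam" using lam by simp
    then show "\<epsilon> * h v \<le> 1" using le[of v] by linarith
    show "v \<notin> T \<Longrightarrow> \<epsilon> * h v = 0" using h by simp
    define y where "y = \<epsilon> * h v"
    define r where "r = lam / lam'"
    have r: "r > 0" "lam' / lam = 1 / r" using lam by (simp_all add: r_def)
    have y0: "0 \<le> y" using \<epsilon> h by (simp add: y_def)
    have "y \<le> 1 - 1 / r" using le[of v] r by (simp add: y_def)
    then have "1 + r * y \<le> r" using r by (simp add: field_simps)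
    then have "y * (1 + r * y) \<le> y * r" using y0 by (rule mult_left_mono)
    then have "y \<le> netf (r * y)" using r y0 by (simp add: netf_def field_simps add_pos_nonneg)
    also have "\<dots> \<le> netf (lam * (\<Sum>u\<in>children T v. \<epsilon> * h u))"
    proof (rule netf_mono)
      have "r * y \<le> r * (\<epsilon> * (lam' * sum h (children T v)))"
        using sub[of v] \<epsilon> r by (simp add: y_def)
      also have "\<dots> = lam * (\<Sum>u\<in>children T v. \<epsilon> * h u)"
        using lam by (simp add: r_def sum_distrib_left[symmetric])
      finally show "r * y \<le> \<dots>" .
    qed (use r y0 in simp)
    finally show "\<epsilon> * h v \<le> netf (lam * (\<Sum>u\<in>children T v. \<epsilon> * h u))" by (simp add: y_def)
  qed
  then have "\<epsilon> * h v \<le> esc T lam v" by (rule subsol_le_esc)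
  then show ?thesis by (simp add: \<epsilon>_def)
qed

text \<open>The best constant \<open>M\<close> reproduces itself through the equation with a loss
  from the nonlinearity, which forces \<open>M = 0\<close> up to \<open>lam0\<close> and makes
  \<open>M\<close> at most linear in \<open>lam - lam0\<close> beyond it.\<close>

lemma esc_le_flow:
  assumes lam: "0 < lam0" "0 \<le> lam" and c: "0 < c" and T: "T \<noteq> {}"
    and h: "\<And>v. v \<in> T \<Longrightarrow> c \<le> h v"
    and super: "\<And>v. v \<in> T \<Longrightarrow> lam0 * sum h (children T v) \<le> h v"
  obtains M where "0 \<le> M" "\<And>v. v \<in> T \<Longrightarrow> esc T lam v \<le> M * h v"
    "M = 0 \<or> M * lam * c \<le> lam - lam0"
proof -
  define M where "M = (SUP v\<in>T. esc T lam v / h v)"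
  have hp: "0 < h v" if "v \<in> T" for v using h[OF that] c by linarith
  have "esc T lam v / h v \<le> 1 / c" if "v \<in> T" for v
    using h[OF that] c by (intro frac_le) auto
  then have bdd: "bdd_above ((\<lambda>v. esc T lam v / h v) ` T)" by (intro bdd_aboveI[where M = "1 / c"]) auto
  have le: "esc T lam v / h v \<le> M" if "v \<in> T" for v
    unfolding M_def by (rule cSUP_upper[OF that bdd])
  then have le': "esc T lam v \<le> M * h v" if "v \<in> T" for v
    using hp[OF that] that by (simp add: divide_le_eq)
  obtain v0 where v0: "v0 \<in> T" using T by auto
  have M0: "0 \<le> M"
    using le[OF v0] hp[OF v0] esc_nonneg[of T lam v0] by (meson divide_nonneg_pos order_trans)
  define r where "r = lam / lam0"
  have r: "0 \<le> r" using lam by (simp add: r_def)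
  \<comment> \<open>The lower bound \<open>c\<close> on \<open>h\<close> turns the concavity of
    \<open>netf\<close> into a loss that is uniform over the tree.\<close>
  have "esc T lam v / h v \<le> M * r / (1 + M * r * c)" if v: "v \<in> T" for v
  proof -
    have "lam * sum (esc T lam) (children T v) \<le> lam * (\<Sum>u\<in>children T v. M * h u)"
      using lam le' by (intro mult_left_mono sum_mono) (auto simp: children_def)
    also have "\<dots> = M * r * (lam0 * sum h (children T v))"
      using lam by (simp add: r_def sum_distrib_left[symmetric])
    also have "\<dots> \<le> M * r * h v"
      using super[OF v] M0 r by (intro mult_left_mono) auto
    finally have "netf (lam * sum (esc T lam) (children T v)) \<le> netf (M * r * h v)"
      using lam by (intro netf_mono) auto
    then have "esc T lam v \<le> netf (M * r * h v)"
      using esc_eq[OF lam(2) v] by simp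
    then have "esc T lam v / h v \<le> netf (M * r * h v) / h v"
      using hp[OF v] by (intro divide_right_mono) auto
    also have "\<dots> = M * r / (1 + M * r * h v)" using hp[OF v] by (simp add: netf_def)
    also have "\<dots> \<le> M * r / (1 + M * r * c)"
      using h[OF v] M0 r c hp[OF v]
      by (intro divide_left_mono add_left_mono mult_left_mono mult_pos_pos add_pos_nonneg mult_nonneg_nonneg) auto
    finally show ?thesis .
  qed
  then have "M \<le> M * r / (1 + M * r * c)" unfolding M_def using T by (intro cSUP_least) auto
  moreover have "0 < 1 + M * r * c" using M0 r c by (intro add_pos_nonneg) auto
  ultimately have "M * (1 + M * r * c) \<le> M * r" by (simp add: pos_le_divide_eq)
  then have "M = 0 \<or> 1 + M * r * c \<le> r"
    using M0 by (cases "M = 0") auto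
  moreover have "M * lam * c \<le> lam - lam0" if "1 + M * r * c \<le> r"
  proof -
    have "lam0 * (1 + M * r * c) \<le> lam0 * r" using that lam by (intro mult_left_mono) auto
    moreover have "lam0 * r = lam" using lam by (simp add: r_def)
    then have "lam0 * (1 + M * r * c) = lam0 + M * lam * c" by (simp add: distrib_left mult_ac)
    ultimately show ?thesis using \<open>lam0 * r = lam\<close> by simp
  qed
  ultimately have "M = 0 \<or> M * lam * c \<le> lam - lam0" by blast
  then show ?thesis using that[of M] M0 le' by blast
qed


section \<open>Extending walks by step sequences\<close>

text \<open>\<open>tl\<close> drops the last vertex of \<open>y\<close>, which would otherwise occur
  twice.\<close>

definition ext :: "point list \<Rightarrow> point list \<Rightarrow> point list" where
  "ext y s = y @ tl (walk (last y) s)"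

definition stepR :: "point list set \<Rightarrow> point list \<Rightarrow> point list \<Rightarrow> bool" where
  "stepR A y z \<longleftrightarrow> (\<exists>s\<in>A. z = ext y s)"

lemma ext_Nil [simp]: "ext y [] = y"
  by (simp add: ext_def)

lemma walk_eq_Cons: "walk p s = p # tl (walk p s)"
  by (cases s) auto

lemma length_tl_walk [simp]: "length (tl (walk p s)) = length s"
  by simp

lemma length_ext [simp]: "length (ext y s) = length y + length s"
  by (simp add: ext_def)

lemma ext_walk: "ext (walk p a) s = walk p (a @ s)"
  by (simp add: ext_def walk_append last_walk)

lemma ext_ext: "y \<noteq> [] \<Longrightarrow> ext (ext y s) t = ext y (s @ t)"
  using walk_exists[of y] ext_walk by (metis append_assoc)

lemma prefix_ext: "prefix y (ext y s)"
  by (simp add: ext_def)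

lemma ext_inj: "ext y s = ext y t \<longleftrightarrow> s = t"
proof -
  have "tl (walk p s) = tl (walk p t) \<longleftrightarrow> s = t" for p
    using walk_eq_Cons[of p] walk_inj by metis
  then show ?thesis by (simp add: ext_def)
qed

lemma prefix_ext_exists:
  assumes "y \<noteq> []" "prefix y z"
  shows "\<exists>s. z = ext y s"
proof -
  obtain zs where zs: "z = y @ zs" using assms by (auto simp: prefix_def)
  obtain s where s: "last y # zs = walk (last y) s"
    using walk_exists[of "last y # zs"] by auto
  then have "zs = tl (walk (last y) s)" by (metis list.sel(3))
  then show ?thesis using zs by (auto simp: ext_def)
qed

lemma drop_ext: "y \<noteq> [] \<Longrightarrow> drop (length y - 1) (ext y s) = walk (last y) s"
proof -
  assume "y \<noteq> []"
  then have "y = butlast y @ [last y]" "length (butlast y) = length y - 1" by simp_all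
  then have "drop (length y - 1) (ext y s) = last y # tl (walk (last y) s)"
    unfolding ext_def by (metis append.assoc append_Cons append_Nil append_eq_conv_conj)
  then show ?thesis using walk_eq_Cons by metis
qed

lemma stepR_length:
  assumes "[] \<notin> A" "stepR A y z"
  shows "length y < length z" "prefix y z"
  using assms prefix_ext by (auto simp: stepR_def)

lemma sum_stepR:
  "(\<Sum>z | stepR A y z. lam ^ (length z - length y)) = gf lam A"
proof -
  have "{z. stepR A y z} = ext y ` A" by (auto simp: stepR_def)
  moreover have "inj_on (ext y) A" by (auto simp: inj_on_def ext_inj)
  ultimately show ?thesis by (simp add: gf_def sum.reindex)
qed

lemma finite_stepR: "finite A \<Longrightarrow> finite {z. stepR A y z}"
proof -
  assume "finite A"
  moreover have "{z. stepR A y z} = ext y ` A" by (auto simp: stepR_def)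
  ultimately show ?thesis by simp
qed


section \<open>Trees coded by concatenation\<close>

lemma sum_UN_le:
  fixes g :: "'b \<Rightarrow> real"
  assumes "finite I" "\<And>i. i \<in> I \<Longrightarrow> finite (B i)" "\<And>x. 0 \<le> g x"
  shows "sum g (\<Union>i\<in>I. B i) \<le> (\<Sum>i\<in>I. sum g (B i))"
  using assms(1,2)
proof (induction rule: finite_induct)
  case (insert i I)
  have "sum g (\<Union>j\<in>insert i I. B j) \<le> sum g (B i) + sum g (\<Union>j\<in>I. B j)"
    using insert assms(3) by (simp add: sum_Un sum_nonneg)
  then show ?case using insert by simp
qed simp

text \<open>
  The function \<open>flow_h\<close> below is the density, with respect to \<open>lam\<close> to the length, of the law of
  an infinite concatenation of independent steps from \<open>A\<close>, the step \<open>s\<close> being chosen with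
  probability proportional to \<open>lam\<close> to the length of \<open>s\<close>; it is summed over the first code word
  beyond a given vertex.
\<close>

locale code_tree = walk_tree T a0 for T :: "point list set" and a0 +
  fixes v0 :: "point list" and A :: "point list set" and m :: nat and lam :: real
  assumes v0_T: "v0 \<in> T"
    and finite_A: "finite A" and Nil_A: "[] \<notin> A" and length_A: "s \<in> A \<Longrightarrow> length s \<le> m"
    and code_T: "(stepR A)\<^sup>*\<^sup>* v0 z \<Longrightarrow> z \<in> T"
    and unique_parent: "(stepR A)\<^sup>*\<^sup>* v0 y \<Longrightarrow> (stepR A)\<^sup>*\<^sup>* v0 y' \<Longrightarrow> stepR A y z \<Longrightarrow> stepR A y' z \<Longrightarrow> y = y'"
    and lam_pos: "0 < lam"
begin

abbreviation "code \<equiv> (stepR A)\<^sup>*\<^sup>* v0"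

text \<open>"First" is expressed through the predecessor: \<open>z\<close> lies beyond
  \<open>u\<close>, but no code word one step before \<open>z\<close> does.\<close>

definition first_codes :: "point list \<Rightarrow> point list set" where
  "first_codes u = {z. code z \<and> prefix u z \<and> \<not> (\<exists>y. code y \<and> stepR A y z \<and> prefix u y)}"

definition flow_h :: "point list \<Rightarrow> real" where
  "flow_h u = (if u \<in> T \<and> prefix v0 u then \<Sum>z\<in>first_codes u. lam ^ (length z - length u) else 0)"

lemma prefix_code: "code z \<Longrightarrow> prefix v0 z"
  by (induction rule: rtranclp_induct) (use stepR_length[OF Nil_A] prefix_order.trans in blast)+

lemma code_parent: "code z \<Longrightarrow> z \<noteq> v0 \<Longrightarrow> \<exists>y. code y \<and> stepR A y z"
  by (erule rtranclp.cases) auto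

lemma code_child: "code y \<Longrightarrow> stepR A y z \<Longrightarrow> code z"
  by (rule rtranclp.rtrancl_into_rtrancl)

lemma first_codes_cases:
  assumes z: "z \<in> first_codes u" and u: "prefix v0 u"
  obtains "z = u" | y where "code y" "stepR A y z" "prefix y u" "y \<noteq> u" "length z < length u + m" "prefix u z"
proof (cases "z = u")
  case False
  have pz: "prefix u z" and cz: "code z" using z by (auto simp: first_codes_def)
  then have "z \<noteq> v0" using False u prefix_order.antisym by blast
  then obtain y where y: "code y" "stepR A y z" using code_parent cz by blast
  have "\<not> prefix u y" using z y by (auto simp: first_codes_def)
  moreover have "prefix y z" by (rule stepR_length[OF Nil_A y(2)])
  ultimately have yu: "prefix y u" "y \<noteq> u" using pz prefix_same_cases by blast+
  then have "length y < length u" by (metis prefix_length_less prefix_order.le_neq_trans)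
  moreover have "length z \<le> length y + m" using y(2) length_A by (auto simp: stepR_def)
  ultimately show ?thesis using that(2) y yu pz by simp
qed (use that in blast)

lemma first_codes_length: "z \<in> first_codes u \<Longrightarrow> prefix v0 u \<Longrightarrow> length u \<le> length z \<and> length z \<le> length u + m"
  by (erule first_codes_cases) (auto dest: prefix_length_le)

lemma first_codes_subset:
  assumes "prefix v0 u"
  shows "first_codes u \<subseteq> insert u (\<Union>y\<in>{y. prefix y u}. {z. stepR A y z})"
proof
  fix z assume "z \<in> first_codes u"
  then show "z \<in> insert u (\<Union>y\<in>{y. prefix y u}. {z. stepR A y z})"
    using assms by (rule first_codes_cases) auto
qed

lemma finite_prefixes: "finite {y. prefix y u}"
  using finite_set[of "prefixes u"] by (simp add: set_prefixes_eq)

lemma finite_first_codes: "prefix v0 u \<Longrightarrow> finite (first_codes u)"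
  by (rule finite_subset[OF first_codes_subset])
     (auto intro!: finite_UN_I finite_prefixes finite_stepR finite_A)

lemma flow_h_nonneg: "0 \<le> flow_h u"
  using lam_pos by (auto simp: flow_h_def intro!: sum_nonneg)

lemma flow_h_outside: "u \<notin> T \<Longrightarrow> flow_h u = 0"
  by (simp add: flow_h_def)

text \<open>Moving from \<open>u\<close> to its children keeps the first code words, except that
  \<open>u\<close> itself, if it is a code word, is replaced by its successors.\<close>

lemma Union_first_codes:
  assumes u: "u \<in> T" "prefix v0 u"
  shows "(\<Union>c\<in>children T u. first_codes c) = (first_codes u - {u}) \<union> {z. code u \<and> stepR A u z}"
proof (intro equalityI subsetI)
  fix z assume "z \<in> (\<Union>c\<in>children T u. first_codes c)"
  then obtain c where c: "c \<in> children T u" "z \<in> first_codes c" by blast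
  then obtain d where d: "c = u @ [d]" by (auto simp: children_def)
  have z: "code z" "prefix c z" using c by (auto simp: first_codes_def)
  then have uz: "prefix u z" "z \<noteq> u" using d by (auto simp: prefix_def)
  show "z \<in> (first_codes u - {u}) \<union> {z. code u \<and> stepR A u z}"
  proof (cases "z \<in> first_codes u")
    case False
    then obtain y where y: "code y" "stepR A y z" "prefix u y" using z uz by (auto simp: first_codes_def)
    have "\<not> prefix c y" using c y by (auto simp: first_codes_def)
    moreover have "prefix y z" by (rule stepR_length[OF Nil_A y(2)])
    ultimately have "prefix y c" "y \<noteq> c" using z prefix_same_cases by blast+
    then have "prefix y u" using d by (auto simp: prefix_snoc)
    then have "y = u" using y prefix_order.antisym by blast
    then show ?thesis using y by blast
  qed (use uz in blast)
next
  fix z assume z: "z \<in> (first_codes u - {u}) \<union> {z. code u \<and> stepR A u z}"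
  then have cz: "code z" "prefix u z" "z \<noteq> u"
    using code_child stepR_length[OF Nil_A] by (auto simp: first_codes_def)
  then obtain zs' where zs': "z = u @ zs'" "zs' \<noteq> []" by (auto simp: prefix_def)
  then obtain d zs where d: "z = u @ d # zs" by (cases zs') blast+
  let ?c = "u @ [d]"
  have "prefix ?c z" using d by simp
  moreover have "?c \<in> children T u"
    using prefix_in_T[OF code_T[OF cz(1)] \<open>prefix ?c z\<close>] by (simp add: children_def)
  moreover have "\<not> (\<exists>y. code y \<and> stepR A y z \<and> prefix ?c y)"
  proof
    assume "\<exists>y. code y \<and> stepR A y z \<and> prefix ?c y"
    then obtain y where y: "code y" "stepR A y z" "prefix ?c y" by blast
    then have "prefix u y" "y \<noteq> u" by (auto simp: prefix_def)
    then have "z \<notin> first_codes u" using y by (auto simp: first_codes_def)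
    then have "code u" "stepR A u z" using z by auto
    then show False using unique_parent y \<open>y \<noteq> u\<close> by blast
  qed
  ultimately show "z \<in> (\<Union>c\<in>children T u. first_codes c)" using cz by (auto simp: first_codes_def)
qed

text \<open>Harmonicity can fail only at code words, where the weight 1 of the word is exchanged for
  the total weight of its successors.\<close>

lemma flow_h_children:
  assumes u: "u \<in> T" "prefix v0 u"
  shows "lam * sum flow_h (children T u) = flow_h u + (if code u then gf lam A - 1 else 0)"
proof -
  let ?w = "\<lambda>z. lam ^ (length z - length u)"
  have ch: "c \<in> T \<and> prefix v0 c \<and> length c = Suc (length u)" if "c \<in> children T u" for c
    using that u by (auto simp: children_def)
  have child: "lam * flow_h c = (\<Sum>z\<in>first_codes c. ?w z)" if c: "c \<in> children T u" for c
  proof -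
    have "lam * lam ^ (length z - length c) = ?w z" if z: "z \<in> first_codes c" for z
    proof -
      have "length c \<le> length z" using first_codes_length[OF z] ch[OF c] by simp
      then have "length z - length u = Suc (length z - length c)" using ch[OF c] by simp
      then show ?thesis by simp
    qed
    then show ?thesis using ch[OF c] by (simp add: flow_h_def sum_distrib_left)
  qed
  have "lam * sum flow_h (children T u) = (\<Sum>c\<in>children T u. \<Sum>z\<in>first_codes c. ?w z)"
    using child by (simp add: sum_distrib_left)
  also have "\<dots> = (\<Sum>z\<in>(\<Union>c\<in>children T u. first_codes c). ?w z)"
  proof (rule sum.UNION_disjoint[symmetric])
    show "\<forall>c\<in>children T u. finite (first_codes c)" using ch finite_first_codes by blast
    show "\<forall>c\<in>children T u. \<forall>d\<in>children T u. c \<noteq> d \<longrightarrow> first_codes c \<inter> first_codes d = {}"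
    proof (intro ballI impI)
      fix c d assume cd: "c \<in> children T u" "d \<in> children T u" "c \<noteq> d"
      show "first_codes c \<inter> first_codes d = {}"
      proof (rule ccontr)
        assume "first_codes c \<inter> first_codes d \<noteq> {}"
        then obtain z where "prefix c z" "prefix d z" by (auto simp: first_codes_def)
        then have "prefix c d" using ch cd prefix_length_prefix by (metis order_refl)
        then show False using prefix_same_length[of c d] ch cd by simp
      qed
    qed
  qed (rule finite_children)
  also have "\<dots> = (\<Sum>z\<in>first_codes u - {u}. ?w z) + (\<Sum>z | code u \<and> stepR A u z. ?w z)"
    unfolding Union_first_codes[OF u]
  proof (rule sum.union_disjoint)
    show "finite {z. code u \<and> stepR A u z}"
      by (rule finite_subset[OF _ finite_stepR[OF finite_A, of u]]) auto
    show "(first_codes u - {u}) \<inter> {z. code u \<and> stepR A u z} = {}"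
      by (auto simp: first_codes_def)
  qed (simp add: finite_first_codes u)
  also have "(\<Sum>z\<in>first_codes u - {u}. ?w z) = flow_h u - (if code u then 1 else 0)"
  proof -
    have "u \<in> first_codes u \<longleftrightarrow> code u"
      using stepR_length[OF Nil_A] by (fastforce simp: first_codes_def dest: prefix_length_le)
    moreover have "flow_h u = (\<Sum>z\<in>first_codes u. ?w z)" using u by (simp add: flow_h_def)
    ultimately show ?thesis
      using finite_first_codes[OF u(2)] by (simp add: sum_diff1)
  qed
  also have "(\<Sum>z | code u \<and> stepR A u z. ?w z) = (if code u then gf lam A else 0)"
    using sum_stepR[where A = A and y = u and lam = lam] by auto
  finally show ?thesis by simp
qed

definition flow_bound :: real where
  "flow_bound = 1 + real m * (max 1 (1 / lam) ^ m * gf lam A)"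

lemma flow_h_le: "flow_h u \<le> flow_bound"
proof (cases "u \<in> T \<and> prefix v0 u")
  case True
  let ?w = "\<lambda>z. lam ^ (length z - length u)" and ?q = "max 1 (1 / lam)"
  \<comment> \<open>A first code word other than \<open>u\<close> has its predecessor among the last
    \<open>m\<close> proper prefixes of \<open>u\<close>, since a step has length at most
    \<open>m\<close>.\<close>
  let ?Y = "(\<lambda>i. take i u) ` {length u - m..<length u}"
  have q: "1 \<le> ?q" by simp
  have "first_codes u - {u} \<subseteq> (\<Union>y\<in>?Y. {z. stepR A y z \<and> length u \<le> length z})"
  proof
    fix z assume z: "z \<in> first_codes u - {u}"
    then have zf: "z \<in> first_codes u" and zu: "z \<noteq> u" by auto
    from zf True[THEN conjunct2] show "z \<in> (\<Union>y\<in>?Y. {z. stepR A y z \<and> length u \<le> length z})"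
    proof (rule first_codes_cases)
      fix y assume 4: "code y" "stepR A y z" "prefix y u" "y \<noteq> u" "length z < length u + m" "prefix u z"
      have "length y < length u" using 4 by (metis prefix_length_less prefix_order.le_neq_trans)
      moreover have "y = take (length y) u" using 4 by (auto simp: prefix_def)
      moreover have "length z \<le> length y + m" using 4 length_A by (auto simp: stepR_def)
      moreover have "length u \<le> length z" using 4 by (auto dest: prefix_length_le)
      ultimately have "y \<in> ?Y" by (intro image_eqI[of _ _ "length y"]) auto
      then show ?thesis using 4 \<open>length u \<le> length z\<close> by blast
    qed (use zu in simp)
  qed
  moreover have fin: "finite {z. stepR A y z \<and> length u \<le> length z}" for y
    by (rule finite_subset[OF _ finite_stepR[OF finite_A, of y]]) auto
  ultimately have "sum ?w (first_codes u - {u}) \<le> sum ?w (\<Union>y\<in>?Y. {z. stepR A y z \<and> length u \<le> length z})"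
    using lam_pos by (intro sum_mono2) auto
  also have "\<dots> \<le> (\<Sum>y\<in>?Y. sum ?w {z. stepR A y z \<and> length u \<le> length z})"
    using lam_pos fin by (intro sum_UN_le) auto
  also have "\<dots> \<le> (\<Sum>y\<in>?Y. ?q ^ m * gf lam A)"
  proof (rule sum_mono)
    fix y assume "y \<in> ?Y"
    then obtain i where i: "y = take i u" "length u - m \<le> i" "i < length u" by auto
    then have ly: "length y = i" by simp
    have "sum ?w {z. stepR A y z \<and> length u \<le> length z}
        \<le> (\<Sum>z | stepR A y z \<and> length u \<le> length z. ?q ^ m * lam ^ (length z - length y))"
    proof (rule sum_mono)
      fix z assume z: "z \<in> {z. stepR A y z \<and> length u \<le> length z}"
      have e: "length z - length y = (length z - length u) + (length u - i)" using z i ly by simp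
      \<comment> \<open>The weights here are measured from \<open>u\<close>, those in
        \<open>gf\<close> from the predecessor; the factor \<open>?q ^ m\<close> covers the
        difference also when \<open>lam < 1\<close>.\<close>
      have "1 \<le> (?q * lam) ^ (length u - i)"
        using lam_pos by (intro one_le_power) (auto simp: max_def field_simps)
      also have "\<dots> \<le> ?q ^ m * lam ^ (length u - i)"
        unfolding power_mult_distrib using i lam_pos by (intro mult_right_mono power_increasing) auto
      finally have "?w z * 1 \<le> ?w z * (?q ^ m * lam ^ (length u - i))"
        using lam_pos by (intro mult_left_mono) auto
      then show "?w z \<le> ?q ^ m * lam ^ (length z - length y)"
        unfolding e power_add by (simp add: mult_ac)
    qed
    also have "\<dots> \<le> (\<Sum>z | stepR A y z. ?q ^ m * lam ^ (length z - length y))"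
      using lam_pos finite_stepR[OF finite_A] by (intro sum_mono2) auto
    also have "\<dots> = ?q ^ m * gf lam A" by (simp add: sum_distrib_left[symmetric] sum_stepR)
    finally show "sum ?w {z. stepR A y z \<and> length u \<le> length z} \<le> ?q ^ m * gf lam A" .
  qed
  also have "\<dots> = real (card ?Y) * (?q ^ m * gf lam A)" by simp
  also have "\<dots> \<le> real m * (?q ^ m * gf lam A)"
  proof (rule mult_right_mono)
    have "card ?Y \<le> card {length u - m..<length u}" by (rule card_image_le) simp
    then show "real (card ?Y) \<le> real m" by simp
    show "0 \<le> ?q ^ m * gf lam A" using lam_pos gf_nonneg[of lam A] by simp
  qed
  finally have "sum ?w (first_codes u - {u}) \<le> real m * (?q ^ m * gf lam A)" .
  moreover have "flow_h u \<le> 1 + sum ?w (first_codes u - {u})"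
  proof -
    have "flow_h u = sum ?w (first_codes u)" using True by (simp add: flow_h_def)
    also have "\<dots> \<le> sum ?w (insert u (first_codes u - {u}))"
      using lam_pos True by (intro sum_mono2) (auto simp: finite_first_codes)
    also have "\<dots> = 1 + sum ?w (first_codes u - {u})"
      using True by (subst sum.insert) (auto simp: finite_first_codes)
    finally show ?thesis .
  qed
  ultimately show ?thesis by (simp add: flow_bound_def)
next
  case False
  then show ?thesis
    using lam_pos gf_nonneg[of lam A] by (auto simp: flow_h_def flow_bound_def intro!: add_nonneg_nonneg mult_nonneg_nonneg)
qed

lemma flow_bound_pos: "0 < flow_bound"
  using lam_pos gf_nonneg[of lam A] by (auto simp: flow_bound_def intro!: add_pos_nonneg mult_nonneg_nonneg)

lemma flow_h_subharmonic:
  assumes "1 \<le> gf lam A"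
  shows "flow_h u \<le> lam * sum flow_h (children T u)"
proof (cases "u \<in> T \<and> prefix v0 u")
  case True
  then show ?thesis using flow_h_children[of u] assms by auto
next
  case False
  then have "flow_h u = 0" by (auto simp: flow_h_def)
  then show ?thesis using lam_pos flow_h_nonneg by (simp add: sum_nonneg)
qed

lemma esc_ge_flow_h:
  assumes "1 \<le> gf lam A" "lam < lam'"
  shows "(1 - lam / lam') * flow_h v / flow_bound \<le> esc T lam' v"
  by (rule esc_ge_flow)
     (use assms lam_pos flow_bound_pos flow_h_nonneg flow_h_le flow_h_outside flow_h_subharmonic in auto)

text \<open>One first code word suffices, as it lies at most \<open>m\<close> steps beyond
  \<open>u\<close>; this gives the uniform positivity needed in \<open>esc_le_flow\<close>.\<close>

lemma flow_h_code_ge: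
  assumes "z \<in> first_codes u" "u \<in> T" "prefix v0 u"
  shows "(min 1 lam) ^ m \<le> flow_h u"
proof -
  have "length z - length u \<le> m" using first_codes_length[OF assms(1,3)] by linarith
  then have "(min 1 lam) ^ m \<le> (min 1 lam) ^ (length z - length u)"
    using lam_pos by (intro power_decreasing) auto
  also have "\<dots> \<le> lam ^ (length z - length u)" using lam_pos by (intro power_mono) auto
  also have "\<dots> \<le> (\<Sum>z\<in>first_codes u. lam ^ (length z - length u))"
    using assms finite_first_codes lam_pos by (intro member_le_sum) auto
  finally show ?thesis using assms by (simp add: flow_h_def)
qed

lemma first_codes_exists:
  assumes "code z" "prefix u z" "prefix v0 u"
  shows "first_codes u \<noteq> {}"
  using assms(1,2)
proof (induction rule: rtranclp_induct)
  case base
  then have "u = v0" using assms(3) prefix_order.antisym by blast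
  then have "v0 \<in> first_codes u"
    using stepR_length[OF Nil_A] by (fastforce simp: first_codes_def dest: prefix_length_le)
  then show ?case by blast
next
  case (step y z)
  then show ?case
  proof (cases "prefix u y")
    case False
    then have "z \<in> first_codes u"
      using step code_child[OF step.hyps] unique_parent by (auto simp: first_codes_def)
    then show ?thesis by blast
  qed auto
qed

lemma flow_h_v0: "flow_h v0 = 1"
proof -
  have "first_codes v0 = {v0}"
  proof (intro equalityI subsetI)
    fix z assume z: "z \<in> first_codes v0"
    show "z \<in> {v0}"
    proof (rule ccontr)
      assume "z \<notin> {v0}"
      then obtain y where "code y" "stepR A y z" using code_parent z by (auto simp: first_codes_def)
      then show False using z prefix_code by (auto simp: first_codes_def)
    qed
  next
    fix z assume "z \<in> {v0}"
    then show "z \<in> first_codes v0"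
      using stepR_length[OF Nil_A] by (fastforce simp: first_codes_def dest: prefix_length_le)
  qed
  then show ?thesis by (simp add: flow_h_def v0_T)
qed

end


section \<open>The self-avoiding tree and the good trees\<close>

lemma is_bridge_walk: "is_bridge (walk p s) \<longleftrightarrow> bridge s"
proof -
  have "length s \<ge> 1 \<longleftrightarrow> s \<noteq> []" by (cases s) auto
  then show ?thesis
    by (auto simp: is_bridge_def bridge_def saw_walk walk_length_def nth_walk ht_take)
       (auto simp: ht_def)
qed

lemma irreducible_bridge_walk: "irreducible_bridge (walk p s) \<longleftrightarrow> irr s"
proof -
  have "(\<exists>i\<in>{1..<length s}. is_bridge (take (Suc i) (walk p s)) \<and> is_bridge (drop i (walk p s)))
    \<longleftrightarrow> (\<exists>i\<in>{1..<length s}. bridge (take i s) \<and> bridge (drop i s))"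
    by (intro bex_cong refl) (simp add: take_walk drop_walk is_bridge_walk)
  then show ?thesis by (simp add: irreducible_bridge_def irr_def is_bridge_walk walk_length_def)
qed

lemma bridge_half: "bridge s \<Longrightarrow> half s"
  by (simp add: bridge_def half_def)

lemma half_take: "half s \<Longrightarrow> half (take i s)"
  by (auto simp: half_def saw_steps_take min_def)

text \<open>The only neighbour of \<open>ast\<close> is the origin, and by self-avoidance
  \<open>ast\<close> is never revisited; so membership in the tree means staying strictly above the
  starting height.\<close>

lemma saw_tree_eq: "saw_tree = walk ast ` {s. half s}"
proof (intro equalityI subsetI)
  fix w assume w: "w \<in> saw_tree"
  then have sa: "w \<noteq> []" "successively ext_half_plane_adj w" "distinct w" "hd w = ast"
    by (auto simp: saw_tree_def self_avoiding_walk_def)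
  then obtain s where s: "w = walk ast s" using walk_exists by metis
  have "ext_half_plane_adj u v \<Longrightarrow> lattice_adj u v" for u v
    by (auto simp: ext_half_plane_adj_def lattice_adj_def ast_def)
  then have "successively lattice_adj w" using sa(2) successively_mono by blast
  then have saw: "saw_steps s" using sa saw_walk[of ast s] by (simp add: self_avoiding_walk_def s)
  have "0 < ht (take i s)" if i: "i \<in> {1..length s}" for i
  proof -
    have "w ! i \<noteq> w ! 0" using sa(3) i by (simp add: s nth_eq_iff_index_eq)
    moreover have "w ! 0 = ast" using sa by (simp add: hd_conv_nth)
    moreover have "ext_half_plane_adj (w ! (i - 1)) (w ! Suc (i - 1))"
      by (rule successively_nth[OF sa(2)]) (use i s in auto)
    ultimately have "w ! i \<in> half_plane"
      using i by (auto simp: ext_half_plane_adj_def half_plane_def)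
    then show ?thesis using i by (simp add: s nth_walk half_plane_def ht_take ast_def)
  qed
  then show "w \<in> walk ast ` {s. half s}" using s saw by (auto simp: half_def)
next
  fix w assume "w \<in> walk ast ` {s. half s}"
  then obtain s where s: "w = walk ast s" "half s" by auto
  have la: "successively lattice_adj w" and d: "distinct w"
    using saw_walk[of ast s] s by (auto simp: half_def self_avoiding_walk_def)
  have hp: "w ! i \<in> half_plane" if "1 \<le> i" "i \<le> length s" for i
    using s that by (auto simp: half_def nth_walk half_plane_def ht_take ast_def)
  have "successively ext_half_plane_adj w"
    unfolding successively_conv_nth
  proof (intro allI impI)
    fix i assume i: "Suc i < length w"
    have l: "lattice_adj (w ! i) (w ! Suc i)" using successively_nth[OF la i] .
    show "ext_half_plane_adj (w ! i) (w ! Suc i)"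
    proof (cases i)
      case 0
      have "w ! 0 = ast" using s by (simp add: nth_walk)
      moreover have "w ! 1 \<in> half_plane" using hp[of 1] i s 0 Suc_leI[of 0 "length s"] by simp
      ultimately have "w ! 1 = (0, 0)"
        using l 0 by (cases "w ! 1") (auto simp: lattice_adj_def half_plane_def ast_def abs_if split: if_splits)
      then show ?thesis using 0 \<open>w ! 0 = ast\<close> by (simp add: ext_half_plane_adj_def)
    next
      case (Suc j)
      then show ?thesis using l hp[of i] hp[of "Suc i"] i s by (simp add: ext_half_plane_adj_def)
    qed
  qed
  then show "w \<in> saw_tree" using s d by (simp add: saw_tree_def self_avoiding_walk_def)
qed

lemma walk_in_saw_tree: "walk ast s \<in> saw_tree \<longleftrightarrow> half s"
  by (auto simp: saw_tree_eq walk_inj)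

lemma saw_tree_take: "w \<in> saw_tree \<Longrightarrow> take (Suc i) w \<in> saw_tree"
  by (auto simp: saw_tree_eq take_walk half_take)

lemma saw_tree_prefix:
  assumes "w \<in> saw_tree" "prefix v w" "v \<noteq> []"
  shows "v \<in> saw_tree"
proof -
  have "v = take (Suc (length v - 1)) w" using assms by (auto simp: prefix_def)
  then show ?thesis using saw_tree_take[OF assms(1)] by metis
qed

lemma saw_tree_hd: "w \<in> saw_tree \<Longrightarrow> w \<noteq> [] \<and> hd w = ast"
  by (auto simp: saw_tree_eq)

lemma finite_saw_children: "finite (children saw_tree x)"
proof -
  have "children saw_tree x \<subseteq> (\<lambda>d. x @ [last x + d]) ` dirs \<union> {[ast]}"
  proof
    fix y assume y: "y \<in> children saw_tree x"
    then obtain v where v: "y = x @ [v]" "y \<in> saw_tree" by (auto simp: children_def)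
    show "y \<in> (\<lambda>d. x @ [last x + d]) ` dirs \<union> {[ast]}"
    proof (cases "x = []")
      case True then show ?thesis using v saw_tree_hd by force
    next
      case False
      obtain s where s: "y = walk ast s" "half s" using v by (auto simp: saw_tree_eq)
      then have "successively lattice_adj y" using saw_walk[of ast s] by (simp add: half_def self_avoiding_walk_def)
      then have "lattice_adj (last x) v" using v False by (simp add: successively_append_iff)
      then have "v - last x \<in> dirs" by (simp add: lattice_adj_iff)
      then show ?thesis using v by (intro UnI1 image_eqI[of _ _ "v - last x"]) auto
    qed
  qed
  then show ?thesis by (rule finite_subset) simp
qed

lemma finite_children_subset: "T \<subseteq> saw_tree \<Longrightarrow> finite (children T x)"
  by (rule finite_subset[OF _ finite_saw_children[of x]]) (auto simp: children_def)

lemma half_up: "half [(0, 1)]"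
  using irr_up irr_bridge bridge_half by blast

interpretation saw: walk_tree saw_tree ast
proof
  have "walk ast [] \<in> saw_tree" unfolding walk_in_saw_tree by (simp add: half_def)
  then show "[ast] \<in> saw_tree" by simp
  have "walk ast [(0, 1)] \<in> saw_tree" unfolding walk_in_saw_tree by (rule half_up)
  then show "children saw_tree [ast] \<noteq> {}" by (auto simp: children_def)
  show "butlast w \<in> saw_tree" if "w \<in> saw_tree" "w \<noteq> [ast]" for w
  proof (rule saw_tree_prefix[OF that(1) prefixeq_butlast])
    show "butlast w \<noteq> []" using that saw_tree_hd[of w] by (cases w) (auto split: if_splits)
  qed
qed (use saw_tree_hd finite_saw_children in auto)

section \<open>Code words of the good trees: finite concatenations of short irreducible
  bridges\<close>

abbreviation gcode :: "nat \<Rightarrow> point list \<Rightarrow> bool" where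
  "gcode m \<equiv> (stepR (irr_le m))\<^sup>*\<^sup>* [ast]"

lemma gcode_steps: "gcode m z \<Longrightarrow> \<exists>s. z = walk ast s \<and> (s = [] \<or> bridge s)"
proof (induction rule: rtranclp_induct)
  case base
  then show ?case by (intro exI[of _ "[]"]) simp
next
  case (step y z)
  then obtain a s where "y = walk ast a" "a = [] \<or> bridge a" "z = ext y s" "irr s"
    by (auto simp: stepR_def)
  then show ?case
    using bridge_append irr_bridge by (intro exI[of _ "a @ s"]) (auto simp: ext_walk)
qed

lemma gcode_saw: "gcode m z \<Longrightarrow> z \<in> saw_tree"
proof -
  assume "gcode m z"
  then obtain s where s: "z = walk ast s" "s = [] \<or> bridge s" using gcode_steps by blast
  then have "half s" using bridge_half by (auto simp: half_def)
  then show ?thesis using s walk_in_saw_tree by simp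
qed

lemma gcode_mono:
  assumes "m \<le> n" "gcode m z"
  shows "gcode n z"
proof -
  have "stepR (irr_le m) \<le> stepR (irr_le n)"
  proof (rule predicate2I)
    fix x y assume "stepR (irr_le m) x y"
    then obtain s where "s \<in> irr_le m" "y = ext x s" unfolding stepR_def by blast
    then show "stepR (irr_le n) x y" unfolding stepR_def using assms(1) by (intro bexI[of _ s]) auto
  qed
  then show ?thesis using assms(2) rtranclp_mono by blast
qed

lemma Nil_irr: "[] \<notin> irr_le m"
  by (auto dest!: irr_bridge bridge_ne)

text \<open>The mirror of \<open>irr_append_unique\<close>, cutting at the end: a surplus
  \<open>u\<close> of the longer initial part has its lower bound from the bridge \<open>s\<close>
  and its upper bound from the bridge \<open>a'\<close>, so it would split \<open>s\<close>.\<close>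

lemma gcode_unique_parent:
  assumes y: "gcode m y" "gcode m' y'" and s: "stepR (irr_le m) y z" "stepR (irr_le m') y' z"
  shows "y = y'"
proof -
  have aux: "length a \<ge> length a'"
    if a': "a' = [] \<or> bridge a'" and s: "irr s" "irr s'" and eq: "a @ s = a' @ s'" for a s a' s'
  proof (rule ccontr)
    assume "\<not> length a' \<le> length a"
    then obtain u where u: "a' = a @ u" "s = u @ s'" "u \<noteq> []"
      using eq by (auto simp: append_eq_append_conv2)
    then have ba: "bridge a'" using a' by auto
    have "bridge u"
      unfolding bridge_def
    proof (intro conjI ballI)
      show "saw_steps u" using bridge_saw[OF ba] u saw_steps_appendD(2) by blast
      fix i assume i: "i \<in> {1..length u}"
      show "0 < ht (take i u)"
        using ht_take_bridge[OF irr_bridge[OF s(1)], of i] i u by simp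
      have "ht (take (length a + i) a') \<le> ht a'"
        using ht_take_bridge[OF ba, of "length a + i"] i u by auto
      then show "ht (take i u) \<le> ht u" by (simp add: u ht_append)
    qed fact
    moreover have "bridge s'" using s irr_bridge by blast
    moreover have "length u \<in> {1..<length s}"
      using u bridge_ne[OF \<open>bridge s'\<close>] by (cases u) auto
    ultimately show False using s(1) u unfolding irr_def by (metis append_eq_conv_conj)
  qed
  obtain a a' where a: "y = walk ast a" "a = [] \<or> bridge a" "y' = walk ast a'" "a' = [] \<or> bridge a'"
    using gcode_steps y by blast
  obtain s s' where ss: "irr s" "irr s'" "z = ext y s" "z = ext y' s'" using s by (auto simp: stepR_def)
  then have eq: "a @ s = a' @ s'" using a by (simp add: ext_walk walk_inj)
  have "length a = length a'"
    using aux[OF a(4) ss(1,2) eq] aux[OF a(2) ss(2,1) eq[symmetric]] by simp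
  then show ?thesis using a eq by simp
qed

lemma segment_initial_walk: "n \<le> n' \<Longrightarrow> map p [n..<Suc n'] = drop n (initial_walk p n')"
  by (simp add: initial_walk_def drop_map del: upt_Suc)

lemma prefix_initial_walk: "n \<le> n' \<Longrightarrow> prefix (initial_walk p n) (initial_walk p n')"
proof -
  assume "n \<le> n'"
  then have "initial_walk p n = take (Suc n) (initial_walk p n')"
    by (simp add: initial_walk_def take_map del: upt_Suc)
  then show ?thesis by (metis take_is_prefix)
qed

lemma initial_walk_ne [simp]: "initial_walk p n \<noteq> []"
  by (simp add: initial_walk_def)

lemma good_path_codes:
  assumes "good_path m p"
  shows "\<exists>t :: nat \<Rightarrow> nat. strict_mono t \<and> (\<forall>i. gcode m (initial_walk p (t i)))"
proof -
  obtain t where t: "strict_mono t" "t 0 = 0"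
    "\<And>i. irreducible_bridge (map p [t i..<Suc (t (Suc i))])" "\<And>i. t (Suc i) - t i \<le> m"
    using assms by (auto simp: good_path_def)
  have "gcode m (initial_walk p (t i))" for i
  proof (induction i)
    case 0
    have "initial_walk p 0 \<in> saw_tree" using assms by (simp add: good_path_def)
    then have "initial_walk p 0 = [ast]" using saw_tree_hd[of "initial_walk p 0"] by (simp add: initial_walk_def)
    then show ?case using t by simp
  next
    case (Suc i)
    have lt: "t i < t (Suc i)" using t(1) by (simp add: strict_mono_less)
    let ?y = "initial_walk p (t i)" and ?z = "initial_walk p (t (Suc i))"
    obtain s where s: "?z = ext ?y s"
      using prefix_ext_exists[OF initial_walk_ne prefix_initial_walk[of "t i" "t (Suc i)" p]] lt by auto
    have "map p [t i..<Suc (t (Suc i))] = drop (length ?y - 1) ?z"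
      using lt by (simp add: segment_initial_walk del: upt_Suc)
    also have "\<dots> = walk (last ?y) s" unfolding s by (rule drop_ext) simp
    finally have "irr s" using t(3)[of i] by (simp add: irreducible_bridge_walk)
    moreover have "length s \<le> m" using t(4)[of i] arg_cong[OF s, of length] lt by simp
    ultimately have "stepR (irr_le m) ?y ?z" using s by (auto simp: stepR_def)
    then show ?case using Suc by (rule rtranclp.rtrancl_into_rtrancl[rotated])
  qed
  then show ?thesis using t(1) by blast
qed

text \<open>A code word is continued forever by single upward steps, each an irreducible bridge of
  length 1.\<close>

lemma gcode_good_path:
  assumes z: "gcode m z" and m: "m \<ge> 1"
  obtains p where "good_path m p" "z = initial_walk p (length z - 1)"
proof -
  let ?up = "\<lambda>k. replicate k (0 :: int, 1 :: int)" and ?R = "stepR (irr_le m)"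
  define E where "E k = ext z (?up k)" for k
  have z_ne: "z \<noteq> []" using gcode_saw[OF z] saw_tree_hd by blast
  have lE: "length (E k) = length z + k" for k by (simp add: E_def)
  have E_Suc: "?R (E k) (E (Suc k))" for k
  proof -
    have "E (Suc k) = ext (E k) [(0, 1)]"
      using z_ne by (simp add: E_def ext_ext replicate_append_same)
    then show ?thesis using irr_up m by (auto simp: stepR_def)
  qed
  have E_trans: "?R\<^sup>*\<^sup>* (E k) (E k')" if "k \<le> k'" for k k'
    using that
  proof (induction k' rule: dec_induct)
    case (step k')
    show ?case by (rule rtranclp.rtrancl_into_rtrancl[OF step.IH E_Suc])
  qed (rule rtranclp.rtrancl_refl)
  have E_code: "gcode m (E k)" for k
  proof -
    have "E 0 = z" by (simp add: E_def)
    then have "?R\<^sup>*\<^sup>* z (E k)" using E_trans[of 0 k] by simp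
    then show ?thesis using z by (rule rtranclp_trans[rotated])
  qed
  have R_prefix: "prefix x y" if "?R\<^sup>*\<^sup>* x y" for x y
    using that
  proof (induction rule: rtranclp_induct)
    case (step y z)
    show ?case by (rule prefix_order.trans[OF step.IH stepR_length(2)[OF Nil_irr step.hyps(2)]])
  qed (rule prefix_order.refl)
  define p where "p i = E (Suc i) ! i" for i
  have p: "p i = E k ! i" if "i < length z + k" for i k
  proof -
    have *: "E a ! i = E b ! i" if "a \<le> b" "i < length z + a" for a b
      using R_prefix[OF E_trans[OF that(1)]] that(2) lE by (auto simp: prefix_def nth_append)
    show ?thesis
    proof (cases "Suc i \<le> k")
      case True
      show ?thesis unfolding p_def by (rule *[OF True]) simp
    next
      case False
      then have "k \<le> Suc i" by simp
      then show ?thesis unfolding p_def by (rule *[OF _ that, symmetric])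
    qed
  qed
  have iw: "initial_walk p n = take (Suc n) (E k)" if "n < length z + k" for n k
  proof (rule nth_equalityI)
    fix i assume "i < length (initial_walk p n)"
    then have "i < Suc n" by (simp add: initial_walk_def)
    then show "initial_walk p n ! i = take (Suc n) (E k) ! i"
      using p[of i k] that by (simp add: initial_walk_def nth_map[of i "[0..<Suc n]"] del: upt_Suc)
  qed (use that lE in \<open>simp add: initial_walk_def\<close>)
  have saw: "initial_walk p n \<in> saw_tree" for n
    using iw[of n "Suc n"] saw_tree_take[OF gcode_saw[OF E_code]] by simp
  let ?C = "\<lambda>n. \<exists>k. ?R\<^sup>*\<^sup>* (initial_walk p n) (E k)"
  have len: "length (initial_walk p n) = Suc n" for n by (simp add: initial_walk_def)
  have next_time: "\<exists>n'. ?C n' \<and> n < n' \<and> n' - n \<le> m \<and> irreducible_bridge (map p [n..<Suc n'])" if Cn: "?C n" for n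
  proof -
    obtain k where k: "?R\<^sup>*\<^sup>* (initial_walk p n) (E k)" using Cn by blast
    \<comment> \<open>Taken large enough that the target lies strictly beyond the current word, so
      the chain of code steps towards it is nonempty and its first step is the next bridge.\<close>
    define k' where "k' = max k (Suc n)"
    have star: "?R\<^sup>*\<^sup>* (initial_walk p n) (E k')"
      using k E_trans[of k k'] by (simp add: k'_def)
    have ne: "initial_walk p n \<noteq> E k'"
    proof
      assume "initial_walk p n = E k'"
      then have "Suc n = length z + k'" using len lE by metis
      then show False using z_ne by (cases z) (auto simp: k'_def)
    qed
    obtain y where y: "?R (initial_walk p n) y" "?R\<^sup>*\<^sup>* y (E k')"
      using star
    proof (cases rule: converse_rtranclpE)
      case base
      then show ?thesis using ne by simp
    next
      case (step y)
      then show ?thesis by (rule that)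
    qed
    obtain s where s: "irr s" "length s \<le> m" "y = ext (initial_walk p n) s" using y(1) by (auto simp: stepR_def)
    have s_ne: "s \<noteq> []" using s bridge_ne irr_bridge by blast
    define n' where "n' = n + length s"
    have ly: "length y = Suc n'" using s by (simp add: n'_def len)
    have "y = take (length y) (E k')" "length y \<le> length z + k'"
      using R_prefix[OF y(2)] lE[of k'] prefix_length_le[of y "E k'"] by (auto simp: prefix_def)
    then have yiw: "y = initial_walk p n'" using iw[of n' k'] ly by simp
    have "map p [n..<Suc n'] = drop (length (initial_walk p n) - 1) y"
      using segment_initial_walk[of n n' p] yiw by (simp add: n'_def len)
    also have "\<dots> = walk (last (initial_walk p n)) s" unfolding s(3) by (rule drop_ext) simp
    finally have "irreducible_bridge (map p [n..<Suc n'])" using s by (simp add: irreducible_bridge_walk)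
    moreover have "?C n'" using y(2) yiw by auto
    ultimately show ?thesis using s s_ne by (intro exI[of _ n']) (auto simp: n'_def)
  qed
  have C0: "?C 0"
  proof -
    have "initial_walk p 0 = [ast]"
      using saw_tree_hd[OF saw[of 0]] by (auto simp: initial_walk_def)
    moreover have "E 0 = z" by (simp add: E_def)
    ultimately show ?thesis using z by metis
  qed
  have "\<exists>t. \<forall>i. (?C (t i) \<and> (i = 0 \<longrightarrow> t i = 0)) \<and>
      (t i < t (Suc i) \<and> t (Suc i) - t i \<le> m \<and> irreducible_bridge (map p [t i..<Suc (t (Suc i))]))"
    by (rule dependent_nat_choice) (use C0 next_time in \<open>auto simp del: upt_Suc\<close>)
  then obtain t where t: "t 0 = 0" "\<And>i. t i < t (Suc i)" "\<And>i. t (Suc i) - t i \<le> m"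
    "\<And>i. irreducible_bridge (map p [t i..<Suc (t (Suc i))])" by blast
  have "strict_mono t" using t(2) by (simp add: strict_mono_Suc_iff)
  then have "good_path m p" unfolding good_path_def using saw t by blast
  moreover have "z = initial_walk p (length z - 1)"
  proof -
    have "E 0 = z" by (simp add: E_def)
    then show ?thesis using iw[of "length z - 1" 0] z_ne by simp
  qed
  ultimately show ?thesis using that by blast
qed

text \<open>Removes infinite paths from the description of the good tree, leaving prefixes of finite
  code words.\<close>

lemma good_tree_iff:
  assumes m: "m \<ge> 1"
  shows "w \<in> good_tree m \<longleftrightarrow> w \<noteq> [] \<and> (\<exists>z. gcode m z \<and> prefix w z)"
proof
  assume "w \<in> good_tree m"
  then obtain p n where p: "good_path m p" "w = initial_walk p n" by (auto simp: good_tree_def)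
  obtain t :: "nat \<Rightarrow> nat" where t: "strict_mono t" "\<And>i. gcode m (initial_walk p (t i))"
    using good_path_codes[OF p(1)] by blast
  have "prefix w (initial_walk p (t n))"
    unfolding p(2) by (rule prefix_initial_walk[OF strict_mono_imp_increasing[OF t(1)]])
  then show "w \<noteq> [] \<and> (\<exists>z. gcode m z \<and> prefix w z)" using t(2)[of n] p by auto
next
  assume "w \<noteq> [] \<and> (\<exists>z. gcode m z \<and> prefix w z)"
  then obtain z where z: "w \<noteq> []" "gcode m z" "prefix w z" by blast
  obtain p where p: "good_path m p" "z = initial_walk p (length z - 1)"
    by (rule gcode_good_path[OF z(2) m])
  have lw: "1 \<le> length w" "length w \<le> length z" using z by (auto simp: Suc_le_eq dest: prefix_length_le)
  have "prefix (initial_walk p (length w - 1)) z"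
    by (subst p(2), rule prefix_initial_walk) (use lw in simp)
  moreover have l: "length w = length (initial_walk p (length w - 1))"
    using lw by (simp add: initial_walk_def)
  ultimately have "prefix w (initial_walk p (length w - 1))"
    using z(3) prefix_length_prefix by (metis order_refl)
  then have "w = initial_walk p (length w - 1)" using l by (rule saw.prefix_same_length)
  moreover have "w \<in> saw_tree" using saw_tree_prefix[OF gcode_saw[OF z(2)] z(3,1)] .
  ultimately show "w \<in> good_tree m" using p(1) by (auto simp: good_tree_def)
qed

lemma good_tree_subset: "good_tree m \<subseteq> saw_tree"
  by (auto simp: good_tree_def)

lemma good_tree_mono:
  assumes "1 \<le> m" "m \<le> n"
  shows "good_tree m \<subseteq> good_tree n"
  using good_tree_iff assms gcode_mono by (meson le_trans subsetI)

lemma good_walk_tree: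
  assumes m: "m \<ge> 1"
  shows "walk_tree (good_tree m) ast"
proof
  show "[ast] \<in> good_tree m" unfolding good_tree_iff[OF m] by blast
  have "stepR (irr_le m) [ast] (ext [ast] [(0, 1)])" using irr_up m by (auto simp: stepR_def)
  then have "ext [ast] [(0, 1)] \<in> good_tree m" unfolding good_tree_iff[OF m] by (auto simp: ext_def)
  then show "children (good_tree m) [ast] \<noteq> {}" by (auto simp: children_def ext_def)
  show "w \<noteq> [] \<and> hd w = ast" if "w \<in> good_tree m" for w
    using that good_tree_subset saw_tree_hd by blast
  show "butlast w \<in> good_tree m" if w: "w \<in> good_tree m" "w \<noteq> [ast]" for w
  proof -
    have "butlast w \<noteq> []"
      using w good_tree_subset saw_tree_hd[of w] by (cases w) (auto split: if_splits)
    then show ?thesis using w unfolding good_tree_iff[OF m]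
      using prefixeq_butlast prefix_order.trans by blast
  qed
  show "finite (children (good_tree m) x)" for x
    by (rule finite_children_subset[OF good_tree_subset])
qed

lemma good_code_tree:
  assumes m: "m \<ge> 1"
  shows "code_tree (good_tree m) ast [ast] (irr_le m) m (zc m)"
proof -
  interpret walk_tree "good_tree m" ast by (rule good_walk_tree[OF m])
  show ?thesis
  proof
    show "z \<in> good_tree m" if "gcode m z" for z
      using that gcode_saw saw_tree_hd unfolding good_tree_iff[OF m] by blast
    show "y = y'" if "gcode m y" "gcode m y'" "stepR (irr_le m) y z" "stepR (irr_le m) y' z" for y y' z
      using gcode_unique_parent that by blast
  qed (use root_in Nil_irr zc[OF m] in auto)
qed


section \<open>Regeneration along straight segments\<close>

text \<open>Code steps depend only on the appended steps, so a chain can be transplanted to any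
  starting word.\<close>

lemma rtranclp_ext:
  assumes "(stepR A)\<^sup>*\<^sup>* x z" "x \<noteq> []" "w \<noteq> []"
  shows "\<exists>s. z = ext x s \<and> (stepR A)\<^sup>*\<^sup>* w (ext w s)"
  using assms(1)
proof (induction rule: rtranclp_induct)
  case base
  show ?case by (intro exI[of _ "[]"]) simp
next
  case (step y z)
  then obtain s where "y = ext x s" "(stepR A)\<^sup>*\<^sup>* w (ext w s)" by blast
  moreover obtain b where "b \<in> A" "z = ext y b" using step.hyps(2) unfolding stepR_def by blast
  ultimately have s: "y = ext x s" "(stepR A)\<^sup>*\<^sup>* w (ext w s)" "b \<in> A" "z = ext y b" by simp_all
  then have "stepR A (ext w s) (ext w (s @ b))"
    using assms(3) by (auto simp: stepR_def ext_ext)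
  then have "(stepR A)\<^sup>*\<^sup>* w (ext w (s @ b))" using s(2) by (rule rtranclp.rtrancl_into_rtrancl[rotated])
  moreover have "z = ext x (s @ b)" using s assms(2) by (simp add: ext_ext)
  ultimately show ?case by blast
qed

lemma gcode_prepend:
  assumes "gcode m w" "gcode m (ext [ast] x)"
  shows "gcode m (ext w x)"
proof -
  have "w \<noteq> []" using gcode_saw[OF assms(1)] saw_tree_hd by blast
  then obtain s where "ext [ast] x = ext [ast] s" "(stepR (irr_le m))\<^sup>*\<^sup>* w (ext w s)"
    using rtranclp_ext[OF assms(2), of w] by auto
  then show ?thesis using assms(1) by (simp add: ext_inj)
qed

abbreviation ups :: "nat \<Rightarrow> point list" where "ups k \<equiv> replicate k (0, 1)"

lemma gcode_ups: "m \<ge> 1 \<Longrightarrow> gcode m (ext [ast] (ups k))"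
proof (induction k)
  case (Suc k)
  have "stepR (irr_le m) (ext [ast] (ups k)) (ext [ast] (ups (Suc k)))"
    unfolding stepR_def using irr_up Suc.prems
    by (intro bexI[of _ "[(0, 1)]"]) (auto simp: ext_ext replicate_append_same)
  then show ?case using Suc by (meson rtranclp.rtrancl_into_rtrancl)
qed simp

lemma bridge_ups: "k \<ge> 1 \<Longrightarrow> bridge (ups k)"
proof -
  assume "k \<ge> 1"
  moreover have "ht (ups i) = int i" for i by (induction i) (auto simp: ht_def)
  ultimately show ?thesis by (auto simp: bridge_def saw_steps_straight)
qed

text \<open>
  An irreducible bridge of length at most \<open>m\<close> that contains the end of a code word \<open>w\<close> in its
  interior and is followed by a vertical segment there could be cut at the end of \<open>w\<close>.
\<close>

lemma gcode_regenerate: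
  assumes w: "gcode m w" and z: "gcode m z" and zx: "z = ext w x"
    and x: "prefix (ups m) x \<or> prefix x (ups m)"
  shows "gcode m (ext [ast] x)"
  using z zx x
proof (induction arbitrary: x rule: rtranclp_induct)
  case base
  then have "x = []" using gcode_saw[OF w] saw_tree_hd[of w]
    by (metis length_ext length_0_conv length_Cons add_is_1 list.size(3) One_nat_def)
  then show ?case by simp
next
  case (step y z)
  have w_ne: "w \<noteq> []" and y_ne: "y \<noteq> []" using gcode_saw w step.hyps(1) saw_tree_hd by blast+
  obtain b where b: "irr b" "length b \<le> m" "z = ext y b" using step.hyps(2) by (auto simp: stepR_def)
  show ?case
  proof (cases "prefix w y")
    case True
    then obtain x' where x': "y = ext w x'" using prefix_ext_exists w_ne by blast
    then have xe: "x = x' @ b" using step.prems(1) b(3) w_ne by (simp add: ext_ext ext_inj)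
    then have "prefix (ups m) x' \<or> prefix x' (ups m)"
      using step.prems(2) by (metis prefixI prefix_order.trans prefix_same_cases)
    then have "gcode m (ext [ast] x')" using step.IH x' by blast
    moreover have "stepR (irr_le m) (ext [ast] x') (ext [ast] x)"
      unfolding xe stepR_def using b by (intro bexI[of _ b]) (auto simp: ext_ext)
    ultimately show ?thesis by (rule rtranclp.rtrancl_into_rtrancl)
  next
    case False
    show ?thesis
    proof (cases "x = []")
      case x_ne: False
      have "prefix w z" unfolding step.prems(1) by (rule prefix_ext)
      moreover have "prefix y z" unfolding b(3) by (rule prefix_ext)
      ultimately have "prefix y w" using False prefix_same_cases by blast
      then obtain c where c: "w = ext y c" using prefix_ext_exists y_ne by blast
      then have be: "b = c @ x" using step.prems(1) b(3) y_ne by (simp add: ext_ext ext_inj)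
      have c_ne: "c \<noteq> []" using False c by auto
      have "length x < m" using be b(2) c_ne by (cases c) auto
      then have "prefix x (ups m)" using step.prems(2) prefix_length_le by fastforce
      then have "x = ups (length x)" by (metis prefix_def append_eq_conv_conj length_append
            take_replicate min.absorb1 le_add1 length_replicate)
      then have bx: "bridge x" using bridge_ups[of "length x"] x_ne by (cases x) auto
      have "bridge c"
      proof -
        obtain a where a: "y = walk ast a" using gcode_steps step.hyps(1) by blast
        obtain a' where a': "w = walk ast a'" "a' = [] \<or> bridge a'" using gcode_steps w by blast
        have "a' = a @ c" using c a a'(1) by (simp add: ext_walk walk_inj)
        then have ba: "bridge (a @ c)" using a' c_ne by auto
        show ?thesis
          unfolding bridge_def
        proof (intro conjI ballI)
          show "saw_steps c" using bridge_saw[OF ba] saw_steps_appendD(2) by blast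
          fix i assume i: "i \<in> {1..length c}"
          show "0 < ht (take i c)" using ht_take_bridge[OF irr_bridge[OF b(1)], of i] i be by simp
          show "ht (take i c) \<le> ht c"
            using ht_take_bridge[OF ba, of "length a + i"] i by (simp add: ht_append)
        qed fact
      qed
      moreover have "length c \<in> {1..<length b}" using be c_ne x_ne by (cases c; cases x) auto
      ultimately have False using b(1) bx be unfolding irr_def by (metis append_eq_conv_conj)
      then show ?thesis ..
    qed simp
  qed
qed

text \<open>After \<open>m\<close> upward steps the tree has no memory of the code word below; this
  is the source of the isomorphic subtrees.\<close>

lemma gcode_regenerate_iff:
  assumes w: "gcode m w"
  shows "gcode m (ext w (ups m @ s)) \<longleftrightarrow> gcode m (ext [ast] (ups m @ s))"
  using gcode_regenerate[OF w _ refl] gcode_prepend[OF w] by auto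


section \<open>Escape probabilities of isomorphic subtrees\<close>

lemma ext_single: "x \<noteq> [] \<Longrightarrow> ext x [d] = x @ [last x + d]"
  by (simp add: ext_def)

lemma children_ext:
  assumes "x \<noteq> []"
  shows "children T x = (\<lambda>d. ext x [d]) ` {d. ext x [d] \<in> T}"
proof (intro equalityI subsetI)
  fix y assume "y \<in> children T x"
  then obtain v where "y = x @ [v]" "y \<in> T" by (auto simp: children_def)
  then show "y \<in> (\<lambda>d. ext x [d]) ` {d. ext x [d] \<in> T}"
    using assms by (intro image_eqI[of _ _ "v - last x"]) (auto simp: ext_single)
qed (use assms in \<open>auto simp: children_def ext_single\<close>)

lemma inj_ext_single: "inj_on (\<lambda>d. ext x [d]) D"
  by (auto simp: inj_on_def ext_inj)

text \<open>A subsolution below \<open>u\<close> is transported step by step to the subtree of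
  \<open>u'\<close>, where further children only help.\<close>

lemma esc_embed:
  assumes u: "u \<noteq> []" "u' \<noteq> []" and emb: "\<And>s. ext u s \<in> T \<Longrightarrow> ext u' s \<in> T"
    and fin: "\<And>x. finite (children T x)" and lam: "lam \<ge> 0"
  shows "esc T lam u \<le> esc T lam u'"
proof (rule esc_leI)
  fix y assume y: "subsol T lam y"
  define y' where "y' x = (if prefix u' x then y (ext u (THE s. x = ext u' s)) else 0)" for x
  have y'_ext: "y' (ext u' s) = y (ext u s)" for s
  proof -
    have "(THE t. ext u' s = ext u' t) = s" by (rule the_equality) (auto simp: ext_inj)
    then show ?thesis by (simp add: y'_def prefix_ext)
  qed
  have y'_nn: "0 \<le> y' x" for x using y by (auto simp: y'_def subsol_def)
  have "subsol T lam y'"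
    unfolding subsol_def
  proof (intro allI)
    fix x
    show "0 \<le> y' x \<and> y' x \<le> 1 \<and> (x \<notin> T \<longrightarrow> y' x = 0) \<and> y' x \<le> netf (lam * sum y' (children T x))"
    proof (cases "prefix u' x")
      case True
      then obtain s where s: "x = ext u' s" using prefix_ext_exists u by blast
      have ne: "ext u s \<noteq> []" "ext u' s \<noteq> []" using u by (auto simp: ext_def)
      let ?D = "{d. ext (ext u s) [d] \<in> T}" and ?D' = "{d. ext (ext u' s) [d] \<in> T}"
      have sub: "?D \<subseteq> ?D'" using emb u by (auto simp: ext_ext)
      have fD: "finite ?D'"
        using fin[of "ext u' s"] unfolding children_ext[OF ne(2)] by (rule finite_imageD[OF _ inj_ext_single])
      have "sum y (children T (ext u s)) = (\<Sum>d\<in>?D. y (ext (ext u s) [d]))"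
        unfolding children_ext[OF ne(1)] by (subst sum.reindex[OF inj_ext_single]) (simp add: o_def)
      also have "\<dots> = (\<Sum>d\<in>?D. y' (ext (ext u' s) [d]))"
        using u by (simp add: ext_ext y'_ext)
      also have "\<dots> \<le> (\<Sum>d\<in>?D'. y' (ext (ext u' s) [d]))"
        using y'_nn sub fD by (intro sum_mono2) auto
      also have "\<dots> = sum y' (children T x)"
        unfolding s children_ext[OF ne(2)] by (subst sum.reindex[OF inj_ext_single]) (simp add: o_def)
      finally have le: "sum y (children T (ext u s)) \<le> sum y' (children T x)" .
      have "y (ext u s) \<le> netf (lam * sum y (children T (ext u s)))" using y by (simp add: subsol_def)
      also have "\<dots> \<le> netf (lam * sum y' (children T x))"
        using le lam y by (intro netf_mono mult_left_mono mult_nonneg_nonneg sum_nonneg) (auto simp: subsol_def)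
      finally show ?thesis using y emb unfolding s y'_ext by (auto simp: subsol_def)
    next
      case False
      then have "y' x = 0" by (simp add: y'_def)
      then show ?thesis using netf_bounds(1) lam y'_nn by (simp add: sum_nonneg)
    qed
  qed
  then have "y' (ext u' []) \<le> esc T lam u'" using subsol_le_esc[of T lam y' u'] by simp
  then show "y u \<le> esc T lam u'" unfolding y'_ext by simp
qed


section \<open>The critical limit on a good tree\<close>

locale critical_good_tree =
  fixes m :: nat
  assumes m: "m \<ge> 1"
begin

abbreviation "T \<equiv> good_tree m"
abbreviation "z0 \<equiv> zc m"

sublocale code_tree T ast "[ast]" "irr_le m" m z0
  by (rule good_code_tree[OF m])

abbreviation "H \<equiv> flow_h"

definition c where "c = (min 1 z0) ^ m"
abbreviation "C \<equiv> flow_bound"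

lemma z0: "0 < z0" "gf z0 (irr_le m) = 1"
  using zc[OF m] by auto

lemma prefix_root: "u \<in> T \<Longrightarrow> prefix [ast] u"
  using hd_T[of u] by (cases u) auto

lemma H_harmonic: "u \<in> T \<Longrightarrow> z0 * sum H (children T u) = H u"
  using flow_h_children[of u] prefix_root z0 by simp

lemma first_codes_ne: "u \<in> T \<Longrightarrow> first_codes u \<noteq> {}"
  using first_codes_exists prefix_root good_tree_iff[OF m] by blast

lemma H_ge: "u \<in> T \<Longrightarrow> c \<le> H u"
proof -
  assume u: "u \<in> T"
  then obtain z where "z \<in> first_codes u" using first_codes_ne by blast
  then show ?thesis unfolding c_def by (rule flow_h_code_ge[OF _ u prefix_root[OF u]])
qed

lemma c_pos: "0 < c"
  using z0 by (simp add: c_def)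

lemma H_pos: "u \<in> T \<Longrightarrow> 0 < H u"
  using H_ge c_pos by (meson less_le_trans)

lemma esc_upper:
  assumes "0 \<le> lam"
  obtains M where "0 \<le> M" "\<And>v. v \<in> T \<Longrightarrow> esc T lam v \<le> M * H v"
    "M = 0 \<or> M * lam * c \<le> lam - z0"
proof -
  have ne: "T \<noteq> {}" using root_in by blast
  have super: "\<And>v. v \<in> T \<Longrightarrow> z0 * sum H (children T v) \<le> H v" by (simp add: H_harmonic)
  show ?thesis
    by (rule esc_le_flow[OF z0(1) assms c_pos ne H_ge super]) (assumption, assumption, rule that)
qed

lemma esc_subcritical:
  assumes "0 < lam" "lam \<le> z0" "v \<in> T"
  shows "esc T lam v = 0"
proof -
  obtain M where M: "0 \<le> M" "\<And>v. v \<in> T \<Longrightarrow> esc T lam v \<le> M * H v" "M = 0 \<or> M * lam * c \<le> lam - z0"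
    using esc_upper[of lam] assms by auto
  have "M = 0"
  proof (rule ccontr)
    assume ne: "M \<noteq> 0"
    then have "0 < M * lam * c" using M(1) assms c_pos by simp
    then show False using M(3) ne assms by linarith
  qed
  then show ?thesis using M(2)[OF assms(3)] by (simp add: order_antisym)
qed

lemma esc_supercritical:
  assumes "z0 < lam" "v \<in> T"
  shows "0 < esc T lam v"
proof -
  have "0 < (1 - z0 / lam) * H v / C"
    using assms z0 H_pos flow_bound_pos by simp
  also have "\<dots> \<le> esc T lam v" using esc_ge_flow_h[of lam v] assms z0 by simp
  finally show ?thesis .
qed

lemma lambda_crit_eq: "lambda_crit m = z0"
  unfolding lambda_crit_def critical_value_def
proof (rule the_equality)
  have rec: "RW_recurrent T [ast] lam \<longleftrightarrow> lam \<le> z0" if "lam > 0" for lam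
    unfolding RW_recurrent_iff[OF that]
    using esc_subcritical[OF that _ root_in] esc_supercritical[OF _ root_in, of lam] by (cases "lam \<le> z0") auto
  then show "0 \<le> z0 \<and> (\<forall>lam>0. (lam < z0 \<longrightarrow> RW_recurrent T [ast] lam) \<and> (z0 < lam \<longrightarrow> RW_transient T [ast] lam))"
    using z0 by (auto simp: RW_transient_def)
  fix b assume b: "0 \<le> b \<and> (\<forall>lam>0. (lam < b \<longrightarrow> RW_recurrent T [ast] lam) \<and> (b < lam \<longrightarrow> RW_transient T [ast] lam))"
  show "b = z0"
  proof (rule ccontr)
    assume "b \<noteq> z0"
    then consider "b < z0" | "z0 < b" by linarith
    then show False
    proof cases
      case 1
      \<comment> \<open>Strictly between two different candidates, or at \<open>z0\<close> itself
        from below, the walk would be both recurrent and transient; the midpoint is a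
        witness.\<close>
      then have p: "(b + z0) / 2 > 0" "b < (b + z0) / 2" "(b + z0) / 2 \<le> z0" using b z0 by auto
      then show False
        using b[THEN conjunct2, rule_format, OF p(1)] rec[OF p(1)] by (auto simp: RW_transient_def)
    next
      case 2
      then have p: "(b + z0) / 2 > 0" "(b + z0) / 2 < b" "\<not> (b + z0) / 2 \<le> z0" using b z0 by auto
      then show False using b[THEN conjunct2, rule_format, OF p(1)] rec[OF p(1)] by blast
    qed
  qed
qed

section \<open>A reference vertex whose subtree recurs near every vertex\<close>

definition \<tau> where "\<tau> = ext [ast] (ups m)"

lemma regen_in_T: "gcode m w \<Longrightarrow> gcode m (ext w (ups m))"
  using gcode_regenerate_iff[of m w "[]"] gcode_ups[OF m] by simp

lemma ext_in_T_iff: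
  assumes "w \<noteq> []"
  shows "ext w s \<in> T \<longleftrightarrow> (\<exists>t. gcode m (ext w (s @ t)))"
proof -
  have ne: "ext w s \<noteq> []" using assms by (simp add: ext_def)
  have "(\<exists>z. gcode m z \<and> prefix (ext w s) z) \<longleftrightarrow> (\<exists>t. gcode m (ext (ext w s) t))"
  proof
    assume "\<exists>z. gcode m z \<and> prefix (ext w s) z"
    then obtain z where z: "gcode m z" "prefix (ext w s) z" by blast
    then obtain t where "z = ext (ext w s) t" using prefix_ext_exists[OF ne] by blast
    then show "\<exists>t. gcode m (ext (ext w s) t)" using z(1) by blast
  next
    assume "\<exists>t. gcode m (ext (ext w s) t)"
    then obtain t where "gcode m (ext (ext w s) t)" by blast
    then show "\<exists>z. gcode m z \<and> prefix (ext w s) z" using prefix_ext by blast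
  qed
  then show ?thesis using ne assms unfolding good_tree_iff[OF m] by (simp add: ext_ext)
qed

lemma regen_esc:
  assumes w: "gcode m w" and lam: "lam \<ge> 0"
  shows "esc T lam (ext w (ups m)) = esc T lam \<tau>"
proof -
  have w_ne: "w \<noteq> []" using gcode_saw[OF w] saw_tree_hd by blast
  then have ne: "ext w (ups m) \<noteq> []" "\<tau> \<noteq> []" by (auto simp: ext_def \<tau>_def)
  have "ext (ext w (ups m)) s \<in> T \<longleftrightarrow> ext \<tau> s \<in> T" for s
    using gcode_regenerate_iff[OF w] w_ne unfolding \<tau>_def by (simp add: ext_ext ext_in_T_iff)
  then show ?thesis
    using esc_embed[OF ne _ finite_children lam] esc_embed[OF ne(2,1) _ finite_children lam]
    by (intro antisym) auto
qed

text \<open>The density beyond a regenerated vertex is a sum over step sequences; by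
  \<open>gcode_regenerate_iff\<close> the set of these sequences does not depend on
  \<open>w\<close>.\<close>

lemma regen_H:
  assumes w: "gcode m w"
  shows "H (ext w (ups m)) = H \<tau>"
proof -
  have H_eq: "H (ext w (ups m)) = (\<Sum>s | gcode m (ext [ast] (ups m @ s)) \<and>
      \<not> (\<exists>t b. gcode m (ext [ast] (ups m @ t)) \<and> b \<in> irr_le m \<and> s = t @ b). z0 ^ length s)" (is "_ = sum _ ?S")
    if w: "gcode m w" for w
  proof -
    let ?u = "ext w (ups m)"
    have w_ne: "w \<noteq> []" using gcode_saw[OF w] saw_tree_hd by blast
    then have u_ne: "?u \<noteq> []" by (simp add: ext_def)
    have uT: "?u \<in> T" using code_T[OF regen_in_T[OF w]] .
    have "first_codes ?u = ext ?u ` ?S"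
    proof (intro equalityI subsetI)
      fix z assume "z \<in> first_codes ?u"
      then have z: "gcode m z" "prefix ?u z" "\<not> (\<exists>y. gcode m y \<and> stepR (irr_le m) y z \<and> prefix ?u y)"
        unfolding first_codes_def by blast+
      obtain s where s: "z = ext ?u s" using prefix_ext_exists[OF u_ne z(2)] by blast
      have "gcode m (ext [ast] (ups m @ s))"
        using z(1) s gcode_regenerate_iff[OF w] w_ne by (simp add: ext_ext)
      moreover have "\<not> (\<exists>t b. gcode m (ext [ast] (ups m @ t)) \<and> b \<in> irr_le m \<and> s = t @ b)"
      proof
        assume "\<exists>t b. gcode m (ext [ast] (ups m @ t)) \<and> b \<in> irr_le m \<and> s = t @ b"
        then obtain t b where tb: "gcode m (ext [ast] (ups m @ t))" "b \<in> irr_le m" "s = t @ b" by blast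
        then have "gcode m (ext ?u t)" using gcode_regenerate_iff[OF w] w_ne by (simp add: ext_ext)
        moreover have "stepR (irr_le m) (ext ?u t) z"
          unfolding stepR_def using tb s u_ne by (intro bexI[of _ b]) (auto simp: ext_ext)
        ultimately show False using z(3) prefix_ext by blast
      qed
      ultimately show "z \<in> ext ?u ` ?S" using s by blast
    next
      fix z assume "z \<in> ext ?u ` ?S"
      then obtain s where s: "z = ext ?u s" "gcode m (ext [ast] (ups m @ s))"
        "\<not> (\<exists>t b. gcode m (ext [ast] (ups m @ t)) \<and> b \<in> irr_le m \<and> s = t @ b)" by blast
      have "gcode m z" using s gcode_regenerate_iff[OF w] w_ne by (simp add: ext_ext)
      moreover have "\<not> (\<exists>y. gcode m y \<and> stepR (irr_le m) y z \<and> prefix ?u y)"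
      proof
        assume "\<exists>y. gcode m y \<and> stepR (irr_le m) y z \<and> prefix ?u y"
        then obtain y where y: "gcode m y" "stepR (irr_le m) y z" "prefix ?u y" by blast
        obtain t where t: "y = ext ?u t" using prefix_ext_exists[OF u_ne y(3)] by blast
        obtain b where b: "b \<in> irr_le m" "z = ext y b" using y(2) unfolding stepR_def by blast
        have "s = t @ b" using s(1) t b(2) u_ne by (simp add: ext_ext ext_inj)
        moreover have "gcode m (ext [ast] (ups m @ t))"
          using y(1) t gcode_regenerate_iff[OF w] w_ne by (simp add: ext_ext)
        ultimately show False using s(3) b(1) by blast
      qed
      ultimately show "z \<in> first_codes ?u" using s(1) prefix_ext unfolding first_codes_def by blast
    qed
    then have "H ?u = (\<Sum>z\<in>ext ?u ` ?S. z0 ^ (length z - length ?u))"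
      using uT prefix_root by (simp add: flow_h_def)
    also have "\<dots> = (\<Sum>s\<in>?S. z0 ^ length s)"
      by (subst sum.reindex) (auto simp: inj_on_def ext_inj)
    finally show ?thesis .
  qed
  show ?thesis unfolding \<tau>_def H_eq[OF w] using H_eq[of "[ast]"] by simp
qed

text \<open>At most \<open>m\<close> steps lead to a code word, and \<open>m\<close> upward steps
  then regenerate; hence the distance \<open>2 * m\<close>.\<close>

lemma regen_near:
  assumes v: "v \<in> T"
  obtains w where "gcode m w" "prefix v (ext w (ups m))" "length (ext w (ups m)) \<le> length v + 2 * m"
proof -
  obtain z where z: "z \<in> first_codes v" using first_codes_ne[OF v] by blast
  then have "gcode m z" "prefix v z" unfolding first_codes_def by blast+
  moreover have "length z \<le> length v + m" using first_codes_length[OF z prefix_root[OF v]] by simp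
  ultimately have "gcode m z" "prefix v (ext z (ups m))" "length (ext z (ups m)) \<le> length v + 2 * m"
    using prefix_order.trans[OF _ prefix_ext] by auto
  then show ?thesis by (rule that)
qed

end


section \<open>The ratio of the escape probability to the critical density\<close>

context critical_good_tree
begin

abbreviation "D \<equiv> 2 * m"
text \<open>A lower bound for the transition probabilities \<open>z0 * H u / H v\<close> of the
  \<open>H\<close>-transform. Its power \<open>\<kappa>\<close> bounds from below the probability of
  following a given path of at most \<open>D\<close> steps.\<close>

definition p0 where "p0 = z0 * c / C"
definition \<kappa> where "\<kappa> = p0 ^ D"
definition \<rho> where "\<rho> lam = lam / z0"
text \<open>A lower bound for \<open>1 / (1 + S)\<close> over all vertices, where \<open>S\<close>
  is the argument of \<open>netf\<close>; it tends to 1 since \<open>S\<close> is of order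
  \<open>lam - z0\<close>.\<close>

definition \<theta> where "\<theta> lam = 1 / (1 + (\<rho> lam - 1) * C / c)"
definition r where "r lam v = esc T lam v / H v"

lemma esc_upper_ex:
  assumes "0 \<le> lam"
  shows "\<exists>M\<ge>0. (\<forall>v\<in>T. esc T lam v \<le> M * H v) \<and> (M = 0 \<or> M * lam * c \<le> lam - z0)"
  by (rule esc_upper[OF assms]) blast

lemma C_pos: "0 < C"
  by (rule flow_bound_pos)

lemma p0_pos: "0 < p0"
  using z0 c_pos C_pos by (simp add: p0_def)

lemma child_weight:
  assumes v: "v \<in> T" and u: "u \<in> children T v"
  shows "p0 \<le> z0 * H u / H v" "z0 * H u / H v \<le> 1"
proof -
  have uT: "u \<in> T" using childrenD[OF u] by blast
  have "z0 * c / C \<le> z0 * H u / H v"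
    using z0 H_ge[OF uT] H_pos[OF v] C_pos c_pos flow_h_le[of v] by (intro frac_le mult_left_mono) auto
  then show "p0 \<le> z0 * H u / H v" by (simp add: p0_def)
  have "H u \<le> sum H (children T v)"
    using u finite_children flow_h_nonneg by (intro member_le_sum) auto
  then have "z0 * H u \<le> H v"
    unfolding H_harmonic[OF v, symmetric] by (rule mult_left_mono) (use z0 in simp)
  then show "z0 * H u / H v \<le> 1" using H_pos[OF v] by simp
qed

lemma p0_le_1: "p0 \<le> 1"
proof -
  obtain u where "u \<in> children T [ast]" using children_root by blast
  then show ?thesis using child_weight[OF root_in, of u] by linarith
qed

lemma kappa: "0 < \<kappa>" "\<kappa> \<le> 1"
  using p0_pos p0_le_1 by (simp_all add: \<kappa>_def power_le_one)

lemma rho_ge_1: "z0 < lam \<Longrightarrow> 1 \<le> \<rho> lam"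
  using z0 by (simp add: \<rho>_def)

lemma theta_denom: "z0 < lam \<Longrightarrow> 1 \<le> 1 + (\<rho> lam - 1) * C / c"
  using rho_ge_1 C_pos c_pos by simp

lemma theta_bounds: "z0 < lam \<Longrightarrow> 0 < \<theta> lam" "z0 < lam \<Longrightarrow> \<theta> lam \<le> 1"
  using theta_denom[of lam] by (simp_all add: \<theta>_def)

lemma esc_r: "v \<in> T \<Longrightarrow> esc T lam v = r lam v * H v"
  using H_pos[of v] by (simp add: r_def)

lemma r_nonneg: "v \<in> T \<Longrightarrow> 0 \<le> r lam v"
  using H_pos[of v] by (simp add: r_def)

text \<open>The ratio \<open>r\<close> at a vertex is nearly its average over the children under the
  \<open>H\<close>-transform. The upper error \<open>\<rho>\<close> comes from
  \<open>netf S \<le> S\<close>, the lower error \<open>\<theta>\<close> from the smallness of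
  \<open>S\<close>; children other than \<open>u\<close> are replaced by the extreme values.\<close>

lemma one_step:
  assumes lam: "z0 < lam" and v: "v \<in> T" and u: "u \<in> children T v"
    and M: "\<And>w. w \<in> T \<Longrightarrow> r lam w \<le> M" and \<mu>: "0 \<le> \<mu>" "\<And>w. w \<in> T \<Longrightarrow> \<mu> \<le> r lam w"
  defines "p \<equiv> z0 * H u / H v"
  shows "r lam v \<le> \<rho> lam * (p * r lam u + (1 - p) * M)"
    and "\<theta> lam * (p * r lam u + (1 - p) * \<mu>) \<le> r lam v"
proof -
  have uT: "u \<in> T" and sub: "\<And>w. w \<in> children T v \<Longrightarrow> w \<in> T" using childrenD u by blast+
  have Hv: "0 < H v" by (rule H_pos[OF v])
  have lam0: "0 < lam" using lam z0 by simp
  define S where "S = lam * sum (esc T lam) (children T v)"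
  have split: "sum g (children T v) = g u + sum g (children T v - {u})" for g :: "point list \<Rightarrow> real"
    by (rule sum.remove[OF finite_children u])
  have Hrest: "sum H (children T v - {u}) = H v / z0 - H u"
    using split[of H] H_harmonic[OF v] z0 by (simp add: field_simps)
  have S_eq: "S = lam * (r lam u * H u + sum (esc T lam) (children T v - {u}))"
    by (simp add: S_def split[of "esc T lam"] esc_r[OF uT])
  have comb: "lam * (r lam u * H u + X * (H v / z0 - H u)) = \<rho> lam * (p * r lam u + (1 - p) * X) * H v" for X
    using Hv z0 by (simp add: \<rho>_def p_def field_simps)
  have ev: "esc T lam v = netf S" unfolding S_def by (rule esc_eq[OF less_imp_le[OF lam0] v])
  have S0: "0 \<le> S" unfolding S_def using lam0 by simp
  have "sum (esc T lam) (children T v - {u}) \<le> (\<Sum>w\<in>children T v - {u}. M * H w)"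
  proof (rule sum_mono)
    fix w assume "w \<in> children T v - {u}"
    then have w: "w \<in> T" using sub by blast
    show "esc T lam w \<le> M * H w"
      unfolding esc_r[OF w] using M[OF w] H_pos[OF w] by (intro mult_right_mono) auto
  qed
  also have "\<dots> = M * (H v / z0 - H u)" by (simp add: sum_distrib_left[symmetric] Hrest)
  finally have "S \<le> \<rho> lam * (p * r lam u + (1 - p) * M) * H v"
    unfolding S_eq comb[symmetric] using lam0 by (intro mult_left_mono add_left_mono) auto
  then have "esc T lam v \<le> \<rho> lam * (p * r lam u + (1 - p) * M) * H v"
    using netf_bounds(3)[OF S0] ev by simp
  then show "r lam v \<le> \<rho> lam * (p * r lam u + (1 - p) * M)"
    using Hv by (simp add: r_def divide_le_eq)
  have "(\<Sum>w\<in>children T v - {u}. \<mu> * H w) \<le> sum (esc T lam) (children T v - {u})"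
  proof (rule sum_mono)
    fix w assume "w \<in> children T v - {u}"
    then have w: "w \<in> T" using sub by blast
    show "\<mu> * H w \<le> esc T lam w"
      unfolding esc_r[OF w] using \<mu>(2)[OF w] H_pos[OF w] by (intro mult_right_mono) auto
  qed
  then have "\<mu> * (H v / z0 - H u) \<le> sum (esc T lam) (children T v - {u})"
    by (simp add: sum_distrib_left[symmetric] Hrest)
  then have Sge: "\<rho> lam * (p * r lam u + (1 - p) * \<mu>) * H v \<le> S"
    unfolding S_eq comb[symmetric] using lam0 by (intro mult_left_mono add_left_mono) auto
  have p: "0 \<le> p" "p \<le> 1" unfolding p_def using child_weight[OF v u] p0_pos by auto
  have X: "0 \<le> p * r lam u + (1 - p) * \<mu>" using p \<mu>(1) r_nonneg[OF uT] by simp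
  have "1 * ((p * r lam u + (1 - p) * \<mu>) * H v) \<le> \<rho> lam * ((p * r lam u + (1 - p) * \<mu>) * H v)"
    using rho_ge_1[OF lam] X Hv by (intro mult_right_mono) auto
  then have Sge': "(p * r lam u + (1 - p) * \<mu>) * H v \<le> S" using Sge by (simp add: mult.assoc)
  \<comment> \<open>Here the linear bound from \<open>esc_le_flow\<close> is spent: it makes
    \<open>S\<close> at most \<open>(\<rho> lam - 1) * C / c\<close>.\<close>
  obtain M1 where M1: "0 \<le> M1" "\<And>v. v \<in> T \<Longrightarrow> esc T lam v \<le> M1 * H v" "M1 = 0 \<or> M1 * lam * c \<le> lam - z0"
    using esc_upper_ex[OF less_imp_le[OF lam0]] by blast
  have "S \<le> lam * (\<Sum>w\<in>children T v. M1 * H w)"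
    unfolding S_def using M1(2) sub lam0 by (intro mult_left_mono sum_mono) auto
  also have "\<dots> = M1 * lam * (H v / z0)"
    using H_harmonic[OF v] z0 by (simp add: sum_distrib_left[symmetric] field_simps)
  also have "\<dots> \<le> ((lam - z0) / c) * (C / z0)"
  proof (rule mult_mono)
    show "M1 * lam \<le> (lam - z0) / c" using M1(3) c_pos lam by (auto simp: pos_le_divide_eq)
    show "H v / z0 \<le> C / z0" using flow_h_le z0 by (intro divide_right_mono) auto
  qed (use lam c_pos Hv z0 in auto)
  also have "\<dots> = (\<rho> lam - 1) * C / c" using z0 by (simp add: \<rho>_def field_simps)
  finally have "1 + S \<le> 1 + (\<rho> lam - 1) * C / c" by simp
  then have "\<theta> lam \<le> 1 / (1 + S)"
    unfolding \<theta>_def using S0 theta_denom[OF lam] by (intro divide_left_mono mult_pos_pos) auto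
  then have "\<theta> lam * S \<le> netf S"
    using mult_right_mono[OF _ S0] by (fastforce simp: netf_def)
  moreover have "\<theta> lam * ((p * r lam u + (1 - p) * \<mu>) * H v) \<le> \<theta> lam * S"
    using Sge' theta_bounds[OF lam] by (intro mult_left_mono) auto
  ultimately have "\<theta> lam * (p * r lam u + (1 - p) * \<mu>) * H v \<le> esc T lam v"
    by (simp add: ev mult.assoc)
  then show "\<theta> lam * (p * r lam u + (1 - p) * \<mu>) \<le> r lam v"
    using Hv by (simp add: r_def pos_le_divide_eq)
qed

text \<open>Iterates \<open>one_step\<close> along the path from \<open>v\<close> to
  \<open>u\<close>. The true path probability is lowered to \<open>p0 ^ d\<close>, which only moves
  mass towards the extreme value.\<close>

lemma many_steps:
  assumes lam: "z0 < lam" and u: "u \<in> T"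
    and M: "\<And>w. w \<in> T \<Longrightarrow> r lam w \<le> M" and \<mu>: "0 \<le> \<mu>" "\<And>w. w \<in> T \<Longrightarrow> \<mu> \<le> r lam w"
  shows "v \<in> T \<Longrightarrow> prefix v u \<Longrightarrow> length u = length v + d \<Longrightarrow>
    r lam v \<le> \<rho> lam ^ d * ((1 - p0 ^ d) * M + p0 ^ d * r lam u) \<and>
    \<theta> lam ^ d * ((1 - p0 ^ d) * \<mu> + p0 ^ d * r lam u) \<le> r lam v"
proof (induction d arbitrary: v)
  case 0
  then have "v = u" using prefix_same_length[OF 0(2)] by simp
  then show ?case by simp
next
  case (Suc d)
  let ?a = "p0 ^ d"
  obtain zs where zs: "u = v @ zs" "length zs = Suc d" using Suc.prems by (auto simp: prefix_def)
  then obtain z zs' where z: "zs = z # zs'" by (cases zs) auto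
  let ?w = "v @ [z]"
  have pw: "prefix ?w u" and lw: "length u = length ?w + d" using zs z by auto
  have wT: "?w \<in> T" using prefix_in_T[OF u pw] by simp
  then have w: "?w \<in> children T v" by (simp add: children_def)
  define p where "p = z0 * H ?w / H v"
  have p: "p0 \<le> p" "p \<le> 1" unfolding p_def using child_weight[OF Suc.prems(1) w] by auto
  have os1: "r lam v \<le> \<rho> lam * (p * r lam ?w + (1 - p) * M)"
    unfolding p_def by (rule one_step(1)[OF lam Suc.prems(1) w M \<mu>])
  have os2: "\<theta> lam * (p * r lam ?w + (1 - p) * \<mu>) \<le> r lam v"
    unfolding p_def by (rule one_step(2)[OF lam Suc.prems(1) w M \<mu>])
  note IH = Suc.IH[OF wT pw lw]
  have a: "0 \<le> ?a" "?a \<le> 1" using p0_pos p0_le_1 by (simp_all add: power_le_one)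
  have Mu: "r lam u \<le> M" "\<mu> \<le> r lam u" "0 \<le> M" "0 \<le> r lam u"
    using M[OF u] \<mu>(2)[OF u] r_nonneg[OF u, of lam] by auto
  define B where "B = (1 - ?a) * M + ?a * r lam u"
  define b where "b = (1 - ?a) * \<mu> + ?a * r lam u"
  have BM: "B \<le> M"
    using mult_left_mono[OF Mu(1) a(1)] by (simp add: B_def algebra_simps)
  have bm: "\<mu> \<le> b"
    using mult_left_mono[OF Mu(2) a(1)] by (simp add: b_def algebra_simps)
  have B0: "0 \<le> B" using a Mu by (simp add: B_def)
  have \<rho>1: "1 \<le> \<rho> lam ^ d" by (rule one_le_power[OF rho_ge_1[OF lam]])
  have t1: "0 \<le> \<theta> lam ^ d" "\<theta> lam ^ d \<le> 1" using theta_bounds[OF lam] by (simp_all add: power_le_one)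
  note os1
  also have "\<rho> lam * (p * r lam ?w + (1 - p) * M) \<le> \<rho> lam * (p * (\<rho> lam ^ d * B) + (1 - p) * (\<rho> lam ^ d * M))"
  proof (intro mult_left_mono add_mono)
    show "r lam ?w \<le> \<rho> lam ^ d * B" using IH by (simp add: B_def)
    show "M \<le> \<rho> lam ^ d * M" using mult_right_mono[OF \<rho>1 Mu(3)] by simp
  qed (use p p0_pos rho_ge_1[OF lam] in auto)
  also have "\<dots> = \<rho> lam ^ Suc d * (p * B + (1 - p) * M)" by (simp add: algebra_simps)
  also have "\<dots> \<le> \<rho> lam ^ Suc d * (p0 * B + (1 - p0) * M)"
  proof (rule mult_left_mono)
    have "0 \<le> (p - p0) * (M - B)" using p BM by (intro mult_nonneg_nonneg) auto
    then show "p * B + (1 - p) * M \<le> p0 * B + (1 - p0) * M" by (simp add: algebra_simps)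
    show "0 \<le> \<rho> lam ^ Suc d" using rho_ge_1[OF lam] by (intro zero_le_power) auto
  qed
  also have "p0 * B + (1 - p0) * M = (1 - p0 ^ Suc d) * M + p0 ^ Suc d * r lam u"
    by (simp add: B_def algebra_simps)
  finally have up: "r lam v \<le> \<rho> lam ^ Suc d * ((1 - p0 ^ Suc d) * M + p0 ^ Suc d * r lam u)" .
  have "\<theta> lam ^ Suc d * ((1 - p0 ^ Suc d) * \<mu> + p0 ^ Suc d * r lam u)
      = \<theta> lam ^ Suc d * (p0 * b + (1 - p0) * \<mu>)"
    by (simp add: b_def algebra_simps)
  also have "\<dots> \<le> \<theta> lam ^ Suc d * (p * b + (1 - p) * \<mu>)"
  proof (rule mult_left_mono)
    have "0 \<le> (p - p0) * (b - \<mu>)" using p bm by (intro mult_nonneg_nonneg) auto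
    then show "p0 * b + (1 - p0) * \<mu> \<le> p * b + (1 - p) * \<mu>" by (simp add: algebra_simps)
    show "0 \<le> \<theta> lam ^ Suc d" using theta_bounds[OF lam] by (intro zero_le_power) auto
  qed
  also have "\<dots> = \<theta> lam * (p * (\<theta> lam ^ d * b) + (1 - p) * (\<theta> lam ^ d * \<mu>))" by (simp add: algebra_simps)
  also have "\<dots> \<le> \<theta> lam * (p * r lam ?w + (1 - p) * \<mu>)"
  proof (intro mult_left_mono add_mono)
    show "\<theta> lam ^ d * b \<le> r lam ?w" using IH by (simp add: b_def)
    show "\<theta> lam ^ d * \<mu> \<le> \<mu>" using mult_right_mono[OF t1(2) \<mu>(1)] by simp
  qed (use p p0_pos theta_bounds[OF lam] in auto)
  also have "\<dots> \<le> r lam v" by (rule os2)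
  finally show ?case using up by simp
qed

lemma tau_in: "\<tau> \<in> T"
  using code_T[OF gcode_ups[OF m, of m]] by (simp add: \<tau>_def)

text \<open>Every vertex has a regenerated descendant with ratio \<open>r lam \<tau>\<close> within
  \<open>D\<close> steps, so supremum and infimum of \<open>r\<close> satisfy inequalities in which
  they reappear with factor \<open>1 - \<kappa>\<close>; solving these bounds both by multiples of
  \<open>r lam \<tau>\<close>.\<close>

lemma ratio_bounds:
  assumes lam: "z0 < lam" and small: "\<rho> lam ^ D * (1 - \<kappa>) < 1" and v: "v \<in> T"
  shows "r lam v \<le> \<rho> lam ^ D * \<kappa> / (1 - \<rho> lam ^ D * (1 - \<kappa>)) * r lam \<tau>"
    and "\<theta> lam ^ D * \<kappa> / (1 - \<theta> lam ^ D * (1 - \<kappa>)) * r lam \<tau> \<le> r lam v"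
proof -
  obtain M1 where M1: "0 \<le> M1" "\<And>v. v \<in> T \<Longrightarrow> esc T lam v \<le> M1 * H v"
    using esc_upper_ex[OF less_imp_le[OF less_trans[OF z0(1) lam]]] by blast
  have "r lam w \<le> M1" if "w \<in> T" for w
    using M1(2)[OF that] H_pos[OF that] by (simp add: r_def divide_le_eq)
  then have bdd: "bdd_above (r lam ` T)" by (intro bdd_aboveI[where M = M1]) auto
  have bdb: "bdd_below (r lam ` T)" using r_nonneg by (intro bdd_belowI[where m = 0]) auto
  define M where "M = (SUP w\<in>T. r lam w)"
  define \<mu> where "\<mu> = (INF w\<in>T. r lam w)"
  have ne: "T \<noteq> {}" using root_in by blast
  have M: "r lam w \<le> M" if "w \<in> T" for w unfolding M_def by (rule cSUP_upper[OF that bdd])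
  have \<mu>: "\<mu> \<le> r lam w" if "w \<in> T" for w unfolding \<mu>_def by (rule cINF_lower[OF bdb that])
  have \<mu>0: "0 \<le> \<mu>" unfolding \<mu>_def using ne r_nonneg by (intro cINF_greatest) auto
  have key: "r lam w \<le> \<rho> lam ^ D * ((1 - \<kappa>) * M + \<kappa> * r lam \<tau>) \<and>
      \<theta> lam ^ D * ((1 - \<kappa>) * \<mu> + \<kappa> * r lam \<tau>) \<le> r lam w" if w: "w \<in> T" for w
  proof -
    obtain y where y: "gcode m y" "prefix w (ext y (ups m))" "length (ext y (ups m)) \<le> length w + D"
      by (rule regen_near[OF w])
    let ?u = "ext y (ups m)"
    have u: "?u \<in> T" by (rule code_T[OF regen_in_T[OF y(1)]])
    have lam0: "0 \<le> lam" using lam z0 by simp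
    have ru: "r lam ?u = r lam \<tau>" by (simp add: r_def regen_esc[OF y(1) lam0] regen_H[OF y(1)])
    define d where "d = length ?u - length w"
    have d: "length ?u = length w + d" "d \<le> D" using y(3) prefix_length_le[OF y(2)] by (simp_all add: d_def)
    note ms = many_steps[OF lam u M \<mu>0 \<mu> w y(2) d(1), unfolded ru]
    have \<tau>M: "r lam \<tau> \<le> M" "\<mu> \<le> r lam \<tau>" "0 \<le> r lam \<tau>" using M \<mu> tau_in r_nonneg by auto
    have kd: "\<kappa> \<le> p0 ^ d" "p0 ^ d \<le> 1"
      unfolding \<kappa>_def using p0_pos p0_le_1 d(2) by (simp_all add: power_decreasing power_le_one)
    have "\<rho> lam ^ d * ((1 - p0 ^ d) * M + p0 ^ d * r lam \<tau>) \<le> \<rho> lam ^ D * ((1 - \<kappa>) * M + \<kappa> * r lam \<tau>)"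
    proof (rule mult_mono)
      show "\<rho> lam ^ d \<le> \<rho> lam ^ D" using rho_ge_1[OF lam] d(2) by (rule power_increasing[rotated])
      have "0 \<le> (p0 ^ d - \<kappa>) * (M - r lam \<tau>)" using kd \<tau>M by (intro mult_nonneg_nonneg) auto
      then show "(1 - p0 ^ d) * M + p0 ^ d * r lam \<tau> \<le> (1 - \<kappa>) * M + \<kappa> * r lam \<tau>"
        by (simp add: algebra_simps)
      show "0 \<le> \<rho> lam ^ D" using rho_ge_1[OF lam] by (intro zero_le_power) auto
      show "0 \<le> (1 - p0 ^ d) * M + p0 ^ d * r lam \<tau>" using kd kappa \<tau>M by (intro add_nonneg_nonneg mult_nonneg_nonneg) auto
    qed
    moreover have "\<theta> lam ^ D * ((1 - \<kappa>) * \<mu> + \<kappa> * r lam \<tau>) \<le> \<theta> lam ^ d * ((1 - p0 ^ d) * \<mu> + p0 ^ d * r lam \<tau>)"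
    proof (rule mult_mono)
      show "\<theta> lam ^ D \<le> \<theta> lam ^ d" using theta_bounds[OF lam] d(2) by (intro power_decreasing) auto
      have "0 \<le> (p0 ^ d - \<kappa>) * (r lam \<tau> - \<mu>)" using kd \<tau>M by (intro mult_nonneg_nonneg) auto
      then show "(1 - \<kappa>) * \<mu> + \<kappa> * r lam \<tau> \<le> (1 - p0 ^ d) * \<mu> + p0 ^ d * r lam \<tau>"
        by (simp add: algebra_simps)
      show "0 \<le> \<theta> lam ^ d" using theta_bounds[OF lam] by (intro zero_le_power) auto
      show "0 \<le> (1 - \<kappa>) * \<mu> + \<kappa> * r lam \<tau>" using kappa \<mu>0 \<tau>M by (intro add_nonneg_nonneg mult_nonneg_nonneg) auto
    qed
    ultimately show ?thesis using ms by linarith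
  qed
  \<comment> \<open>The hypothesis \<open>small\<close> keeps the coefficient positive when this is
    solved for \<open>M\<close>.\<close>
  have "M \<le> \<rho> lam ^ D * ((1 - \<kappa>) * M + \<kappa> * r lam \<tau>)"
    unfolding M_def using key ne by (intro cSUP_least) (auto simp: M_def[symmetric])
  then have "M * (1 - \<rho> lam ^ D * (1 - \<kappa>)) \<le> \<rho> lam ^ D * \<kappa> * r lam \<tau>" by (simp add: algebra_simps)
  then have "M \<le> \<rho> lam ^ D * \<kappa> * r lam \<tau> / (1 - \<rho> lam ^ D * (1 - \<kappa>))"
    using small by (simp add: pos_le_divide_eq)
  then show "r lam v \<le> \<rho> lam ^ D * \<kappa> / (1 - \<rho> lam ^ D * (1 - \<kappa>)) * r lam \<tau>"
    using M[OF v] by simp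
  have "\<theta> lam ^ D * ((1 - \<kappa>) * \<mu> + \<kappa> * r lam \<tau>) \<le> \<mu>"
    unfolding \<mu>_def using key ne by (intro cINF_greatest) (auto simp: \<mu>_def[symmetric])
  then have "\<theta> lam ^ D * \<kappa> * r lam \<tau> \<le> \<mu> * (1 - \<theta> lam ^ D * (1 - \<kappa>))" by (simp add: algebra_simps)
  moreover have "0 < 1 - \<theta> lam ^ D * (1 - \<kappa>)"
  proof -
    have "\<theta> lam ^ D * (1 - \<kappa>) \<le> 1 * (1 - \<kappa>)"
      using theta_bounds[OF lam] kappa by (intro mult_right_mono) (auto simp: power_le_one)
    then show ?thesis using kappa by simp
  qed
  ultimately have "\<theta> lam ^ D * \<kappa> * r lam \<tau> / (1 - \<theta> lam ^ D * (1 - \<kappa>)) \<le> \<mu>"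
    by (simp add: pos_divide_le_eq)
  then show "\<theta> lam ^ D * \<kappa> / (1 - \<theta> lam ^ D * (1 - \<kappa>)) * r lam \<tau> \<le> r lam v"
    using \<mu>[OF v] by simp
qed

lemma r_tau_pos: "z0 < lam \<Longrightarrow> 0 < r lam \<tau>"
  using esc_supercritical[OF _ tau_in] H_pos[OF tau_in] by (simp add: r_def)

text \<open>Both bounding factors tend to \<open>\<kappa> / (1 - (1 - \<kappa>))\<close>, which is
  1. Dividing by the value at \<open>\<tau>\<close> removes the common decay to 0.\<close>

lemma ratio_tendsto:
  assumes v: "v \<in> T"
  shows "((\<lambda>lam. esc T lam v / r lam \<tau>) \<longlongrightarrow> H v) (at_right z0)"
proof -
  let ?F = "at_right z0"
  have \<rho>: "(\<rho> \<longlongrightarrow> 1) ?F"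
    unfolding \<rho>_def using z0 by (auto intro!: tendsto_eq_intros)
  have \<theta>: "(\<theta> \<longlongrightarrow> 1) ?F"
    unfolding \<theta>_def using c_pos by (auto intro!: tendsto_eq_intros \<rho>)
  have ev: "\<forall>\<^sub>F lam in ?F. z0 < lam" by (simp add: eventually_at_right_less)
  have "((\<lambda>lam. \<rho> lam ^ D * (1 - \<kappa>)) \<longlongrightarrow> 1 ^ D * (1 - \<kappa>)) ?F"
    by (intro tendsto_intros \<rho>)
  then have ev2: "\<forall>\<^sub>F lam in ?F. \<rho> lam ^ D * (1 - \<kappa>) < 1"
    by (rule order_tendstoD) (use kappa in simp)
  have up: "((\<lambda>lam. \<rho> lam ^ D * \<kappa> / (1 - \<rho> lam ^ D * (1 - \<kappa>))) \<longlongrightarrow> 1 ^ D * \<kappa> / (1 - 1 ^ D * (1 - \<kappa>))) ?F"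
    using kappa by (intro tendsto_intros \<rho>) auto
  have lo: "((\<lambda>lam. \<theta> lam ^ D * \<kappa> / (1 - \<theta> lam ^ D * (1 - \<kappa>))) \<longlongrightarrow> 1 ^ D * \<kappa> / (1 - 1 ^ D * (1 - \<kappa>))) ?F"
    using kappa by (intro tendsto_intros \<theta>) auto
  have "((\<lambda>lam. r lam v / r lam \<tau>) \<longlongrightarrow> 1 ^ D * \<kappa> / (1 - 1 ^ D * (1 - \<kappa>))) ?F"
  proof (rule tendsto_sandwich[OF _ _ lo up])
    show "\<forall>\<^sub>F lam in ?F. \<theta> lam ^ D * \<kappa> / (1 - \<theta> lam ^ D * (1 - \<kappa>)) \<le> r lam v / r lam \<tau>"
      using ev ev2 by eventually_elim (subst pos_le_divide_eq[OF r_tau_pos], assumption, rule ratio_bounds(2)[OF _ _ v])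
    show "\<forall>\<^sub>F lam in ?F. r lam v / r lam \<tau> \<le> \<rho> lam ^ D * \<kappa> / (1 - \<rho> lam ^ D * (1 - \<kappa>))"
      using ev ev2 by eventually_elim (subst pos_divide_le_eq[OF r_tau_pos], assumption, rule ratio_bounds(1)[OF _ _ v])
  qed
  then have "((\<lambda>lam. r lam v / r lam \<tau>) \<longlongrightarrow> 1) ?F" using kappa by simp
  then have "((\<lambda>lam. r lam v / r lam \<tau> * H v) \<longlongrightarrow> 1 * H v) ?F" by (rule tendsto_mult_right)
  then show ?thesis by (simp add: esc_r[OF v])
qed

text \<open>The conditional probabilities of the limit walk tend to \<open>z0 * H w / H v\<close>,
  and their product telescopes. The exponent is the number of steps, one less than the number of
  vertices.\<close>

lemma phi_good_tendsto:
  assumes "\<gamma> \<in> T"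
  shows "((\<lambda>lam. phi_good lam m \<gamma>) \<longlongrightarrow> z0 ^ (length \<gamma> - 1) * H \<gamma>) (at_right z0)"
  using assms
proof (induction \<gamma> rule: rev_induct)
  case Nil
  then show ?case using Nil_notin_T by simp
next
  case (snoc d v)
  let ?F = "at_right z0"
  have ev: "\<forall>\<^sub>F lam in ?F. z0 < lam" by (simp add: eventually_at_right_less)
  show ?case
  proof (cases "v @ [d] = [ast]")
    case True
    have "\<forall>\<^sub>F lam in ?F. phi_good lam m [ast] = 1"
      using ev
    proof eventually_elim
      case (elim lam)
      then show ?case
        unfolding phi_good_def using limit_walk_prob_root[OF _ esc_supercritical[OF elim root_in]] z0 by simp
    qed
    then show ?thesis unfolding True using flow_h_v0 by (simp add: tendsto_eventually)
  next
    case False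
    have v: "v \<in> T" using butlast_T[OF snoc.prems False] by simp
    let ?w = "v @ [d]"
    have w: "?w \<in> children T v" using snoc.prems by (simp add: children_def)
    have v_ne: "v \<noteq> []" using v Nil_notin_T by blast
    have sum_lim: "((\<lambda>lam. \<Sum>u\<in>children T v. esc T lam u / r lam \<tau>) \<longlongrightarrow> sum H (children T v)) ?F"
      by (intro tendsto_sum ratio_tendsto) (use childrenD in blast)
    have Hs: "sum H (children T v) = H v / z0" using H_harmonic[OF v] z0 by (simp add: field_simps)
    have "((\<lambda>lam. (esc T lam ?w / r lam \<tau>) / (\<Sum>u\<in>children T v. esc T lam u / r lam \<tau>) * phi_good lam m v)
      \<longlongrightarrow> H ?w / (H v / z0) * (z0 ^ (length v - 1) * H v)) ?F"
      using H_pos[OF v] z0 unfolding Hs[symmetric]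
      by (intro tendsto_intros ratio_tendsto snoc sum_lim v) (simp add: Hs)
    also have "H ?w / (H v / z0) * (z0 ^ (length v - 1) * H v) = z0 ^ (length ?w - 1) * H ?w"
      using H_pos[OF v] v_ne by (cases v) auto
    finally show ?thesis
    proof (rule Lim_transform_eventually)
      show "\<forall>\<^sub>F lam in ?F. (esc T lam ?w / r lam \<tau>) / (\<Sum>u\<in>children T v. esc T lam u / r lam \<tau>) * phi_good lam m v
          = phi_good lam m ?w"
        using ev
      proof eventually_elim
        case (elim lam)
        have lam0: "0 < lam" using elim z0 by simp
        have q: "0 < r lam \<tau>" by (rule r_tau_pos[OF elim])
        have "esc T lam ?w \<le> sum (esc T lam) (children T v)"
          using w finite_children by (intro member_le_sum) auto
        then have s: "0 < sum (esc T lam) (children T v)"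
          using esc_supercritical[OF elim snoc.prems] by simp
        have "phi_good lam m ?w * sum (esc T lam) (children T v) = esc T lam ?w * phi_good lam m v"
          unfolding phi_good_def
          by (rule limit_walk_prob_child(1)[OF lam0 esc_supercritical[OF elim root_in] v w])
        then show ?case using q s by (simp add: sum_divide_distrib[symmetric] field_simps)
      qed
    qed
  qed
qed

lemma phi_crit_eq: "\<gamma> \<in> T \<Longrightarrow> phi_crit m \<gamma> = z0 ^ (length \<gamma> - 1) * H \<gamma>"
  unfolding phi_crit_def lambda_crit_eq
  by (rule tendsto_Lim[OF _ phi_good_tendsto]) simp_all

lemma phi_good_outside: "\<gamma> \<notin> T \<Longrightarrow> phi_good lam m \<gamma> = 0"
  unfolding phi_good_def by (rule limit_walk_prob_outside)

lemma phi_crit_outside: "\<gamma> \<notin> T \<Longrightarrow> phi_crit m \<gamma> = 0"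
  unfolding phi_crit_def phi_good_outside by (rule tendsto_Lim) simp_all

lemma phi_good_tendsto_phi_crit:
  "((\<lambda>lam. phi_good lam m \<gamma>) \<longlongrightarrow> phi_crit m \<gamma>) (at_right (lambda_crit m))"
  using phi_good_tendsto[of \<gamma>] phi_crit_eq[of \<gamma>] phi_good_outside[of \<gamma>] phi_crit_outside[of \<gamma>]
  by (cases "\<gamma> \<in> T") (simp_all add: lambda_crit_eq)

end


section \<open>Convergence of the critical limits\<close>

text \<open>No bridge in the decomposition is longer than the word, so the truncation can be
  replaced by one that does not depend on \<open>m\<close>.\<close>

lemma gcode_length: "gcode m y \<Longrightarrow> gcode (length y) y"
proof (induction rule: rtranclp_induct)
  case base
  then show ?case by simp
next
  case (step y z)
  obtain b where b: "irr b" "z = ext y b" using step.hyps(2) unfolding stepR_def by blast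
  have "gcode (length z) y" using gcode_mono[OF _ step.IH] b by simp
  moreover have "stepR (irr_le (length z)) y z"
    unfolding stepR_def using b by (intro bexI[of _ b]) auto
  ultimately show ?case by (rule rtranclp.rtrancl_into_rtrancl)
qed

text \<open>Groups the first code words beyond \<open>\<gamma>\<close> by their predecessor
  \<open>y\<close>, a proper prefix of \<open>\<gamma>\<close>. The finite index set is the same for
  all large \<open>m\<close>, so the limit can be taken term by term.\<close>

lemma phi_crit_sum:
  assumes len: "m \<ge> length \<gamma>" and \<gamma>: "\<gamma> \<in> saw_tree" "\<gamma> \<noteq> [ast]"
  shows "phi_crit m \<gamma> = (\<Sum>y | gcode (length \<gamma>) y \<and> prefix y \<gamma> \<and> y \<noteq> \<gamma>.
    zc m ^ (length y - 1) * gf (zc m) ({b. prefix \<gamma> (ext y b)} \<inter> irr_le m))"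
proof -
  have \<gamma>_ne: "\<gamma> \<noteq> []" using saw_tree_hd[OF \<gamma>(1)] by simp
  then have m1: "m \<ge> 1" using len by (cases \<gamma>) auto
  interpret critical_good_tree m by unfold_locales (rule m1)
  let ?P = "{y. gcode (length \<gamma>) y \<and> prefix y \<gamma> \<and> y \<noteq> \<gamma>}"
  let ?B = "\<lambda>y. {b. prefix \<gamma> (ext y b)} \<inter> irr_le m"
  have root_prefix: "prefix [ast] \<gamma>" using saw_tree_hd[OF \<gamma>(1)] by (cases \<gamma>) auto
  have P_iff: "y \<in> ?P \<longleftrightarrow> gcode m y \<and> prefix y \<gamma> \<and> y \<noteq> \<gamma>" for y
  proof -
    have "gcode m y \<longleftrightarrow> gcode (length \<gamma>) y" if p: "prefix y \<gamma>"
    proof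
      assume "gcode m y"
      then show "gcode (length \<gamma>) y" by (rule gcode_mono[OF prefix_length_le[OF p] gcode_length])
    next
      assume "gcode (length \<gamma>) y"
      then show "gcode m y" by (rule gcode_mono[OF len])
    qed
    then show ?thesis by (cases "prefix y \<gamma>") simp_all
  qed
  have eq: "first_codes \<gamma> = (\<Union>y\<in>?P. ext y ` ?B y)"
  proof (intro equalityI subsetI)
    fix z assume z: "z \<in> first_codes \<gamma>"
    then have cz: "gcode m z" "prefix \<gamma> z" unfolding first_codes_def by blast+
    have "z \<noteq> [ast]"
    proof
      assume "z = [ast]"
      then show False using cz(2) \<gamma>(2) \<gamma>_ne by (simp add: prefix_Cons)
    qed
    then obtain y where y: "gcode m y" "stepR (irr_le m) y z" using code_parent cz(1) by blast
    then have npy: "\<not> prefix \<gamma> y" using z unfolding first_codes_def by blast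
    moreover have "prefix y z" by (rule stepR_length(2)[OF Nil_irr y(2)])
    ultimately have "prefix y \<gamma>" using cz(2) prefix_same_cases by blast
    moreover have "y \<noteq> \<gamma>" using npy by auto
    ultimately have "y \<in> ?P" using y(1) P_iff by blast
    moreover obtain b where "b \<in> irr_le m" "z = ext y b" using y(2) unfolding stepR_def by blast
    ultimately show "z \<in> (\<Union>y\<in>?P. ext y ` ?B y)" using cz(2) by blast
  next
    fix z assume "z \<in> (\<Union>y\<in>?P. ext y ` ?B y)"
    then obtain y b where y: "y \<in> ?P" "b \<in> irr_le m" "prefix \<gamma> (ext y b)" "z = ext y b" by blast
    then have gy: "gcode m y" "prefix y \<gamma>" "y \<noteq> \<gamma>" using P_iff by blast+
    have st: "stepR (irr_le m) y z" unfolding stepR_def using y by blast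
    have "gcode m z" using gy(1) st by (rule rtranclp.rtrancl_into_rtrancl)
    moreover have "\<not> (\<exists>y'. gcode m y' \<and> stepR (irr_le m) y' z \<and> prefix \<gamma> y')"
    proof
      assume "\<exists>y'. gcode m y' \<and> stepR (irr_le m) y' z \<and> prefix \<gamma> y'"
      then obtain y' where y': "gcode m y'" "stepR (irr_le m) y' z" "prefix \<gamma> y'" by blast
      have "y = y'" by (rule gcode_unique_parent[OF gy(1) y'(1) st y'(2)])
      then show False using gy y'(3) prefix_order.antisym by blast
    qed
    ultimately show "z \<in> first_codes \<gamma>" unfolding first_codes_def using y by blast
  qed
  have phi: "phi_crit m \<gamma> = (\<Sum>z\<in>first_codes \<gamma>. z0 ^ (length z - 1))"
  proof (cases "\<gamma> \<in> T")
    case True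
    have "z0 ^ (length \<gamma> - 1) * z0 ^ (length z - length \<gamma>) = z0 ^ (length z - 1)" if z: "z \<in> first_codes \<gamma>" for z
    proof -
      have "length \<gamma> \<le> length z" using first_codes_length[OF z root_prefix] by simp
      moreover have "1 \<le> length \<gamma>" using \<gamma>_ne by (cases \<gamma>) auto
      ultimately have "length z - 1 = (length \<gamma> - 1) + (length z - length \<gamma>)" by simp
      then show ?thesis by (simp only: power_add)
    qed
    then show ?thesis
      using True root_prefix by (simp add: phi_crit_eq flow_h_def sum_distrib_left)
  next
    case False
    then have "first_codes \<gamma> = {}" using good_tree_iff[OF m1] \<gamma>_ne unfolding first_codes_def by blast
    then show ?thesis using phi_crit_outside[OF False] by simp
  qed
  have finP: "finite ?P" by (rule finite_subset[OF _ finite_prefixes[of \<gamma>]]) blast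
  have finB: "finite (ext y ` ?B y)" for y by simp
  have "phi_crit m \<gamma> = (\<Sum>y\<in>?P. \<Sum>z\<in>ext y ` ?B y. z0 ^ (length z - 1))"
    unfolding phi eq
  proof (rule sum.UNION_disjoint[OF finP], intro ballI finB)
    show "\<forall>i\<in>?P. \<forall>j\<in>?P. i \<noteq> j \<longrightarrow> ext i ` ?B i \<inter> ext j ` ?B j = {}"
    proof (intro ballI impI equals0I)
      fix i j z assume ij: "i \<in> ?P" "j \<in> ?P" "i \<noteq> j" "z \<in> ext i ` ?B i \<inter> ext j ` ?B j"
      then have st: "stepR (irr_le m) i z" "stepR (irr_le m) j z" unfolding stepR_def by blast+
      have g: "gcode m i" "gcode m j" using ij P_iff by blast+
      have "i = j" by (rule gcode_unique_parent[OF g st])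
      then show False using ij(3) by simp
    qed
  qed
  also have "\<dots> = (\<Sum>y\<in>?P. z0 ^ (length y - 1) * gf z0 (?B y))"
  proof (rule sum.cong[OF refl])
    fix y assume "y \<in> ?P"
    then have "y \<noteq> []" using gcode_saw saw_tree_hd by blast
    then have ly: "length y \<ge> 1" by (cases y) auto
    have "(\<Sum>z\<in>ext y ` ?B y. z0 ^ (length z - 1)) = (\<Sum>b\<in>?B y. z0 ^ (length y + length b - 1))"
      by (subst sum.reindex) (auto simp: inj_on_def ext_inj)
    also have "\<dots> = (\<Sum>b\<in>?B y. z0 ^ (length y - 1) * z0 ^ length b)"
      using ly by (intro sum.cong refl) (simp add: power_add[symmetric])
    finally show "(\<Sum>z\<in>ext y ` ?B y. z0 ^ (length z - 1)) = z0 ^ (length y - 1) * gf z0 (?B y)"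
      by (simp add: gf_def sum_distrib_left)
  qed
  finally show ?thesis .
qed

lemma phi_crit_convergent:
  assumes \<gamma>: "\<gamma> \<in> saw_tree" "\<gamma> \<noteq> [ast]"
  shows "(\<lambda>m. phi_crit m \<gamma>) \<longlonglongrightarrow> phi_inf \<gamma>"
proof -
  let ?B = "\<lambda>y. {b. prefix \<gamma> (ext y b)}"
  have "(\<lambda>m. gf (zc m) (?B y \<inter> irr_le m)) \<longlonglongrightarrow> lim (\<lambda>m. gf (zc m) (?B y \<inter> irr_le m))" for y
    using gf_zc_convergent[of "?B y"] by (simp add: convergent_LIMSEQ_iff)
  then have "(\<lambda>m. \<Sum>y | gcode (length \<gamma>) y \<and> prefix y \<gamma> \<and> y \<noteq> \<gamma>.
      zc m ^ (length y - 1) * gf (zc m) (?B y \<inter> irr_le m))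
    \<longlonglongrightarrow> (\<Sum>y | gcode (length \<gamma>) y \<and> prefix y \<gamma> \<and> y \<noteq> \<gamma>.
      zinf ^ (length y - 1) * lim (\<lambda>m. gf (zc m) (?B y \<inter> irr_le m)))" (is "_ \<longlonglongrightarrow> ?L")
    by (intro tendsto_sum tendsto_mult tendsto_power zc_tendsto)
  moreover have "\<forall>\<^sub>F m in sequentially. (\<Sum>y | gcode (length \<gamma>) y \<and> prefix y \<gamma> \<and> y \<noteq> \<gamma>.
      zc m ^ (length y - 1) * gf (zc m) (?B y \<inter> irr_le m)) = phi_crit m \<gamma>"
    using eventually_ge_at_top[of "length \<gamma>"] by eventually_elim (rule phi_crit_sum[OF _ \<gamma>, symmetric])
  ultimately have lim: "(\<lambda>m. phi_crit m \<gamma>) \<longlonglongrightarrow> ?L" by (rule Lim_transform_eventually)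
  show ?thesis unfolding phi_inf_def limI[OF lim] by (rule lim)
qed


section \<open>Vertical strips of free sites\<close>

lemma gcode_bridge:
  assumes "gcode M y" "bridge b" "length b \<le> M"
  shows "gcode M (ext y b)"
  using assms
proof (induction "length b" arbitrary: y b rule: less_induct)
  case less
  have y_ne: "y \<noteq> []" using gcode_saw[OF less.prems(1)] saw_tree_hd by blast
  have irr: "gcode M (ext y b')" if "irr b'" "length b' \<le> M" for b'
  proof -
    have "stepR (irr_le M) y (ext y b')" unfolding stepR_def using that by blast
    then show ?thesis using less.prems(1) by (rule rtranclp.rtrancl_into_rtrancl[rotated])
  qed
  from bridge_decompose[OF less.prems(2)] show ?case
  proof
    assume "irr b"
    then show ?thesis using irr less.prems by blast
  next
    assume "\<exists>c t. irr c \<and> bridge t \<and> b = c @ t"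
    then obtain c t where ct: "irr c" "bridge t" "b = c @ t" by blast
    have "c \<noteq> []" using ct bridge_ne irr_bridge by blast
    then have "length t < length b" using ct by simp
    then have "gcode M (ext (ext y c) t)"
      using less.hyps[of t "ext y c"] ct less.prems(3) irr[of c] by simp
    then show ?thesis using y_ne ct(3) by (simp add: ext_ext)
  qed
qed

definition flat_set :: "nat \<Rightarrow> point list set \<Rightarrow> bool" where
  "flat_set n S \<longleftrightarrow> S \<subseteq> {s. bridge s \<and> length s = n \<and> fst (sum_list s) = 0} \<and> S \<noteq> {} \<and> n \<ge> 1"

text \<open>Every block has displacement 0 and length \<open>n\<close>, so horizontal deviations do
  not accumulate, while the height grows by at least 1 per block.\<close>

lemma flat_blocks:
  assumes S: "flat_set n S" and v: "v \<noteq> []"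
  shows "(stepR S ^^ j) v z \<Longrightarrow> \<exists>s. z = ext v s \<and> length s = j * n \<and> (s = [] \<or> bridge s) \<and>
    fst (sum_list s) = 0 \<and> ht s \<ge> int j \<and> (\<forall>i. \<bar>fst (pos s i)\<bar> \<le> int n)"
proof (induction j arbitrary: z)
  case 0
  then show ?case by (intro exI[of _ "[]"]) (auto simp: pos_def)
next
  case (Suc j)
  from Suc.prems obtain y where y: "(stepR S ^^ j) v y" "stepR S y z" by (auto elim: relpowp_Suc_E)
  obtain s where s: "y = ext v s" "length s = j * n" "s = [] \<or> bridge s" "fst (sum_list s) = 0"
    "ht s \<ge> int j" "\<And>i. \<bar>fst (pos s i)\<bar> \<le> int n"
    using Suc.IH[OF y(1)] by blast
  obtain b where b: "b \<in> S" "z = ext y b" using y(2) unfolding stepR_def by blast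
  then have b': "bridge b" "length b = n" "fst (sum_list b) = 0" using S by (auto simp: flat_set_def)
  have "\<bar>fst (pos b i)\<bar> \<le> int n" for i
  proof -
    have "set (take i b) \<subseteq> dirs" using bridge_saw[OF b'(1)] set_take_subset by (fastforce simp: saw_steps_def)
    then show ?thesis using abs_sum_dirs[of "take i b"] b'(2) by (auto simp: pos_def)
  qed
  then have "\<bar>fst (pos (s @ b) i)\<bar> \<le> int n" for i using s(4,6) by (simp add: pos_append)
  moreover have "ht (s @ b) \<ge> int (Suc j)" using s(5) ht_bridge_pos[OF b'(1)] by (simp add: ht_append)
  moreover have "bridge (s @ b)" using s(3) b'(1) bridge_append by auto
  moreover have "z = ext v (s @ b)" using b(2) s(1) v by (simp add: ext_ext)
  ultimately show ?case using s b' by (intro exI[of _ "s @ b"]) simp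
qed

text \<open>Only sites strictly above the endpoint matter, because an appended bridge lies strictly
  above its start.\<close>

definition strip_free :: "nat \<Rightarrow> point list \<Rightarrow> bool" where
  "strip_free n v \<longleftrightarrow> (\<forall>p\<in>set v. snd (last v) < snd p \<longrightarrow> int n < \<bar>fst p - fst (last v)\<bar>)"

lemma half_ht_nonneg:
  assumes "half a"
  shows "0 \<le> ht (take i a)"
proof (cases "min i (length a) = 0")
  case False
  then have "min i (length a) \<in> {1..length a}" by (simp add: Suc_le_eq)
  then have "0 < ht (take (min i (length a)) a)" using assms unfolding half_def by blast
  moreover have "take i a = take (min i (length a)) a" by (simp add: min_def)
  ultimately show ?thesis by simp
qed (auto simp: min_def split: if_splits)

lemma half_append_strip:
  assumes a: "half a" and sf: "strip_free n (walk ast a)"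
    and s: "s = [] \<or> bridge s" "\<And>i. \<bar>fst (pos s i)\<bar> \<le> int n"
  shows "half (a @ s)"
proof -
  have ha: "0 \<le> ht (take i a)" for i by (rule half_ht_nonneg[OF a])
  have hs: "0 < ht (take i s)" if "1 \<le> i" "i \<le> length s" for i
    using s(1) that ht_take_bridge[of s i] by auto
  have cross: "pos (a @ s) i \<noteq> pos (a @ s) j" if ij: "i \<le> length a" "length a < j" "j \<le> length a + length s" for i j
  proof
    assume eq: "pos (a @ s) i = pos (a @ s) j"
    define k where "k = j - length a"
    have k: "1 \<le> k" "k \<le> length s" using ij by (auto simp: k_def)
    have p: "pos a i = sum_list a + pos s k" using eq ij by (simp add: pos_append k_def)
    have mem: "ast + pos a i \<in> set (walk ast a)"
      using nth_walk[of i a ast] ij nth_mem[of i "walk ast a"] by simp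
    have "snd (last (walk ast a)) < snd (ast + pos a i)"
      using hs[OF k] by (simp add: last_walk p ht_take)
    then have "int n < \<bar>fst (ast + pos a i) - fst (last (walk ast a))\<bar>"
      using sf mem unfolding strip_free_def by blast
    then show False using s(2)[of k] by (simp add: last_walk p)
  qed
  have "saw_steps (a @ s)"
    unfolding saw_steps_iff
  proof (intro conjI allI impI)
    have ss: "saw_steps s" using s(1) bridge_saw by auto
    show "set (a @ s) \<subseteq> dirs" using a ss by (auto simp: half_def saw_steps_iff)
    fix i j assume ij: "i < j" "j \<le> length (a @ s)"
    consider "j \<le> length a" | "i > length a" | "i \<le> length a" "length a < j" using ij by linarith
    then show "pos (a @ s) i \<noteq> pos (a @ s) j"
    proof cases
      case 1
      then show ?thesis using a ij by (simp add: pos_append half_def saw_steps_iff)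
    next
      case 2
      moreover have "pos s (i - length a) \<noteq> pos s (j - length a)"
        using ss ij 2 unfolding saw_steps_iff by auto
      ultimately show ?thesis using ij by (simp add: pos_append)
    next
      case 3
      then show ?thesis using cross ij by simp
    qed
  qed
  moreover have "0 < ht (take i (a @ s))" if i: "i \<in> {1..length (a @ s)}" for i
  proof (cases "i \<le> length a")
    case True
    then show ?thesis using a i by (auto simp: half_def)
  next
    case False
    then have "0 < ht (take (i - length a) s)" using i by (intro hs) auto
    then show ?thesis using False ha[of "length a"] by (simp add: ht_append)
  qed
  ultimately show ?thesis by (simp add: half_def)
qed

text \<open>The walk \<open>v\<close> need not be a concatenation of bridges, but once enough flat
  blocks have carried it above its own maximum, the whole walk is a bridge. It then belongs to a
  good tree with a truncation \<open>M\<close> depending on \<open>v\<close>.\<close>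

lemma strip_code_tree:
  assumes S: "flat_set n S" and v: "v \<in> saw_tree" "strip_free n v" and lam: "0 < lam"
  obtains M where "M \<ge> 1" "code_tree (good_tree M) ast v S n lam"
proof -
  obtain a where a: "v = walk ast a" "half a" using v(1) by (auto simp: saw_tree_eq)
  have v_ne: "v \<noteq> []" using a by simp
  \<comment> \<open>Each block gains at least one unit of height, so \<open>J\<close> blocks exceed
    every height reached by \<open>a\<close>; \<open>M\<close> is the length of the resulting
    bridge.\<close>
  define J where "J = Suc (length a)"
  define M where "M = length a + J * n"
  have n1: "n \<ge> 1" using S by (simp add: flat_set_def)
  have Jn: "J \<le> J * n" "n \<le> J * n" using mult_le_mono2[OF n1, of J] by (simp_all add: J_def)
  have M1: "M \<ge> 1" "n \<le> M" using Jn by (simp_all add: M_def J_def)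
  obtain \<beta> where \<beta>: "\<beta> \<in> S" using S by (auto simp: flat_set_def)
  have codeJ: "gcode M z" if z: "(stepR S ^^ J) v z" for z
  proof -
    obtain s where s: "z = ext v s" "length s = J * n" "s = [] \<or> bridge s" "ht s \<ge> int J"
      "\<And>i. \<bar>fst (pos s i)\<bar> \<le> int n"
      using flat_blocks[OF S v_ne z] by blast
    have bs: "bridge s" using s(3,4) by (auto simp: J_def)
    have h: "half (a @ s)" using half_append_strip[OF a(2) _ s(3,5)] v(2) a(1) by simp
    have ha: "ht (take i a) \<le> int (length a)" for i
    proof -
      have "set (take i a) \<subseteq> dirs" using half_saw[OF a(2)] set_take_subset by (fastforce simp: saw_steps_def)
      then show ?thesis using abs_ht_le[of "take i a"] by simp
    qed
    have ha0: "0 \<le> ht a"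
      using half_ht_nonneg[OF a(2), of "length a"] by simp
    have "bridge (a @ s)"
      unfolding bridge_def
    proof (intro conjI ballI)
      show "saw_steps (a @ s)" by (rule half_saw[OF h])
      show "a @ s \<noteq> []" using bridge_ne[OF bs] by simp
      fix i assume i: "i \<in> {1..length (a @ s)}"
      show "0 < ht (take i (a @ s))" using h i unfolding half_def by blast
      show "ht (take i (a @ s)) \<le> ht (a @ s)"
      proof (cases "i \<le> length a")
        case True
        then show ?thesis using ha[of i] ha0 s(4) by (simp add: ht_append J_def)
      next
        case False
        then have "1 \<le> i - length a" "i - length a \<le> length s" using i by auto
        then show ?thesis using ht_take_bridge[OF bs, of "i - length a"] False by (simp add: ht_append)
      qed
    qed
    moreover have "length (a @ s) \<le> M" using s(2) by (simp add: M_def)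
    ultimately have "gcode M (ext [ast] (a @ s))" by (intro gcode_bridge) auto
    moreover have "ext [ast] (a @ s) = z"
      using ext_walk[of ast "[]" "a @ s"] ext_walk[of ast a s] a(1) s(1) by simp
    ultimately show ?thesis by simp
  qed
  have code_ge: "gcode M z" if "(stepR S ^^ (J + i)) v z" for i z
    using that
  proof (induction i arbitrary: z)
    case 0 then show ?case using codeJ by simp
  next
    case (Suc i)
    from Suc.prems obtain y where y: "(stepR S ^^ (J + i)) v y" "stepR S y z"
      by (auto elim: relpowp_Suc_E)
    obtain b where b: "b \<in> S" "z = ext y b" using y(2) unfolding stepR_def by blast
    have "bridge b" "length b \<le> M" using S b(1) M1 by (auto simp: flat_set_def)
    then show ?case using gcode_bridge[OF Suc.IH[OF y(1)]] b(2) by simp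
  qed
  \<comment> \<open>Words with fewer than \<open>J\<close> blocks lie in the good tree as prefixes
    of longer ones, obtained by repeating one fixed block.\<close>
  have extend: "\<exists>z'. (stepR S ^^ (j + i)) v z' \<and> prefix z z'" if z: "(stepR S ^^ j) v z" for i j z
  proof (induction i)
    case 0 then show ?case using z by auto
  next
    case (Suc i)
    then obtain z' where z': "(stepR S ^^ (j + i)) v z'" "prefix z z'" by blast
    have "stepR S z' (ext z' \<beta>)" unfolding stepR_def using \<beta> by blast
    then have "(stepR S ^^ Suc (j + i)) v (ext z' \<beta>)" using z'(1) by (intro relpowp_Suc_I)
    then show ?case using prefix_order.trans[OF z'(2) prefix_ext[of z' \<beta>]] by auto
  qed
  have in_T: "z \<in> good_tree M" if z: "(stepR S)\<^sup>*\<^sup>* v z" for z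
  proof -
    obtain j where j: "(stepR S ^^ j) v z" using rtranclp_imp_relpowp[OF z] by blast
    obtain z' where z': "(stepR S ^^ (j + J)) v z'" "prefix z z'" using extend[OF j, of J] by blast
    have "gcode M z'" using code_ge[of j z'] z'(1) by (simp add: add.commute)
    moreover have "z \<noteq> []" using flat_blocks[OF S v_ne j] v_ne by (auto simp: ext_def)
    ultimately show ?thesis unfolding good_tree_iff[OF M1(1)] using z'(2) by blast
  qed
  interpret walk_tree "good_tree M" ast by (rule good_walk_tree[OF M1(1)])
  have "code_tree (good_tree M) ast v S n lam"
  proof
    show "v \<in> good_tree M" by (rule in_T) simp
    show "finite S" by (rule finite_subset[OF _ finite_bridges(4)[of n]]) (use S in \<open>auto simp: flat_set_def\<close>)
    show "[] \<notin> S" using S n1 by (auto simp: flat_set_def)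
    show "length s \<le> n" if "s \<in> S" for s using S that by (auto simp: flat_set_def)
    show "z \<in> good_tree M" if "(stepR S)\<^sup>*\<^sup>* v z" for z by (rule in_T[OF that])
    show "y = y'" if st: "stepR S y z" "stepR S y' z" for y y' z
    proof -
      have pl: "prefix x z \<and> length z = length x + n" if "stepR S x z" for x
      proof -
        obtain s where "s \<in> S" "z = ext x s" using \<open>stepR S x z\<close> unfolding stepR_def by blast
        then show ?thesis using S prefix_ext[of x s] by (auto simp: flat_set_def)
      qed
      have "prefix y y'"
        using prefix_length_prefix[of y z y'] pl[OF st(1)] pl[OF st(2)] by simp
      then show ?thesis using prefix_same_length[of y y'] pl[OF st(1)] pl[OF st(2)] by simp
    qed
  qed (rule lam)
  then show ?thesis using that M1(1) by blast
qed


section \<open>Approximation of the self-avoiding tree by good trees\<close>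

locale supercritical =
  fixes lam :: real
  assumes lam: "lam > inverse connective_constant"
begin

lemma lam_pos: "0 < lam"
proof -
  have "0 < inverse connective_constant" using connective_constant_ge_1 by simp
  then show ?thesis using lam by linarith
qed

abbreviation "e \<equiv> esc saw_tree lam"
abbreviation "em m \<equiv> esc (good_tree m) lam"

definition einf :: "point list \<Rightarrow> real" where
  "einf v = (SUP m\<in>{1..}. em m v)"

lemma bdd_em: "bdd_above ((\<lambda>m. em m v) ` {1..})"
  by (intro bdd_aboveI[where M = 1]) auto

lemma em_mono: "1 \<le> m \<Longrightarrow> m \<le> n \<Longrightarrow> em m v \<le> em n v"
  using lam_pos by (intro esc_mono good_tree_mono finite_children_subset good_tree_subset) auto

lemma em_le_einf: "1 \<le> m \<Longrightarrow> em m v \<le> einf v"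
  unfolding einf_def by (intro cSUP_upper bdd_em) auto

lemma einf_nonneg: "0 \<le> einf v"
  using em_le_einf[of 1 v] esc_nonneg[of "good_tree 1" lam v] by linarith

lemma em_le_e: "em m v \<le> e v"
  using lam_pos by (intro esc_mono finite_saw_children good_tree_subset) auto

lemma einf_le_e: "einf v \<le> e v"
  unfolding einf_def using em_le_e by (intro cSUP_least) auto

lemma em_tendsto: "(\<lambda>m. em m v) \<longlonglongrightarrow> einf v"
proof -
  have "(\<lambda>m. em (Suc m) v) \<longlonglongrightarrow> (SUP m. em (Suc m) v)"
    by (rule LIMSEQ_incseq_SUP) (auto intro!: incseq_SucI em_mono bdd_aboveI[where M = 1])
  moreover have "(SUP m. em (Suc m) v) = einf v"
  proof -
    have r: "{1..} = range Suc" by (auto simp: image_iff Suc_le_eq gr0_conv_Suc)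
    show ?thesis unfolding einf_def r image_image ..
  qed
  ultimately have "(\<lambda>m. em (Suc m) v) \<longlonglongrightarrow> einf v" by simp
  then show ?thesis by (rule LIMSEQ_imp_Suc)
qed

lemma sum_children_good: "sum (em m) (children (good_tree m) v) = sum (em m) (children saw_tree v)"
proof (rule sum.mono_neutral_left[OF finite_saw_children])
  show "children (good_tree m) v \<subseteq> children saw_tree v"
    using good_tree_subset[of m] by (auto simp: children_def)
  show "\<forall>u\<in>children saw_tree v - children (good_tree m) v. em m u = 0"
    using esc_outside[of _ "good_tree m" lam] unfolding children_def by blast
qed

lemma em_eq:
  assumes "1 \<le> m" "v \<in> saw_tree"
  shows "em m v = netf (lam * sum (em m) (children saw_tree v))"
proof (cases "v \<in> good_tree m")
  case True
  show ?thesis using esc_eq[OF less_imp_le[OF lam_pos] True] unfolding sum_children_good .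
next
  case False
  interpret g: walk_tree "good_tree m" ast by (rule good_walk_tree[OF assms(1)])
  have v_ne: "v \<noteq> []" using assms(2) saw_tree_hd by blast
  have "em m u = 0" if "u \<in> children saw_tree v" for u
  proof (rule esc_outside)
    have "prefix v u" using that by (auto simp: children_def)
    then show "u \<notin> good_tree m" using g.prefix_in_T False v_ne by blast
  qed
  then have "sum (em m) (children saw_tree v) = 0" by (intro sum.neutral) blast
  then show ?thesis using esc_outside[OF False, of lam] by simp
qed

text \<open>Vertices have finitely many children and \<open>netf\<close> is continuous on
  nonnegative arguments, so the equation survives the limit. This does not yet show that the limit
  is the maximal solution.\<close>

lemma einf_eq:
  assumes v: "v \<in> saw_tree"
  shows "einf v = netf (lam * sum einf (children saw_tree v))"
proof -
  let ?S = "lam * sum einf (children saw_tree v)"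
  have S: "0 \<le> ?S" using lam_pos einf_nonneg by (simp add: sum_nonneg)
  have "(\<lambda>m. netf (lam * sum (em m) (children saw_tree v))) \<longlonglongrightarrow> netf ?S"
    unfolding netf_def using S by (intro tendsto_intros em_tendsto) auto
  moreover have "\<forall>\<^sub>F m in sequentially. netf (lam * sum (em m) (children saw_tree v)) = em m v"
    using eventually_ge_at_top[of 1] by eventually_elim (simp add: em_eq[OF _ v])
  ultimately have "(\<lambda>m. em m v) \<longlonglongrightarrow> netf ?S" by (rule Lim_transform_eventually)
  then show ?thesis using em_tendsto LIMSEQ_unique by blast
qed

lemma e_eq: "v \<in> saw_tree \<Longrightarrow> e v = netf (lam * sum e (children saw_tree v))"
  by (rule esc_eq[OF less_imp_le[OF lam_pos]])

lemma einf_child: "v \<in> saw_tree \<Longrightarrow> u \<in> children saw_tree v \<Longrightarrow> netf (lam * einf u) \<le> einf v"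
  unfolding einf_eq[of v] using lam_pos einf_nonneg finite_saw_children
  by (intro netf_mono mult_left_mono member_le_sum) auto

text \<open>A parameter \<open>lam'\<close> strictly between the critical value and
  \<open>lam\<close> leaves the gap for \<open>esc_ge_flow\<close>. The truncation depends on
  \<open>v\<close>, but the bound depends only on \<open>n\<close>, \<open>S\<close> and the two
  parameters, hence is uniform.\<close>

lemma strip_lower_bound:
  "\<exists>n. \<exists>\<delta>>0. \<forall>v\<in>saw_tree. strip_free n v \<longrightarrow> \<delta> \<le> einf v"
proof -
  obtain lam' where l: "inverse connective_constant < lam'" "lam' < lam" using dense[OF lam] by blast
  have l0: "0 < lam'"
  proof -
    have "0 < inverse connective_constant" using connective_constant_ge_1 by simp
    then show ?thesis using l by linarith
  qed
  obtain n S where S: "S \<subseteq> {s. bridge s \<and> length s = n \<and> fst (sum_list s) = 0}" "n \<ge> 1"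
    "1 \<le> real (card S) * lam' ^ n"
    by (rule flat_bridges[OF l(1)])
  have ne: "S \<noteq> {}" using S(3) by auto
  have fs: "flat_set n S" unfolding flat_set_def using S ne by simp
  have "gf lam' S = (\<Sum>s\<in>S. lam' ^ n)" unfolding gf_def using S(1) by (intro sum.cong) auto
  then have gf1: "1 \<le> gf lam' S" using S(3) by simp
  define B where "B = 1 + real n * (max 1 (1 / lam') ^ n * gf lam' S)"
  have B: "0 < B" using gf1 by (auto simp: B_def intro!: add_pos_nonneg mult_nonneg_nonneg)
  have "(1 - lam' / lam) / B \<le> einf v" if v: "v \<in> saw_tree" "strip_free n v" for v
  proof -
    obtain M where M: "M \<ge> 1" "code_tree (good_tree M) ast v S n lam'"
      by (rule strip_code_tree[OF fs v l0])
    interpret c: code_tree "good_tree M" ast v S n lam' by (rule M(2))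
    have "(1 - lam' / lam) * c.flow_h v / c.flow_bound \<le> em M v" by (rule c.esc_ge_flow_h[OF gf1 l(2)])
    then have "(1 - lam' / lam) / B \<le> em M v" by (simp add: c.flow_h_v0 c.flow_bound_def B_def)
    then show ?thesis using em_le_einf[OF M(1), of v] by linarith
  qed
  moreover have "(1 - lam' / lam) / B > 0" using B l l0 by simp
  ultimately show ?thesis by blast
qed

text \<open>The root is excluded because a horizontal step from \<open>ast\<close> is not allowed;
  \<open>a\<close> selects a right or left record.\<close>

definition record_walk :: "point list \<Rightarrow> bool" where
  "record_walk w \<longleftrightarrow> w \<in> saw_tree \<and> w \<noteq> [ast] \<and>
     ((\<forall>p\<in>set (butlast w). snd p < snd (last w)) \<or>
      (\<exists>a\<in>{1, -1 :: int}. \<forall>p\<in>set (butlast w). a * fst p < a * fst (last w)))"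

lemma set_butlast_last: "w \<noteq> [] \<Longrightarrow> set w = insert (last w) (set (butlast w))"
  by (metis append_butlast_last_id list.set(1) list.set(2) set_append Un_insert_right Un_empty_right)

text \<open>Past a horizontal record all further sites in that direction are free, and the added
  sites have the height of the endpoint, so any higher site was already in \<open>w\<close>.\<close>

lemma sideways:
  assumes w: "w \<in> saw_tree" "w \<noteq> [ast]" and a: "a \<in> {1, -1 :: int}"
    and rec: "\<forall>p\<in>set (butlast w). a * fst p < a * fst (last w)"
  defines "W \<equiv> \<lambda>k. ext w (replicate k (a, 0))"
  shows "W k \<in> saw_tree \<and> last (W k) = last w + (int k * a, 0) \<and>
    (\<forall>p\<in>set (W k). a * fst p \<le> a * fst (last (W k))) \<and>
    (\<forall>p\<in>set (W k). snd p \<noteq> snd (last w) \<longrightarrow> p \<in> set w)"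
proof (induction k)
  case 0
  have w_ne: "w \<noteq> []" using w saw_tree_hd by blast
  show ?case using w rec set_butlast_last[OF w_ne] by (auto simp: W_def zero_prod_def[symmetric] less_imp_le)
next
  case (Suc k)
  have w_ne: "w \<noteq> []" using w saw_tree_hd by blast
  have Wk_ne: "W k \<noteq> []" using w_ne by (simp add: W_def ext_def)
  let ?d = "last (W k) + (a, 0)"
  have Wsuc: "W (Suc k) = W k @ [?d]"
  proof -
    have "W (Suc k) = ext (W k) [(a, 0)]"
      using w_ne by (simp add: W_def ext_ext replicate_append_same)
    then show ?thesis using ext_single[OF Wk_ne] by simp
  qed
  have lt: "a * fst p < a * fst ?d" if "p \<in> set (W k)" for p
  proof -
    have "a * fst p \<le> a * fst (last (W k))" using Suc that by blast
    then show ?thesis using a by auto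
  qed
  have "W (Suc k) \<in> saw_tree"
  proof -
    obtain s where s: "W k = walk ast s" "half s" using Suc by (auto simp: saw_tree_eq)
    have Ws: "W (Suc k) = walk ast (s @ [(a, 0)])"
      unfolding Wsuc s(1) by (simp add: walk_append last_walk)
    have s_ne: "s \<noteq> []"
    proof
      assume "s = []"
      then have "length (W k) = 1" using s by simp
      then have "length w = 1" using w_ne by (cases w) (auto simp: W_def)
      then show False using w saw_tree_hd[of w] by (cases w) auto
    qed
    have "(a, 0) \<in> dirs" using a by (auto simp: dirs_def)
    moreover have "distinct (W (Suc k))"
    proof -
      have "?d \<notin> set (W k)" using lt by blast
      moreover have "distinct (W k)" using Suc by (simp add: saw_tree_def self_avoiding_walk_def)
      ultimately show ?thesis by (simp add: Wsuc)
    qed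
    moreover have "successively lattice_adj (W (Suc k))"
      unfolding Ws successively_walk using \<open>(a, 0) \<in> dirs\<close> half_saw[OF s(2)] by (simp add: saw_steps_def)
    ultimately have "saw_steps (s @ [(a, 0)])"
      using saw_walk[of ast "s @ [(a, 0)]"] by (simp add: self_avoiding_walk_def Ws)
    moreover have "0 < ht (take i (s @ [(a, 0)]))" if i: "i \<in> {1..length (s @ [(a, 0)])}" for i
    proof (cases "i \<le> length s")
      case True
      then show ?thesis using s(2) i by (auto simp: half_def)
    next
      case False
      have "length s \<in> {1..length s}" using s_ne by (simp add: Suc_le_eq)
      then have "0 < ht (take (length s) s)" using s(2) unfolding half_def by blast
      then show ?thesis using False i by (simp add: ht_append) (simp add: ht_def)
    qed
    ultimately have "half (s @ [(a, 0)])" unfolding half_def by blast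
    then show ?thesis unfolding Ws walk_in_saw_tree .
  qed
  moreover have "last (W (Suc k)) = last w + (int (Suc k) * a, 0)"
    using Suc by (simp add: Wsuc algebra_simps)
  moreover have "\<forall>p\<in>set (W (Suc k)). a * fst p \<le> a * fst (last (W (Suc k)))"
    using lt by (auto simp: Wsuc less_imp_le)
  moreover have "\<forall>p\<in>set (W (Suc k)). snd p \<noteq> snd (last w) \<longrightarrow> p \<in> set w"
    using Suc by (auto simp: Wsuc)
  ultimately show ?case by blast
qed

text \<open>A highest record has a free strip above it at once. A horizontal record gets one after
  \<open>Suc n\<close> sideways steps, which put every higher site at horizontal distance more than
  \<open>n\<close>.\<close>

lemma record_lower_bound:
  "\<exists>\<delta>>0. \<forall>w. record_walk w \<longrightarrow> \<delta> \<le> einf w"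
proof -
  obtain n \<delta> where \<delta>: "\<delta> > 0" "\<And>v. v \<in> saw_tree \<Longrightarrow> strip_free n v \<Longrightarrow> \<delta> \<le> einf v"
    using strip_lower_bound by blast
  \<comment> \<open>By \<open>einf_child\<close>, going back one step to the parent costs at most
    one application of \<open>f\<close>; \<open>Suc n\<close> applications bring the bound back to
    \<open>w\<close>.\<close>
  define f where "f x = netf (lam * x)" for x
  have f_pos: "0 < f x" if "0 < x" for x using that lam_pos by (simp add: f_def netf_def add_pos_pos)
  have f_mono: "f x \<le> f y" if "0 \<le> x" "x \<le> y" for x y
    unfolding f_def using that lam_pos by (intro netf_mono) auto
  have fpow: "0 < (f ^^ k) \<delta>" for k by (induction k) (use \<delta>(1) f_pos in auto)
  have "min \<delta> ((f ^^ Suc n) \<delta>) \<le> einf w" if w: "record_walk w" for w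
  proof -
    have wT: "w \<in> saw_tree" "w \<noteq> [ast]" using w by (auto simp: record_walk_def)
    have w_ne: "w \<noteq> []" using wT saw_tree_hd by blast
    consider (top) "\<forall>p\<in>set (butlast w). snd p < snd (last w)"
      | (side) a where "a \<in> {1, -1 :: int}" "\<forall>p\<in>set (butlast w). a * fst p < a * fst (last w)"
      using w unfolding record_walk_def by blast
    then show ?thesis
    proof cases
      case top
      then have "strip_free n w" using set_butlast_last[OF w_ne] by (auto simp: strip_free_def)
      then show ?thesis using \<delta>(2)[OF wT(1)] by simp
    next
      case side
      define W where "W k = ext w (replicate k (a, 0))" for k
      note sw = sideways[OF wT side, folded W_def]
      have WT: "W k \<in> saw_tree" for k using sw by blast
      have child: "W (Suc k) \<in> children saw_tree (W k)" for k
      proof -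
        have "W k \<noteq> []" using w_ne by (simp add: W_def ext_def)
        moreover have "W (Suc k) = ext (W k) [(a, 0)]"
          using w_ne by (simp add: W_def ext_ext replicate_append_same)
        ultimately show ?thesis using WT[of "Suc k"] by (simp add: children_def ext_single)
      qed
      have sf: "strip_free n (W (Suc n))"
        unfolding strip_free_def
      proof (intro ballI impI)
        fix p assume p: "p \<in> set (W (Suc n))" "snd (last (W (Suc n))) < snd p"
        have l: "last (W (Suc n)) = last w + (int (Suc n) * a, 0)" using sw by blast
        then have "snd p \<noteq> snd (last w)" using p(2) by simp
        then have "p \<in> set w" using sw p(1) by blast
        then have "a * fst p \<le> a * fst (last w)"
          using side(2) set_butlast_last[OF w_ne] by (auto simp: less_imp_le)
        moreover have "fst (last (W (Suc n))) = fst (last w) + int (Suc n) * a" using l by simp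
        ultimately show "int n < \<bar>fst p - fst (last (W (Suc n)))\<bar>" using side(1) by auto
      qed
      have "(f ^^ i) \<delta> \<le> einf (W (Suc n - i))" if "i \<le> Suc n" for i
        using that
      proof (induction i)
        case 0
        show ?case using \<delta>(2)[OF WT sf] by simp
      next
        case (Suc i)
        have "(f ^^ Suc i) \<delta> \<le> f (einf (W (Suc n - i)))"
          using Suc fpow[of i] by (simp add: f_mono)
        also have "Suc n - i = Suc (Suc n - Suc i)" using Suc.prems by simp
        also have "f (einf (W (Suc (Suc n - Suc i)))) \<le> einf (W (Suc n - Suc i))"
          unfolding f_def by (rule einf_child[OF WT child])
        finally show ?case .
      qed
      from this[of "Suc n"] have "(f ^^ Suc n) \<delta> \<le> einf (W 0)" by simp
      then show ?thesis by (simp add: W_def)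
    qed
  qed
  moreover have "0 < min \<delta> ((f ^^ Suc n) \<delta>)" using \<delta>(1) fpow[of "Suc n"] by simp
  ultimately show ?thesis by blast
qed

text \<open>
  A walk that leaves a box for the first time is a record, so a comparison on records
  propagates down to the root through the finitely many walks that stay in the box.
\<close>

lemma record_comparison:
  assumes \<theta>: "0 \<le> \<theta>" "\<theta> \<le> 1" and rec: "\<And>w. record_walk w \<Longrightarrow> \<theta> * e w \<le> einf w"
    and v: "v \<in> saw_tree"
  shows "\<theta> * e v \<le> einf v"
proof -
  define L where "L = Max ((\<lambda>p. \<bar>fst p\<bar> + \<bar>snd p\<bar>) ` set v)"
  define B where "B = {- L..L} \<times> {-1..L}"
  have v_ne: "v \<noteq> []" using v saw_tree_hd by blast
  have snd_ge: "-1 \<le> snd p" if p: "p \<in> set w" and wT: "w \<in> saw_tree" for p w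
  proof -
    obtain s where s: "w = walk ast s" "half s" using wT by (auto simp: saw_tree_eq)
    obtain i where "i \<le> length s" "p = ast + pos s i"
      using p s(1) by (auto simp: in_set_conv_nth nth_walk less_Suc_eq_le)
    then show ?thesis using half_ht_nonneg[OF s(2), of i] by (simp add: ht_take ast_def)
  qed
  have "set v \<subseteq> B"
  proof
    fix p assume p: "p \<in> set v"
    have "\<bar>fst p\<bar> + \<bar>snd p\<bar> \<le> L" unfolding L_def using p by (intro Max_ge) auto
    then show "p \<in> B" using snd_ge[OF p v] by (auto simp: B_def mem_Times_iff)
  qed
  have finB: "finite B" by (simp add: B_def)
  have "\<theta> * e w \<le> einf w" if "w \<in> saw_tree" "set w \<subseteq> B" for w
    using that
  proof (induction "card B - length w" arbitrary: w rule: less_induct)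
    case less
    have w_ne: "w \<noteq> []" using less.prems saw_tree_hd by blast
    have child: "\<theta> * e u \<le> einf u" if u: "u \<in> children saw_tree w" for u
    proof -
      obtain d where d: "u = w @ [d]" "u \<in> saw_tree" using u by (auto simp: children_def)
      show ?thesis
      proof (cases "d \<in> B")
        case True
        then have uB: "set u \<subseteq> B" using d less.prems by simp
        have "distinct u" using d(2) by (simp add: saw_tree_def self_avoiding_walk_def)
        then have "length u \<le> card B" using card_mono[OF finB uB] by (simp add: distinct_card)
        then have "card B - length u < card B - length w" using d(1) by simp
        then show ?thesis using less.hyps d(2) uB by blast
      next
        case False
        have "-1 \<le> snd d" using snd_ge[OF _ d(2)] d(1) by simp
        then have out: "snd d > L \<or> 1 * fst d > L \<or> -1 * fst d > L"
          using False by (cases d) (auto simp: B_def)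
        have in_box: "snd p \<le> L \<and> 1 * fst p \<le> L \<and> -1 * fst p \<le> L" if "p \<in> set w" for p
          using less.prems(2) that by (force simp: B_def)
        have "record_walk u"
          unfolding record_walk_def
        proof (intro conjI)
          show "u \<noteq> [ast]" using d(1) w_ne by simp
          have bl: "butlast u = w" "last u = d" using d(1) by simp_all
          have "(\<forall>p\<in>set w. snd p < snd d) \<or>
              (\<exists>a\<in>{1, -1 :: int}. \<forall>p\<in>set w. a * fst p < a * fst d)"
            using out
          proof (elim disjE)
            assume "snd d > L"
            then have "\<forall>p\<in>set w. snd p < snd d" using in_box by force
            then show ?thesis by blast
          next
            assume "1 * fst d > L"
            then have "\<forall>p\<in>set w. 1 * fst p < 1 * fst d" using in_box by force
            then show ?thesis by blast
          next
            assume "-1 * fst d > L"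
            then have "\<forall>p\<in>set w. -1 * fst p < -1 * fst d" using in_box by force
            then show ?thesis by blast
          qed
          then show "(\<forall>p\<in>set (butlast u). snd p < snd (last u)) \<or>
              (\<exists>a\<in>{1, -1 :: int}. \<forall>p\<in>set (butlast u). a * fst p < a * fst (last u))"
            unfolding bl .
        qed (rule d(2))
        then show ?thesis by (rule rec)
      qed
    qed
    let ?S = "lam * sum e (children saw_tree w)"
    have S: "0 \<le> ?S" using lam_pos by simp
    \<comment> \<open>Concavity of \<open>netf\<close> with value 0 at 0.\<close>
    have "\<theta> * netf ?S \<le> netf (\<theta> * ?S)"
    proof -
      have "0 \<le> \<theta> * ?S" using \<theta> S by simp
      moreover have "\<theta> * ?S \<le> ?S" using \<theta> S by (simp add: mult_left_le_one_le)
      ultimately have "(\<theta> * ?S) / (1 + ?S) \<le> (\<theta> * ?S) / (1 + \<theta> * ?S)"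
        using S by (intro divide_left_mono mult_pos_pos add_pos_nonneg) auto
      then show ?thesis by (simp add: netf_def)
    qed
    also have "\<dots> \<le> netf (lam * sum einf (children saw_tree w))"
    proof (rule netf_mono)
      have "\<theta> * ?S = lam * (\<Sum>u\<in>children saw_tree w. \<theta> * e u)"
        by (simp add: sum_distrib_left[symmetric])
      also have "\<dots> \<le> lam * sum einf (children saw_tree w)"
        using child lam_pos by (intro mult_left_mono sum_mono) auto
      finally show "\<theta> * ?S \<le> lam * sum einf (children saw_tree w)" .
    qed (use \<theta> S in simp)
    finally show ?case using e_eq[OF less.prems(1)] einf_eq[OF less.prems(1)] by simp
  qed
  then show ?thesis using v \<open>set v \<subseteq> B\<close> by blast
qed

text \<open>A uniqueness argument for positive solutions: the best constant \<open>t\<close> with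
  \<open>t * e \<le> einf\<close> is positive by the bound on records, and if it were below 1 the
  strict concavity of \<open>netf\<close> on records would improve it.\<close>

lemma einf_eq_e:
  assumes v: "v \<in> saw_tree"
  shows "einf v = e v"
proof -
  obtain \<delta> where \<delta>: "\<delta> > 0" "\<And>w. record_walk w \<Longrightarrow> \<delta> \<le> einf w" using record_lower_bound by blast
  define Q where "Q = {\<theta>. 0 \<le> \<theta> \<and> \<theta> \<le> 1 \<and> (\<forall>v\<in>saw_tree. \<theta> * e v \<le> einf v)}"
  define t where "t = Sup Q"
  have Q0: "0 \<in> Q" using einf_nonneg by (simp add: Q_def)
  have bdd: "bdd_above Q" by (intro bdd_aboveI[where M = 1]) (auto simp: Q_def)
  have t01: "0 \<le> t" "t \<le> 1"
    unfolding t_def using cSup_upper[OF Q0 bdd] Q0 by (auto intro!: cSup_least simp: Q_def)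
  have tQ: "t * e v \<le> einf v" if v: "v \<in> saw_tree" for v
  proof (cases "e v = 0")
    case False
    then have ev: "0 < e v" by (simp add: order_less_le)
    have "t \<le> einf v / e v"
      unfolding t_def
    proof (rule cSup_least)
      show "Q \<noteq> {}" using Q0 by blast
      show "\<theta> \<le> einf v / e v" if "\<theta> \<in> Q" for \<theta>
        using that v ev by (simp add: Q_def pos_le_divide_eq)
    qed
    then show ?thesis using ev by (simp add: pos_le_divide_eq)
  qed (use einf_nonneg in simp)
  \<comment> \<open>The quotient of \<open>netf (\<theta> * S)\<close> and \<open>netf S\<close> is
    \<open>\<theta> * (1 + S) / (1 + \<theta> * S)\<close>, which increases with \<open>S\<close>;
    on records \<open>S \<ge> \<delta>\<close>, and inserting \<open>\<delta>\<close> gives the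
    stated factor.\<close>
  have improve: "(\<theta> * (1 + \<delta>) / (1 + \<theta> * \<delta>)) * e w \<le> einf w"
    if \<theta>: "0 \<le> \<theta>" "\<theta> \<le> 1" "\<And>v. v \<in> saw_tree \<Longrightarrow> \<theta> * e v \<le> einf v" and w: "record_walk w" for \<theta> w
  proof -
    have wT: "w \<in> saw_tree" using w by (simp add: record_walk_def)
    let ?S = "lam * sum e (children saw_tree w)"
    have S0: "0 \<le> ?S" using lam_pos by simp
    have "\<delta> \<le> e w" using \<delta>(2)[OF w] einf_le_e[of w] by linarith
    also have "e w \<le> ?S" unfolding e_eq[OF wT] by (rule netf_bounds(3)[OF S0])
    finally have S\<delta>: "\<delta> \<le> ?S" .
    have sub: "\<theta> * ?S \<le> lam * sum einf (children saw_tree w)"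
    proof -
      have "\<theta> * ?S = lam * (\<Sum>u\<in>children saw_tree w. \<theta> * e u)"
        by (simp add: sum_distrib_left[symmetric])
      also have "\<dots> \<le> lam * sum einf (children saw_tree w)"
        using \<theta>(3) lam_pos by (intro mult_left_mono sum_mono) (auto simp: children_def)
      finally show ?thesis .
    qed
    have "(\<theta> * (1 + \<delta>) / (1 + \<theta> * \<delta>)) * (S / (1 + S)) \<le> \<theta> * S / (1 + \<theta> * S)" if S: "\<delta> \<le> S" for S
    proof -
      have p: "0 < 1 + \<theta> * \<delta>" "0 < 1 + S" "0 < 1 + \<theta> * S"
        using \<theta> \<delta>(1) S by (auto intro!: add_pos_nonneg)
      have "0 \<le> (1 - \<theta>) * (S - \<delta>)" using \<theta> S by simp
      then have "(1 + \<delta>) * (1 + \<theta> * S) \<le> (1 + \<theta> * \<delta>) * (1 + S)" by (simp add: algebra_simps)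
      then have "\<theta> * S * ((1 + \<delta>) * (1 + \<theta> * S)) \<le> \<theta> * S * ((1 + \<theta> * \<delta>) * (1 + S))"
        using \<theta> \<delta>(1) S by (intro mult_left_mono) auto
      moreover have "(\<theta> * (1 + \<delta>) / (1 + \<theta> * \<delta>)) * (S / (1 + S)) = \<theta> * S * (1 + \<delta>) / ((1 + \<theta> * \<delta>) * (1 + S))"
        by simp
      ultimately show ?thesis using p by (simp add: frac_le_eq divide_le_eq pos_le_divide_eq mult_ac)
    qed
    from this[OF S\<delta>] have "(\<theta> * (1 + \<delta>) / (1 + \<theta> * \<delta>)) * netf ?S \<le> netf (\<theta> * ?S)" by (simp only: netf_def)
    also have "\<dots> \<le> netf (lam * sum einf (children saw_tree w))"
      using sub \<theta> S0 by (intro netf_mono) auto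
    finally show ?thesis unfolding e_eq[OF wT] einf_eq[OF wT] .
  qed
  have upd: "\<theta> * (1 + \<delta>) / (1 + \<theta> * \<delta>) \<in> {0..1}" if "0 \<le> \<theta>" "\<theta> \<le> 1" for \<theta>
  proof -
    have "0 < 1 + \<theta> * \<delta>" using that \<delta>(1) by (intro add_pos_nonneg) auto
    then show ?thesis using that \<delta>(1) by (simp add: divide_le_eq algebra_simps)
  qed
  have "min 1 \<delta> * e w \<le> einf w" if "record_walk w" for w
  proof -
    have "min 1 \<delta> * e w \<le> \<delta> * 1" using \<delta>(1) by (intro mult_mono) auto
    then show ?thesis using \<delta>(2)[OF that] by simp
  qed
  then have "min 1 \<delta> \<in> Q"
    unfolding Q_def using record_comparison[of "min 1 \<delta>"] \<delta>(1) by auto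
  then have t_pos: "0 < t" unfolding t_def using cSup_upper[OF _ bdd] \<delta>(1) by (metis min_less_iff_conj less_le_trans zero_less_one)
  \<comment> \<open>The improvement holds on records only; \<open>record_comparison\<close> extends
    it to every vertex, so the improved constant competes with the supremum
    \<open>t\<close>.\<close>
  have "t * (1 + \<delta>) / (1 + t * \<delta>) \<in> Q"
    unfolding Q_def using upd[OF t01] record_comparison[OF _ _ improve[OF t01 tQ]] by auto
  then have "t * (1 + \<delta>) / (1 + t * \<delta>) \<le> t" unfolding t_def by (rule cSup_upper[OF _ bdd])
  moreover have "0 < 1 + t * \<delta>" using t_pos \<delta>(1) by (intro add_pos_pos) auto
  ultimately have "t * (1 + \<delta>) \<le> t * (1 + t * \<delta>)" by (simp add: pos_divide_le_eq)
  then have "1 \<le> t" using t_pos \<delta>(1) by simp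
  then have "t = 1" using t01 by simp
  then show ?thesis using tQ[OF v] einf_le_e[of v] by simp
qed

lemma em_tendsto_e: "v \<in> saw_tree \<Longrightarrow> (\<lambda>m. em m v) \<longlonglongrightarrow> e v"
  using em_tendsto[of v] einf_eq_e[of v] by simp

text \<open>The one-step walk to the origin is a record, which makes the walk on the full tree
  transient.\<close>

lemma e_root_pos: "0 < e [ast]"
proof -
  obtain \<delta> where \<delta>: "\<delta> > 0" "\<And>w. record_walk w \<Longrightarrow> \<delta> \<le> einf w" using record_lower_bound by blast
  let ?w = "walk ast [(0, 1)]"
  have wT: "?w \<in> saw_tree" unfolding walk_in_saw_tree by (rule half_up)
  have "record_walk ?w" using wT by (auto simp: record_walk_def ast_def)
  then have "0 < einf ?w" using \<delta> by (meson less_le_trans)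
  moreover have "?w \<in> children saw_tree [ast]" using wT by (simp add: children_def)
  ultimately have "0 < netf (lam * einf ?w)" "netf (lam * einf ?w) \<le> einf [ast]"
    using lam_pos einf_child[OF saw.root_in, of ?w] by (auto simp: netf_def intro!: divide_pos_pos add_pos_pos)
  then show ?thesis using einf_le_e[of "[ast]"] by linarith
qed

lemma em_root_pos: "\<forall>\<^sub>F m in sequentially. 0 < em m [ast] \<and> 1 \<le> m"
  using order_tendstoD(1)[OF em_tendsto_e[OF saw.root_in] e_root_pos] eventually_ge_at_top[of 1]
  by eventually_elim simp

text \<open>Induction along \<open>\<gamma>\<close>: the conditional probability of the last step is
  a quotient of escape probabilities, each of which converges by
  \<open>em_tendsto_e\<close>.\<close>

lemma phi_good_tendsto_phi: "\<gamma> \<in> saw_tree \<Longrightarrow> (\<lambda>m. phi_good lam m \<gamma>) \<longlonglongrightarrow> phi lam \<gamma>"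
proof (induction \<gamma> rule: rev_induct)
  case Nil
  then show ?case using saw_tree_hd by blast
next
  case (snoc d v)
  let ?w = "v @ [d]"
  show ?case
  proof (cases "?w = [ast]")
    case True
    have "\<forall>\<^sub>F m in sequentially. phi_good lam m [ast] = 1"
      using em_root_pos
    proof eventually_elim
      case (elim m)
      interpret g: walk_tree "good_tree m" ast by (rule good_walk_tree) (use elim in simp)
      show ?case unfolding phi_good_def using g.limit_walk_prob_root[OF lam_pos] elim by blast
    qed
    moreover have "phi lam [ast] = 1"
      unfolding phi_def by (rule saw.limit_walk_prob_root[OF lam_pos e_root_pos])
    ultimately show ?thesis unfolding True by (simp add: tendsto_eventually)
  next
    case False
    have v: "v \<in> saw_tree" using saw.butlast_T[OF snoc.prems False] by simp
    have v_ne: "v \<noteq> []" using v saw_tree_hd by blast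
    have w: "?w \<in> children saw_tree v" using snoc.prems by (simp add: children_def)
    have phi_w: "phi lam ?w * sum e (children saw_tree v) = e ?w * phi lam v"
      "e ?w = 0 \<Longrightarrow> phi lam ?w = 0"
      unfolding phi_def using saw.limit_walk_prob_child[OF lam_pos e_root_pos v w] by blast+
    have good_w: "\<forall>\<^sub>F m in sequentially.
        phi_good lam m ?w * sum (em m) (children saw_tree v) = em m ?w * phi_good lam m v \<and>
        (em m ?w = 0 \<longrightarrow> phi_good lam m ?w = 0)"
      using em_root_pos
    proof eventually_elim
      case (elim m)
      interpret g: walk_tree "good_tree m" ast by (rule good_walk_tree) (use elim in simp)
      show ?case
      proof (cases "?w \<in> good_tree m")
        case True
        then have vg: "v \<in> good_tree m" using g.butlast_T[OF True False] by simp
        have wg: "?w \<in> children (good_tree m) v" using True by (simp add: children_def)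
        have pos: "0 < em m [ast]" using elim by blast
        show ?thesis
          using g.limit_walk_prob_child[OF lam_pos pos vg wg] unfolding phi_good_def sum_children_good by blast
      next
        case False
        have "phi_good lam m ?w = 0" unfolding phi_good_def by (rule g.limit_walk_prob_outside[OF False])
        then show ?thesis using esc_outside[OF False, of lam] by simp
      qed
    qed
    show ?thesis
    proof (cases "e ?w = 0")
      case True
      \<comment> \<open>A vertex without escape is handled apart, since the sum in the denominator
        may be 0; there the probabilities vanish on both sides.\<close>
      have "em m ?w = 0" for m using em_le_e[of m ?w] True by (simp add: order_antisym)
      then have "\<forall>\<^sub>F m in sequentially. phi_good lam m ?w = 0"
        using good_w by (simp add: eventually_conj_iff)
      then show ?thesis using phi_w(2)[OF True] by (simp add: tendsto_eventually)
    next
      case ew: False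
      have "e ?w \<le> sum e (children saw_tree v)"
        using w finite_saw_children by (intro member_le_sum) auto
      moreover have "0 < e ?w" using ew by (simp add: order_less_le)
      ultimately have s: "0 < sum e (children saw_tree v)" by linarith
      have sl: "(\<lambda>m. sum (em m) (children saw_tree v)) \<longlonglongrightarrow> sum e (children saw_tree v)"
        by (intro tendsto_sum em_tendsto_e) (simp add: children_def)
      have "(\<lambda>m. em m ?w * phi_good lam m v / sum (em m) (children saw_tree v))
          \<longlonglongrightarrow> e ?w * phi lam v / sum e (children saw_tree v)"
        using s by (intro tendsto_intros em_tendsto_e snoc sl v) auto
      moreover have "\<forall>\<^sub>F m in sequentially.
          em m ?w * phi_good lam m v / sum (em m) (children saw_tree v) = phi_good lam m ?w"
        using good_w order_tendstoD(1)[OF sl s]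
      proof eventually_elim
        case (elim m)
        then have "phi_good lam m ?w * sum (em m) (children saw_tree v) = em m ?w * phi_good lam m v" by blast
        then show ?case using elim(2) by (metis less_irrefl nonzero_mult_div_cancel_right)
      qed
      ultimately have "(\<lambda>m. phi_good lam m ?w) \<longlonglongrightarrow> e ?w * phi lam v / sum e (children saw_tree v)"
        by (rule Lim_transform_eventually)
      moreover have "e ?w * phi lam v / sum e (children saw_tree v) = phi lam ?w"
        using phi_w(1) s by (simp add: field_simps)
      ultimately show ?thesis by simp
    qed
  qed
qed

end

theorem theorem66:
  fixes k :: nat and \<gamma> :: "point list"
  assumes "k > 0"
    and "\<gamma> \<in> saw_tree"
    and "walk_length \<gamma> = k"
  shows "(\<forall>m\<ge>1. ((\<lambda>lam. phi_good lam m \<gamma>) \<longlongrightarrow> phi_crit m \<gamma>) (at_right (lambda_crit m)))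
    \<and> (\<lambda>m. phi_crit m \<gamma>) \<longlonglongrightarrow> phi_inf \<gamma>
    \<and> (\<forall>lam>inverse connective_constant. (\<lambda>m. phi_good lam m \<gamma>) \<longlonglongrightarrow> phi lam \<gamma>)"
proof (intro conjI allI impI)
  show "((\<lambda>lam. phi_good lam m \<gamma>) \<longlongrightarrow> phi_crit m \<gamma>) (at_right (lambda_crit m))" if "m \<ge> 1" for m
    by (rule critical_good_tree.phi_good_tendsto_phi_crit) (unfold_locales, rule that)
  have "\<gamma> \<noteq> [ast]" using assms(1,3) by (auto simp: walk_length_def)
  then show "(\<lambda>m. phi_crit m \<gamma>) \<longlonglongrightarrow> phi_inf \<gamma>" by (rule phi_crit_convergent[OF assms(2)])
  show "(\<lambda>m. phi_good lam m \<gamma>) \<longlonglongrightarrow> phi lam \<gamma>" if "lam > inverse connective_constant" for lam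
    by (rule supercritical.phi_good_tendsto_phi[OF _ assms(2)]) (unfold_locales, rule that)
qed

end
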